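(* Let $p\in(1,\infty)$ and let $u$ be a weak subsolution of $A_{\mu,p}u=0$ in $\Omega$. There exists a constant $C=C(N,p,\Sigma,\mu)>0$ such that $$\operatorname*{ess\,sup}_{B_{\frac r2}(x_0)}u\leq\delta\operatorname{Tail}\left(u_+;x_0,\frac r2\right)+C\delta^{-\frac{(p-1)\eta}{(\eta-1)p}}\left(\frac1{|B_r(x_0)|}\int_{B_r(x_0)}u_+^p\,dx\right)^{\frac1p},$$ whenever $B_r(x_0)\subset\Omega$ with $r\in(0,1]$ and $\delta\in(0,1]$.
   Context: Let $p\in(1,\infty)$ and let $\Omega\subset\mathbb{R}^N$ be a bounded domain. $\mu$ is a nonnegative finite Borel measure on $[0,1]$, nontrivial on $(0,1)$, with $\mu(\{0\})=0$ and $\alpha:=\mu(\{1\})>0$; $\Sigma:=\operatorname{supp}(\mu)$. $B_r(x_0)$ is the open ball of radius $r$ centered at $x_0$, and $u_+:=\max\{u,0\}$. The exponent $\eta$ is $\eta=\frac N{N-p}$ if $p\in(1,N)$ and $\eta=2$ if $p\in[N,\infty)$. The operator is $A_{\mu,p}u=\int_{(0,1)}(-\Delta)_p^su\,d\mu(s)-\alpha\Delta_pu$ (fractional $p$-Laplacians and the $p$-Laplacian $\Delta_pu=\operatorname{div}(|\nabla u|^{p-2}\nabla u)$); (sub)solutions are understood in the weak sense defined below. For $s\in(0,1)$ the normalization constant is $$C_{N,p,s}=\frac{\frac{sp}{2}(1-s)2^{2s-1}}{\pi^{\frac{N-1}{2}}}\,\frac{\Gamma\left(\frac{N+ps}{2}\right)}{\Gamma\left(\frac{p+1}{2}\right)\Gamma(2-s)}.$$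 Tail: for $u\in L^{p-1}_{loc}(\mathbb{R}^N)$, $$\operatorname{Tail}(u;x_0,r)=\left[\int_{(0,1)}C_{N,p,s}\,r^{p}\left(\int_{\mathbb{R}^N\setminus B_r(x_0)}\frac{|u(y)|^{p-1}}{|y-x_0|^{N+sp}}\,dy\right)d\mu(s)\right]^{\frac1{p-1}}.$$ Tail space: $L^{p-1}_{sp,\mu}(\mathbb{R}^N)=\{u\in L^{p-1}_{loc}(\mathbb{R}^N):\operatorname{Tail}(u;x,r)<\infty\ \forall x\in\mathbb{R}^N,\ \forall r\in(0,\infty)\}$. For a bounded domain $\Omega'$, $W_0^{1,p}(\Omega')=\{v\in W^{1,p}(\Omega'):v=0\text{ in }\mathbb{R}^N\setminus\Omega'\}$. A function $u\in W^{1,p}_{loc}(\Omega)\cap L^{p-1}_{sp,\mu}(\mathbb{R}^N)$ is a weak subsolution of $A_{\mu,p}u=0$ in $\Omega$ if for every $\Omega'\Subset\Omega$ and every nonnegative $v\in W_0^{1,p}(\Omega')$ $$\int_{(0,1)}C_{N,p,s}\iint_{\mathbb{R}^{2N}}\frac{|u(x)-u(y)|^{p-2}(u(x)-u(y))(v(x)-v(y))}{|x-y|^{N+sp}}\,dx\,dy\,d\mu(s)+\alpha\int_\Omega|\nabla u|^{p-2}\nabla u\cdot\nabla v\,dx\leq0.$$ *)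

theory Defs
  imports "HOL-Analysis.Analysis" "HOL-Probability.Essential_Supremum"
begin

definition bounded_domain :: "'a::euclidean_space set \<Rightarrow> bool" where
  "bounded_domain S \<longleftrightarrow> open S \<and> connected S \<and> S \<noteq> {} \<and> bounded S"

text \<open>Functions live on the whole space; membership in \<open>L\<^sup>q(S)\<close> only concerns the values on \<open>S\<close>.
  Any \<open>q > 0\<close> is allowed, since the exponent \<open>p - 1\<close> may be below \<open>1\<close>.\<close>

definition Lp :: "real \<Rightarrow> 'a::euclidean_space set \<Rightarrow> ('a \<Rightarrow> 'b::euclidean_space) \<Rightarrow> bool" where
  "Lp q S f \<longleftrightarrow> f \<in> borel_measurable (lebesgue_on S) \<and>
     integrable (lebesgue_on S) (\<lambda>x. norm (f x) powr q)"

definition Lp_loc :: "real \<Rightarrow> 'a::euclidean_space set \<Rightarrow> ('a \<Rightarrow> 'b::euclidean_space) \<Rightarrow> bool" where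
  "Lp_loc q S f \<longleftrightarrow> (\<forall>K. compact K \<and> K \<subseteq> S \<longrightarrow> Lp q K f)"

fun C_order :: "nat \<Rightarrow> ('a::euclidean_space \<Rightarrow> real) \<Rightarrow> bool" where
  "C_order 0 f \<longleftrightarrow> continuous_on UNIV f"
| "C_order (Suc k) f \<longleftrightarrow>
     (\<exists>Df. (\<forall>x. GDERIV f x :> Df x) \<and> (\<forall>b\<in>Basis. C_order k (\<lambda>x. Df x \<bullet> b)))"

definition test_function :: "'a::euclidean_space set \<Rightarrow> ('a \<Rightarrow> real) \<Rightarrow> bool" where
  "test_function S \<phi> \<longleftrightarrow> (\<forall>k. C_order k \<phi>) \<and>
     compact (closure {x. \<phi> x \<noteq> 0}) \<and> closure {x. \<phi> x \<noteq> 0} \<subseteq> S"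

text \<open>The integration-by-parts identity is written as one vector equation, which comprises
  the identities for all partial derivatives.\<close>

definition has_weak_gradient ::
    "'a::euclidean_space set \<Rightarrow> ('a \<Rightarrow> real) \<Rightarrow> ('a \<Rightarrow> 'a) \<Rightarrow> bool" where
  "has_weak_gradient S u g \<longleftrightarrow> Lp_loc 1 S u \<and> Lp_loc 1 S g \<and>
     (\<forall>\<phi> D\<phi>. test_function S \<phi> \<and> (\<forall>x. GDERIV \<phi> x :> D\<phi> x) \<longrightarrow>
        (\<integral>x. u x *\<^sub>R D\<phi> x \<partial>lebesgue_on S) = - (\<integral>x. \<phi> x *\<^sub>R g x \<partial>lebesgue_on S))"

text \<open>On an open set the weak gradient is unique up to null sets, so the choice is immaterial
  under integrals.\<close>

definition weak_gradient :: "'a::euclidean_space set \<Rightarrow> ('a \<Rightarrow> real) \<Rightarrow> 'a \<Rightarrow> 'a" where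
  "weak_gradient S u = (SOME g. has_weak_gradient S u g)"

definition W1p :: "real \<Rightarrow> 'a::euclidean_space set \<Rightarrow> ('a \<Rightarrow> real) \<Rightarrow> bool" where
  "W1p p S u \<longleftrightarrow> Lp p S u \<and> (\<exists>g. has_weak_gradient S u g \<and> Lp p S g)"

definition W1p_loc :: "real \<Rightarrow> 'a::euclidean_space set \<Rightarrow> ('a \<Rightarrow> real) \<Rightarrow> bool" where
  "W1p_loc p S u \<longleftrightarrow> Lp_loc p S u \<and> (\<exists>g. has_weak_gradient S u g \<and> Lp_loc p S g)"

text \<open>Zero boundary values are expressed through the extension by zero: \<open>v\<close> is a Sobolev function
  on the whole space that vanishes outside \<open>S\<close>.  Asking for weak differentiability on \<open>S\<close> only
  would admit functions with a jump across the boundary, such as the indicator of \<open>S\<close>.\<close>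

definition W1p_zero :: "real \<Rightarrow> 'a::euclidean_space set \<Rightarrow> ('a \<Rightarrow> real) \<Rightarrow> bool" where
  "W1p_zero p S v \<longleftrightarrow> W1p p UNIV v \<and> (AE x in lebesgue. x \<notin> S \<longrightarrow> v x = 0)"

definition frac_const :: "nat \<Rightarrow> real \<Rightarrow> real \<Rightarrow> real" where
  "frac_const N p s =
     (s * p / 2 * (1 - s) * 2 powr (2 * s - 1)) / (pi powr ((real N - 1) / 2)) *
     (Gamma ((real N + p * s) / 2) / (Gamma ((p + 1) / 2) * Gamma (2 - s)))"

text \<open>Real powers of extended nonnegative numbers; only used with \<open>a > 0\<close>.\<close>

definition ennreal_powr :: "ennreal \<Rightarrow> real \<Rightarrow> ennreal" where
  "ennreal_powr t a = (if t = \<infinity> then \<infinity> else ennreal (enn2real t powr a))"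

definition Tail ::
    "real measure \<Rightarrow> real \<Rightarrow> ('a::euclidean_space \<Rightarrow> real) \<Rightarrow> 'a \<Rightarrow> real \<Rightarrow> ennreal" where
  "Tail \<mu> p u x0 r =
     ennreal_powr
       (\<integral>\<^sup>+s\<in>{0<..<1}. ennreal (frac_const DIM('a) p s * r powr p) *
          (\<integral>\<^sup>+y\<in>- ball x0 r.
             ennreal (\<bar>u y\<bar> powr (p - 1) / norm (y - x0) powr (real DIM('a) + s * p)) \<partial>lebesgue) \<partial>\<mu>)
       (1 / (p - 1))"

definition tail_space :: "real measure \<Rightarrow> real \<Rightarrow> ('a::euclidean_space \<Rightarrow> real) \<Rightarrow> bool" where
  "tail_space \<mu> p u \<longleftrightarrow> Lp_loc (p - 1) UNIV u \<and> (\<forall>x r. 0 < r \<longrightarrow> Tail \<mu> p u x r < \<infinity>)"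

text \<open>The map \<open>\<xi> \<mapsto> |\<xi>|\<^sup>p\<^sup>-\<^sup>2 \<xi>\<close>, with value \<open>0\<close> at \<open>\<xi> = 0\<close> for every \<open>p > 1\<close>.\<close>

definition p_flux :: "real \<Rightarrow> 'b::real_normed_vector \<Rightarrow> 'b" where
  "p_flux p \<xi> = norm \<xi> powr (p - 2) *\<^sub>R \<xi>"

definition nonlocal_form ::
    "real measure \<Rightarrow> real \<Rightarrow> ('a::euclidean_space \<Rightarrow> real) \<Rightarrow> ('a \<Rightarrow> real) \<Rightarrow> real" where
  "nonlocal_form \<mu> p u v =
     (LINT s:{0<..<1}|\<mu>. frac_const DIM('a) p s *
        (\<integral>(x, y). p_flux p (u x - u y) * (v x - v y) /
             norm (x - y) powr (real DIM('a) + s * p) \<partial>(lebesgue :: ('a \<times> 'a) measure)))"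

definition local_form ::
    "real \<Rightarrow> 'a::euclidean_space set \<Rightarrow> ('a \<Rightarrow> real) \<Rightarrow> ('a \<Rightarrow> real) \<Rightarrow> real" where
  "local_form p S u v =
     (\<integral>x. p_flux p (weak_gradient S u x) \<bullet> weak_gradient UNIV v x \<partial>lebesgue_on S)"

text \<open>For \<open>u\<close> and \<open>v\<close> as below, both integrals in the inequality converge absolutely (for the
  inner double integral: for almost every \<open>s\<close>), so the default value of the Bochner integral
  plays no role.\<close>

definition weak_subsolution ::
    "real measure \<Rightarrow> real \<Rightarrow> 'a::euclidean_space set \<Rightarrow> ('a \<Rightarrow> real) \<Rightarrow> bool" where
  "weak_subsolution \<mu> p S u \<longleftrightarrow>
     W1p_loc p S u \<and> tail_space \<mu> p u \<and>
     (\<forall>S' v. bounded_domain S' \<and> closure S' \<subseteq> S \<and> W1p_zero p S' v \<and> (AE x in lebesgue. 0 \<le> v x) \<longrightarrow>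
        nonlocal_form \<mu> p u v + measure \<mu> {1} * local_form p S u v \<le> 0)"

definition sobolev_eta :: "nat \<Rightarrow> real \<Rightarrow> real" where
  "sobolev_eta N p = (if p < real N then real N / (real N - p) else 2)"

text \<open>The \<open>L\<^sup>p\<close> average is extended-valued: a ball that touches the boundary of the domain may
  carry infinite mass.\<close>

definition Lp_average :: "real \<Rightarrow> 'a::euclidean_space set \<Rightarrow> ('a \<Rightarrow> real) \<Rightarrow> ennreal" where
  "Lp_average p B f =
     ennreal_powr ((\<integral>\<^sup>+x\<in>B. ennreal (\<bar>f x\<bar> powr p) \<partial>lebesgue) / emeasure lebesgue B) (1 / p)"

end

theory Submission
  imports Defs
begin

text \<open>The proof is a De Giorgi iteration.  Testing with \<open>(u - k)\<^sub>+ \<phi>\<^sup>m\<close> bounds the \<open>L\<^sup>p\<close> norm of the gradient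
  of this function by the \<open>L\<^sup>p\<close> norm of \<open>(u - k)\<^sub>+\<close> on a larger ball and a tail term; near the diagonal the
  nonlocal form is bounded below pointwise, and the factor \<open>1 - s\<close> in the normalization constant compensates
  the singularity of the kernel as \<open>s \<rightarrow> 1\<close>.  The Sobolev inequality enters only through the Faber-Krahn type
  consequence \<open>\<parallel>v\<parallel>\<^sub>p \<le> c |{v \<noteq> 0}|\<^bsup>1/N\<^esup> \<parallel>\<nabla>v\<parallel>\<^sub>p\<close>, which follows by averaging the translation estimate
  \<open>\<parallel>v(\<cdot> + h) - v\<parallel>\<^sub>p \<le> |h| \<parallel>\<nabla>v\<parallel>\<^sub>p\<close> over a ball of shifts.  The exponent \<open>p/N\<close> it yields is used for all
  \<open>p\<close>; for \<open>p \<ge> N\<close> the resulting power of \<open>\<delta>\<close> is better than the one claimed.\<close>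

section \<open>Smooth cutoff functions\<close>

text \<open>Three features of the definitions shape the proof: \<open>weak_gradient\<close> is a
  choice determined only up to null sets, functions are merely Lebesgue measurable, and divergent
  Bochner integrals have the value 0. So every Sobolev function is cut off and replaced by a Borel
  representative on the whole space that has directional derivatives, and the nonlocal form is
  bounded below through the nonnegative integral of its negative part, for which a default value
  does no harm. The exponent m of the cutoff is an integer with m \<ge> p. Then \<phi>^(m-1) \<le>
  \<phi>^(p-1), which lets the derivative of the cutoff be absorbed for all p > 1 at once. The
  condition r \<le> 1 enters because the part of order s scales like r^(-sp), which is then at most
  r^(-p). Positivity of \<alpha> is what yields control of a full gradient. The tail becomes
  harmless when the final level is at least \<delta> times the tail; the price is a factor
  \<delta>^(1-p), which for p < N is exactly what fixes the power of \<delta> in the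
  statement.\<close>

lemma GDERIV_inner_left: "GDERIV (\<lambda>x. (x - x0) \<bullet> v) x :> (v::'a::euclidean_space)"
  unfolding gderiv_def by (auto intro!: derivative_eq_intros)

lemma GDERIV_continuous: "GDERIV f x :> D \<Longrightarrow> isCont f x"
  unfolding gderiv_def by (rule has_derivative_continuous)

lemma GDERIV_unique: "GDERIV f x :> D \<Longrightarrow> GDERIV f x :> D' \<Longrightarrow> D = D'"
  unfolding gderiv_def by (metis has_derivative_unique inner_commute vector_eq_rdot)

section \<open>Calculus of the classes of k times differentiable functions\<close>

lemma C_order_SucD: "C_order (Suc k) f \<Longrightarrow> C_order k f"
proof (induction k arbitrary: f)
  case 0
  then obtain Df where "\<And>x. GDERIV f x :> Df x" by auto
  then show ?case by (auto intro!: continuous_at_imp_continuous_on intro: GDERIV_continuous)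
next
  case (Suc k)
  from Suc.prems obtain Df where "\<forall>x. GDERIV f x :> Df x" "\<forall>b\<in>Basis. C_order (Suc k) (\<lambda>x. Df x \<bullet> b)"
    by (subst (asm) C_order.simps) blast
  with Suc.IH show ?case by auto
qed

lemma C_order_const: "C_order k (\<lambda>x::'a::euclidean_space. c)"
proof (induction k arbitrary: c)
  case (Suc k)
  show ?case by (simp, rule exI[of _ "\<lambda>_. 0"]) (auto simp: Suc GDERIV_const)
qed auto

lemma C_order_affine: "C_order k (\<lambda>x::'a::euclidean_space. (x - x0) \<bullet> v)"
proof (cases k)
  case (Suc j)
  show ?thesis unfolding Suc C_order.simps
    by (rule exI[of _ "\<lambda>_. v"]) (auto simp: C_order_const GDERIV_inner_left)
qed (auto intro!: continuous_intros)

lemma C_order_add: "C_order k f \<Longrightarrow> C_order k g \<Longrightarrow> C_order k (\<lambda>x. f x + g x)"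
proof (induction k arbitrary: f g)
  case (Suc k)
  obtain Df Dg where "\<forall>x. GDERIV f x :> Df x" "\<forall>b\<in>Basis. C_order k (\<lambda>x. Df x \<bullet> b)"
     "\<forall>x. GDERIV g x :> Dg x" "\<forall>b\<in>Basis. C_order k (\<lambda>x. Dg x \<bullet> b)"
    using Suc.prems by auto
  then show ?case
    by (simp, intro exI[of _ "\<lambda>x. Df x + Dg x"]) (auto simp: inner_add_left intro: Suc.IH GDERIV_add)
qed (auto intro: continuous_intros)

lemma C_order_mult: "C_order k f \<Longrightarrow> C_order k g \<Longrightarrow> C_order k (\<lambda>x. f x * g x)"
proof (induction k arbitrary: f g)
  case (Suc k)
  obtain Df Dg where D: "\<forall>x. GDERIV f x :> Df x" "\<forall>b\<in>Basis. C_order k (\<lambda>x. Df x \<bullet> b)"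
     "\<forall>x. GDERIV g x :> Dg x" "\<forall>b\<in>Basis. C_order k (\<lambda>x. Dg x \<bullet> b)"
    using Suc.prems by auto
  have fg: "C_order k f" "C_order k g" using Suc.prems C_order_SucD by auto
  show ?case unfolding C_order.simps
    by (intro exI[of _ "\<lambda>x. f x *\<^sub>R Dg x + g x *\<^sub>R Df x"])
       (use D fg in \<open>auto simp: inner_add_left intro!: Suc.IH GDERIV_mult C_order_add\<close>)
qed (auto intro: continuous_intros)

lemma C_order_cmult: "C_order k f \<Longrightarrow> C_order k (\<lambda>x. c * f x)"
  by (rule C_order_mult[OF C_order_const])

lemma C_order_diff: "C_order k f \<Longrightarrow> C_order k g \<Longrightarrow> C_order k (\<lambda>x. f x - g x)"
  using C_order_add[of k f "\<lambda>x. (-1) * g x"] C_order_cmult[of k g "-1"] by simp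

lemma C_order_sum: "(\<And>i. i \<in> I \<Longrightarrow> C_order k (f i)) \<Longrightarrow> C_order k (\<lambda>x. \<Sum>i\<in>I. f i x)"
  by (induction I rule: infinite_finite_induct) (auto intro: C_order_const C_order_add)

lemma C_order_prod: "(\<And>i. i \<in> I \<Longrightarrow> C_order k (f i)) \<Longrightarrow> C_order k (\<lambda>x. \<Prod>i\<in>I. f i x)"
  by (induction I rule: infinite_finite_induct) (auto intro: C_order_const C_order_mult)

lemma C_order_power: "C_order k f \<Longrightarrow> C_order k (\<lambda>x. f x ^ n)"
  by (induction n) (auto intro: C_order_const C_order_mult)

text \<open>The outer function is given together with all its derivatives as one sequence. The
  induction on \<open>k\<close> then trades one order of the composite for the step from
  \<open>H j\<close> to \<open>H (Suc j)\<close>.\<close>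

lemma C_order_compose:
  fixes H :: "nat \<Rightarrow> real \<Rightarrow> real"
  assumes H: "\<And>j t. DERIV (H j) t :> H (Suc j) t"
  shows "C_order k f \<Longrightarrow> C_order k (\<lambda>x. H j (f x))"
proof (induction k arbitrary: f j)
  case 0
  have "continuous_on UNIV (H j)"
    using H DERIV_isCont continuous_at_imp_continuous_on by blast
  then show ?case using 0 by (auto intro: continuous_on_compose2)
next
  case (Suc k)
  obtain Df where D: "\<forall>x. GDERIV f x :> Df x" "\<forall>b\<in>Basis. C_order k (\<lambda>x. Df x \<bullet> b)"
    using Suc.prems by auto
  have f: "C_order k f" using Suc.prems C_order_SucD by auto
  show ?case unfolding C_order.simps
    by (intro exI[of _ "\<lambda>x. H (Suc j) (f x) *\<^sub>R Df x"])
      (use D f H in \<open>auto intro!: Suc.IH C_order_mult intro: GDERIV_DERIV_compose[of f _ _ "H j"]\<close>)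
qed

text \<open>The functions \<open>t \<mapsto> P(1/t) exp(-1/t)\<close>, extended by zero to \<open>t \<le> 0\<close>, are closed under differentiation.\<close>

definition exp_bump :: "real poly \<Rightarrow> real \<Rightarrow> real" where
  "exp_bump P t = (if 0 < t then poly P (1/t) * exp (- (1/t)) else 0)"

lemma poly_exp_tendsto_0: "((\<lambda>x::real. poly P x * exp (-x)) \<longlongrightarrow> 0) at_top"
proof -
  have "((\<lambda>x. \<Sum>i\<le>degree P. coeff P i * (x ^ i / exp x)) \<longlongrightarrow> (\<Sum>i\<le>degree P. coeff P i * 0)) at_top"
    by (intro tendsto_sum tendsto_mult tendsto_const tendsto_power_div_exp_0)
  moreover have "(\<Sum>i\<le>degree P. coeff P i * (x ^ i / exp x)) = poly P x * exp (-x)" for x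
    by (simp add: poly_altdef sum_distrib_right exp_minus divide_inverse mult.assoc)
  ultimately show ?thesis by simp
qed

text \<open>With s = 1/t one has ds/dt = -s^2, so P(s) exp(-s) has the derivative s^2 (P(s) - P'(s))
  exp(-s); the factor \<open>[:0,0,1:]\<close> is the monomial s^2. At t = 0 the right difference
  quotient is s P(s) exp(-s), which tends to 0 as s tends to infinity.\<close>

lemma DERIV_exp_bump: "DERIV (exp_bump P) t :> exp_bump ([:0,0,1:] * (P - pderiv P)) t"
proof (cases t "0::real" rule: linorder_cases)
  case less
  have "DERIV (\<lambda>_. 0) t :> (0::real)" by simp
  moreover have ev: "eventually (\<lambda>x. 0 = exp_bump P x) (nhds t)"
    using eventually_nhds_in_open[OF open_lessThan[of 0], of t] less
    by (auto elim!: eventually_mono simp: exp_bump_def)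
  ultimately have "DERIV (exp_bump P) t :> 0" using DERIV_cong_ev[OF refl ev refl] by simp
  then show ?thesis using less by (simp add: exp_bump_def)
next
  case greater
  have "DERIV (\<lambda>t. poly P (1/t) * exp (- (1/t))) t :> exp_bump ([:0,0,1:] * (P - pderiv P)) t"
    unfolding exp_bump_def using greater
    by (auto intro!: derivative_eq_intros DERIV_chain2[OF poly_DERIV]) (simp add: field_simps power2_eq_square)
  moreover have ev: "eventually (\<lambda>x. poly P (1/x) * exp (- (1/x)) = exp_bump P x) (nhds t)"
    using eventually_nhds_in_open[OF open_greaterThan[of 0], of t] greater
    by (auto elim!: eventually_mono simp: exp_bump_def)
  ultimately show ?thesis using DERIV_cong_ev[OF refl ev refl] by simp
next
  case equal
  have "((\<lambda>h. poly (pCons 0 P) (inverse h) * exp (- inverse h)) \<longlongrightarrow> 0) (at_right (0::real))"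
    using filterlim_compose[OF poly_exp_tendsto_0 filterlim_inverse_at_top_right] by blast
  then have "((\<lambda>h. exp_bump P h / h) \<longlongrightarrow> 0) (at_right 0)"
    by (rule Lim_transform_eventually)
      (auto simp: exp_bump_def eventually_at_filter field_simps)
  moreover have "((\<lambda>h. exp_bump P h / h) \<longlongrightarrow> 0) (at_left 0)"
    by (rule tendsto_eventually) (auto simp: exp_bump_def eventually_at_filter)
  ultimately have "((\<lambda>h. exp_bump P h / h) \<longlongrightarrow> 0) (at 0)"
    using filterlim_split_at by blast
  then show ?thesis using equal by (auto simp: DERIV_def exp_bump_def)
qed

lemma C_order_exp_bump: "C_order k f \<Longrightarrow> C_order k (\<lambda>x. exp_bump P (f x))"
proof -
  define H where "H j = exp_bump (((\<lambda>P. [:0,0,1:] * (P - pderiv P)) ^^ j) P)" for j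
  have "DERIV (H j) t :> H (Suc j) t" for j t
    unfolding H_def using DERIV_exp_bump by simp
  from C_order_compose[of H, OF this, of k f 0] show "C_order k f \<Longrightarrow> ?thesis" by (simp add: H_def)
qed

definition bump :: "real \<Rightarrow> real" where "bump = exp_bump 1"

lemma bump_eq: "bump t = (if 0 < t then exp (- (1/t)) else 0)"
  by (simp add: bump_def exp_bump_def)

lemma bump_bounds: "0 \<le> bump t" "bump t \<le> 1" "0 < bump t \<longleftrightarrow> 0 < t"
  by (auto simp: bump_eq)

lemma C_order_bump: "C_order k f \<Longrightarrow> C_order k (\<lambda>x. bump (f x))"
  unfolding bump_def by (rule C_order_exp_bump)

definition bump' :: "real \<Rightarrow> real" where "bump' = exp_bump ([:0,0,1:] * (1 - pderiv 1))"

lemma DERIV_bump: "DERIV bump t :> bump' t"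
  unfolding bump_def bump'_def by (rule DERIV_exp_bump)

lemma bump'_bound: "\<bar>bump' t\<bar> \<le> 4"
proof (cases "0 < t")
  case True
  define s where "s = 1/t"
  have s: "0 < s" using True by (simp add: s_def)
  \<comment> \<open>Squaring s/2 \<le> exp(s/2) gives s^2 exp(-s) \<le> 4, the source of the
    constant.\<close>
  have "s/2 \<le> exp (s/2)" using exp_ge_add_one_self[of "s/2"] by linarith
  then have "(s/2)\<^sup>2 \<le> (exp (s/2))\<^sup>2" using s by (intro power_mono) auto
  then have "s\<^sup>2 \<le> 4 * exp s" by (simp add: power_divide flip: exp_double)
  then have "s\<^sup>2 * exp (-s) \<le> 4" by (simp add: exp_minus field_simps)
  moreover have "bump' t = s\<^sup>2 * exp (-s)"
    using True by (simp add: bump'_def exp_bump_def s_def power2_eq_square)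
  ultimately show ?thesis by simp
qed (simp add: bump'_def exp_bump_def)

lemma bump'_nonpos: "t \<le> 0 \<Longrightarrow> bump' t = 0"
  by (simp add: bump'_def exp_bump_def)

text \<open>The factors \<open>exp 1\<close> normalize \<open>exp 1 * bump 1 = 1\<close>, which makes the step exactly constant outside \<open>{0..1}\<close>.\<close>

definition smooth_step :: "real \<Rightarrow> real" where "smooth_step t = 1 - exp 1 * bump (1 - exp 1 * bump t)"

lemma smooth_step_eq_0: "t \<le> 0 \<Longrightarrow> smooth_step t = 0"
  by (simp add: smooth_step_def bump_eq flip: exp_add)

lemma smooth_step_eq_1: "1 \<le> t \<Longrightarrow> smooth_step t = 1"
proof -
  assume "1 \<le> t"
  then have "exp 1 * bump t \<ge> 1" by (simp add: bump_eq flip: exp_add)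
  then show ?thesis by (simp add: smooth_step_def bump_eq)
qed

lemma smooth_step_bounds: "0 \<le> smooth_step t" "smooth_step t \<le> 1"
proof -
  \<comment> \<open>The argument of the outer \<open>bump\<close> is at most 1, where exp(-1/s) is
    at most exp(-1); this gives the lower bound 0.\<close>
  have "bump (1 - exp 1 * bump t) \<le> exp (-1)"
  proof (cases "1 - exp 1 * bump t > 0")
    case True
    have "1 \<le> 1 / (1 - exp 1 * bump t)" using True bump_bounds(1)[of t] by (simp add: field_simps)
    then show ?thesis using True by (simp add: bump_eq)
  qed (simp add: bump_eq)
  then have "exp 1 * bump (1 - exp 1 * bump t) \<le> exp 1 * exp (-1)" by (intro mult_left_mono) auto
  then show "0 \<le> smooth_step t" by (simp add: smooth_step_def flip: exp_add)
  show "smooth_step t \<le> 1" using bump_bounds(1) by (simp add: smooth_step_def)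
qed

section \<open>Test functions and explicit cutoffs\<close>

lemma test_functionD:
  assumes "test_function S \<phi>" "\<And>x. GDERIV \<phi> x :> D x"
  shows "continuous_on UNIV \<phi>" "continuous_on UNIV D" "compact (closure {x. \<phi> x \<noteq> 0})"
    "closure {x. \<phi> x \<noteq> 0} \<subseteq> S" "\<And>x. x \<notin> closure {x. \<phi> x \<noteq> 0} \<Longrightarrow> \<phi> x = 0"
    "\<And>x. x \<notin> closure {x. \<phi> x \<noteq> 0} \<Longrightarrow> D x = 0" "\<And>k. C_order k \<phi>"
proof -
  show *: "\<And>k. C_order k \<phi>" "compact (closure {x. \<phi> x \<noteq> 0})" "closure {x. \<phi> x \<noteq> 0} \<subseteq> S"
    using assms(1) unfolding test_function_def by blast+
  from *(1)[of 0] show "continuous_on UNIV \<phi>" by simp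
  from *(1)[of "Suc 0"] obtain D' where D': "\<And>x. GDERIV \<phi> x :> D' x"
    "\<forall>b\<in>Basis. continuous_on UNIV (\<lambda>x. D' x \<bullet> b)" unfolding C_order.simps by blast
  \<comment> \<open>Continuity is known for the gradient hidden in \<open>C_order\<close>;
    uniqueness of gradients transfers it to the given \<open>D\<close>.\<close>
  then have "D' = D" using GDERIV_unique[OF D'(1) assms(2)] by (intro ext)
  then show "continuous_on UNIV D" using D'(2) by (subst continuous_on_componentwise) simp
  show "\<phi> x = 0" if "x \<notin> closure {x. \<phi> x \<noteq> 0}" for x
    using that closure_subset[of "{x. \<phi> x \<noteq> 0}"] by auto
  show "D x = 0" if x: "x \<notin> closure {x. \<phi> x \<noteq> 0}" for x
  proof -
    have "((\<lambda>_. 0) has_derivative (\<lambda>h. h \<bullet> 0)) (at x)" by simp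
    then have "(\<phi> has_derivative (\<lambda>h. h \<bullet> 0)) (at x)"
    proof (rule has_derivative_transform_within_open)
      show "open (- closure {x. \<phi> x \<noteq> 0})" by (intro open_Compl closed_closure)
      show "x \<in> - closure {x. \<phi> x \<noteq> 0}" using x by simp
      show "0 = \<phi> y" if "y \<in> - closure {x. \<phi> x \<noteq> 0}" for y
        using that closure_subset[of "{x. \<phi> x \<noteq> 0}"] by auto
    qed
    then show ?thesis using GDERIV_unique[OF assms(2)] unfolding gderiv_def by blast
  qed
qed

lemma test_function_obtain:
  assumes "test_function S \<phi>"
  obtains D where "\<And>x. GDERIV \<phi> x :> D x"
proof -
  have "C_order (Suc 0) \<phi>" using assms unfolding test_function_def by blast
  then show ?thesis using that by auto
qed

lemma test_function_bounded:
  assumes "test_function S \<phi>" "\<And>x. GDERIV \<phi> x :> D x"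
  obtains B where "\<And>x. \<bar>\<phi> x\<bar> \<le> B" "\<And>x. norm (D x) \<le> B" "0 < B"
proof -
  let ?K = "closure {x. \<phi> x \<noteq> 0}"
  note t = test_functionD[OF assms]
  have "bounded (\<phi> ` ?K)" "bounded (D ` ?K)"
    by (intro compact_imp_bounded compact_continuous_image t(3)
        continuous_on_subset[OF t(1)] continuous_on_subset[OF t(2)] subset_UNIV)+
  then obtain B1 B2 where B: "\<And>x. x \<in> ?K \<Longrightarrow> \<bar>\<phi> x\<bar> \<le> B1" "\<And>x. x \<in> ?K \<Longrightarrow> norm (D x) \<le> B2"
    unfolding bounded_iff by auto
  show ?thesis
  proof (rule that[of "max 1 (max B1 B2)"])
    fix x
    show "\<bar>\<phi> x\<bar> \<le> max 1 (max B1 B2)" "norm (D x) \<le> max 1 (max B1 B2)"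
      using B[of x] t(5,6)[of x] by (cases "x \<in> ?K"; force)+
  qed auto
qed

lemma test_function_mult:
  assumes "test_function S \<phi>" "\<And>k. C_order k \<psi>"
  shows "test_function S (\<lambda>x. \<phi> x * \<psi> x)"
proof -
  have "closure {x. \<phi> x * \<psi> x \<noteq> 0} \<subseteq> closure {x. \<phi> x \<noteq> 0}" by (intro closure_mono) auto
  moreover have "compact (closure {x. \<phi> x * \<psi> x \<noteq> 0})"
    using closed_Int_compact[OF closed_closure, of "closure {x. \<phi> x \<noteq> 0}" "{x. \<phi> x * \<psi> x \<noteq> 0}"] assms(1) calculation
    unfolding test_function_def by (simp add: Int_absorb2)
  ultimately show ?thesis using assms C_order_mult unfolding test_function_def by blast
qed

lemma test_function_compactI:
  assumes "\<And>k. C_order k \<phi>" "\<And>x. x \<notin> K \<Longrightarrow> \<phi> x = 0" "compact K" "K \<subseteq> S"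
  shows "test_function S \<phi>"
proof -
  have "closure {x. \<phi> x \<noteq> 0} \<subseteq> K"
    using assms by (intro closure_minimal) (auto simp: compact_imp_closed)
  moreover from this have "compact (closure {x. \<phi> x \<noteq> 0})"
    using closed_Int_compact[OF closed_closure, of K "{x. \<phi> x \<noteq> 0}"] assms(3) by (simp add: Int_absorb2)
  ultimately show ?thesis using assms unfolding test_function_def by blast
qed

text \<open>The step is applied to the quadratic f(x) = (b^2 - |x - x0|^2) / (b^2 - a^2), which is
  at least 1 on the inner ball and at most 0 outside the outer one; unlike the norm it is smooth at
  the centre. In the constant 32 exp 2, the two \<open>bump'\<close> bounds give 4 * 4, the two
  normalizing factors give exp 2, and the gradient of f gives 2.\<close>

lemma cutoff_exists:
  fixes x0 :: "'a::euclidean_space"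
  assumes ab: "0 \<le> a" "a < b" "cball x0 b \<subseteq> S"
  obtains \<eta> D where "test_function S \<eta>" "\<And>x. GDERIV \<eta> x :> D x" "\<And>x. 0 \<le> \<eta> x" "\<And>x. \<eta> x \<le> 1"
    "\<And>x. x \<in> cball x0 a \<Longrightarrow> \<eta> x = 1" "\<And>x. x \<notin> ball x0 b \<Longrightarrow> \<eta> x = 0"
    "\<And>x. norm (D x) \<le> 32 * exp 2 / (b - a)"
proof -
  have pos: "0 < b\<^sup>2 - a\<^sup>2" using ab by (simp add: power_strict_mono)
  define f where "f x = (1 / (b\<^sup>2 - a\<^sup>2)) * (b\<^sup>2 - (\<Sum>e\<in>Basis. ((x - x0) \<bullet> e) * ((x - x0) \<bullet> e)))" for x
  have f: "f x = (b\<^sup>2 - (norm (x - x0))\<^sup>2) / (b\<^sup>2 - a\<^sup>2)" for x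
    by (simp add: f_def power2_norm_eq_inner euclidean_inner[of "x - x0" "x - x0"])
  have Cf: "C_order k f" for k
    unfolding f_def by (intro C_order_cmult C_order_diff C_order_const C_order_sum C_order_mult C_order_affine)
  define Df where "Df x = (- 2 / (b\<^sup>2 - a\<^sup>2)) *\<^sub>R (x - x0)" for x
  have Df: "GDERIV f x :> Df x" for x
  proof -
    have "f = (\<lambda>x. (1 / (b\<^sup>2 - a\<^sup>2)) * (b\<^sup>2 - (x - x0) \<bullet> (x - x0)))"
      by (auto simp: f power2_norm_eq_inner)
    moreover have "((\<lambda>x. (1 / (b\<^sup>2 - a\<^sup>2)) * (b\<^sup>2 - (x - x0) \<bullet> (x - x0))) has_derivative
      (\<lambda>h. (1 / (b\<^sup>2 - a\<^sup>2)) * (0 - ((x - x0) \<bullet> (h - 0) + (h - 0) \<bullet> (x - x0))))) (at x)"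
      by (intro derivative_intros)
    moreover have "(\<lambda>h. (1 / (b\<^sup>2 - a\<^sup>2)) * (0 - ((x - x0) \<bullet> (h - 0) + (h - 0) \<bullet> (x - x0)))) = (\<lambda>h. h \<bullet> Df x)"
      by (simp add: Df_def inner_commute)
    ultimately show ?thesis unfolding gderiv_def by simp
  qed
  define \<eta> where "\<eta> x = smooth_step (f x)" for x
  define D where "D x = (- (exp 1 * (bump' (1 - exp 1 * bump (f x)) * - (exp 1 * bump' (f x))))) *\<^sub>R Df x" for x
  have Dst: "DERIV smooth_step t :> - (exp 1 * (bump' (1 - exp 1 * bump t) * - (exp 1 * bump' t)))" for t
  proof -
    have "DERIV (\<lambda>t. 1 - exp 1 * bump t) t :> 0 - exp 1 * bump' t"
      by (intro DERIV_diff DERIV_const DERIV_cmult DERIV_bump)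
    then have "DERIV smooth_step t :> 0 - exp 1 * (bump' (1 - exp 1 * bump t) * (0 - exp 1 * bump' t))"
      unfolding smooth_step_def[abs_def] by (intro DERIV_diff DERIV_const DERIV_cmult DERIV_chain2[OF DERIV_bump] DERIV_bump)
    then show ?thesis by simp
  qed
  have Ce: "C_order k \<eta>" for k
    unfolding \<eta>_def smooth_step_def
    by (intro C_order_cmult C_order_diff C_order_const C_order_bump Cf)
  have D: "GDERIV \<eta> x :> D x" for x
    unfolding \<eta>_def D_def by (rule GDERIV_DERIV_compose[OF Df Dst])
  have out: "f x \<le> 0" if "x \<notin> ball x0 b" for x
  proof -
    have "b\<^sup>2 \<le> (norm (x - x0))\<^sup>2" using that ab by (auto simp: dist_norm norm_minus_commute intro!: power_mono)
    then show ?thesis using pos by (simp add: f divide_nonpos_pos)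
  qed
  have one: "\<eta> x = 1" if "x \<in> cball x0 a" for x
  proof -
    have "(norm (x - x0))\<^sup>2 \<le> a\<^sup>2" using that ab by (auto simp: dist_norm norm_minus_commute intro!: power_mono)
    then have "f x \<ge> 1" using pos by (simp add: f)
    then show ?thesis by (simp add: \<eta>_def smooth_step_eq_1)
  qed
  have zero: "\<eta> x = 0" if "x \<notin> ball x0 b" for x
    using out[OF that] by (simp add: \<eta>_def smooth_step_eq_0)
  have bd: "norm (D x) \<le> 32 * exp 2 / (b - a)" for x
  proof (cases "x \<in> ball x0 b")
    case False
    then show ?thesis using out[OF False] ab by (simp add: D_def bump'_nonpos)
  next
    case True
    have "norm (Df x) = 2 * norm (x - x0) / (b\<^sup>2 - a\<^sup>2)" using pos by (simp add: Df_def)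
    also have "\<dots> \<le> 2 * b / (b\<^sup>2 - a\<^sup>2)"
      using True pos by (intro divide_right_mono) (auto simp: dist_norm norm_minus_commute)
    \<comment> \<open>Here b^2 - a^2 = (b - a)(b + a), and b \<le> b + a because a \<ge> 0.\<close>
    also have "\<dots> \<le> 2 / (b - a)"
      using ab pos mult_left_mono[of a b a] by (simp add: field_simps power2_eq_square)
    finally have 1: "norm (Df x) \<le> 2 / (b - a)" .
    have "exp (2::real) = exp 1 * exp 1" by (simp flip: exp_add)
    then have "norm (D x) = exp 2 * (\<bar>bump' (1 - exp 1 * bump (f x))\<bar> * \<bar>bump' (f x)\<bar>) * norm (Df x)"
      by (simp add: D_def abs_mult)
    also have "\<dots> \<le> exp 2 * (4 * 4) * (2 / (b - a))"
      using 1 ab by (intro mult_mono mult_left_mono bump'_bound) auto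
    finally show ?thesis by simp
  qed
  have tf: "test_function S \<eta>"
    by (rule test_function_compactI[where K = "cball x0 b", OF Ce]) (use zero ab in auto)
  show ?thesis
    by (rule that[OF tf D _ _ one zero bd]) (simp_all add: \<eta>_def smooth_step_bounds)
qed

text \<open>A product over the coordinates of one-sided bumps. Dilating the argument of
  \<open>bump\<close> by n + 1 leaves its zero set alone and pushes exp(-1/((n+1) t)) to 1 for each
  t > 0, so the limit is the indicator of the open box, not of the closed one.\<close>

lemma box_bump_exists:
  fixes a c :: "'a::euclidean_space"
  obtains \<psi> where "\<And>n S. cbox a c \<subseteq> S \<Longrightarrow> test_function S (\<psi> n)" "\<And>n x. \<bar>\<psi> n x\<bar> \<le> 1"
    "\<And>n x. x \<notin> cbox a c \<Longrightarrow> \<psi> n x = 0" "\<And>x. (\<lambda>n. \<psi> n x) \<longlonglongrightarrow> indicat_real (box a c) x"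
proof -
  define \<psi> where "\<psi> n x = (\<Prod>b\<in>Basis. bump (real (Suc n) * ((x - a) \<bullet> b)) * bump (- real (Suc n) * ((x - c) \<bullet> b)))" for n x
  have C: "C_order k (\<psi> n)" for k n
    unfolding \<psi>_def by (intro C_order_prod C_order_mult C_order_bump C_order_cmult C_order_affine)
  have z: "\<psi> n x = 0" if x: "x \<notin> box a c" for n x
  proof -
    obtain b where b: "b \<in> Basis" "\<not> (a \<bullet> b < x \<bullet> b \<and> x \<bullet> b < c \<bullet> b)" using x by (auto simp: mem_box)
    then have "bump (real (Suc n) * ((x - a) \<bullet> b)) * bump (- real (Suc n) * ((x - c) \<bullet> b)) = 0"
      by (auto simp: bump_eq inner_diff_left zero_less_mult_iff mult_less_0_iff)
    then show ?thesis unfolding \<psi>_def using b(1) by (simp only: prod_zero_iff finite_Basis) blast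
  qed
  have lim: "(\<lambda>n. bump (real (Suc n) * t)) \<longlonglongrightarrow> 1" if "0 < t" for t
  proof -
    have "(\<lambda>n. exp (- (1 / t) * (1 / real (Suc n)))) \<longlonglongrightarrow> exp (- (1 / t) * 0)"
      by (intro tendsto_intros lim_inverse_n[THEN LIMSEQ_Suc, unfolded inverse_eq_divide])
    then show ?thesis using that by (simp add: bump_eq mult_ac)
  qed
  show ?thesis
  proof (rule that[of \<psi>])
    show "cbox a c \<subseteq> S \<Longrightarrow> test_function S (\<psi> n)" for n S
      by (rule test_function_compactI[where K = "cbox a c", OF C])
        (auto intro!: z dest: subsetD[OF box_subset_cbox])
    show "\<psi> n x = 0" if "x \<notin> cbox a c" for n x
      using that by (auto intro!: z dest: subsetD[OF box_subset_cbox])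
    show "\<bar>\<psi> n x\<bar> \<le> 1" for n x
      unfolding \<psi>_def abs_prod abs_mult
      by (intro prod_le_1) (auto simp: bump_bounds mult_le_one)
    show "(\<lambda>n. \<psi> n x) \<longlonglongrightarrow> indicat_real (box a c) x" for x
    proof (cases "x \<in> box a c")
      case False
      then show ?thesis by (simp add: z)
    next
      case True
      have "(\<lambda>n. \<psi> n x) \<longlonglongrightarrow> (\<Prod>b\<in>(Basis::'a set). 1 * 1)"
        unfolding \<psi>_def
      proof (intro tendsto_prod tendsto_mult)
        fix b :: 'a assume b: "b \<in> Basis"
        show "(\<lambda>n. bump (real (Suc n) * ((x - a) \<bullet> b))) \<longlonglongrightarrow> 1"
          using True b by (intro lim) (auto simp: mem_box inner_diff_left)
        have "(\<lambda>n. bump (real (Suc n) * ((c - x) \<bullet> b))) \<longlonglongrightarrow> 1"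
          using True b by (intro lim) (auto simp: mem_box inner_diff_left)
        then show "(\<lambda>n. bump (- real (Suc n) * ((x - c) \<bullet> b))) \<longlonglongrightarrow> 1"
          by (simp add: inner_diff_left algebra_simps)
      qed
      then show ?thesis using True by simp
    qed
  qed
qed

section \<open>The fundamental lemma and translations in \<open>L\<^sup>1\<close>\<close>

lemma lborel_distr_shift: "distr lborel borel (\<lambda>x. x + c) = (lborel :: 'a::euclidean_space measure)"
proof -
  have "(\<lambda>x. x + c) = (+) c" by (auto simp: add.commute)
  then show ?thesis using lborel_distr_plus[of c] by simp
qed

lemma integrable_shift:
  fixes f :: "'a::euclidean_space \<Rightarrow> real"
  assumes "integrable lborel f"
  shows "integrable lborel (\<lambda>x. f (x + c))"
  using integrable_distr[of "\<lambda>x. x + c" lborel borel f] assms by (simp add: lborel_distr_shift)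

lemma integral_shift:
  fixes f :: "'a::euclidean_space \<Rightarrow> real"
  assumes "f \<in> borel_measurable borel"
  shows "(\<integral>x. f (x + c) \<partial>lborel) = (\<integral>x. f x \<partial>lborel)"
  using assms by (subst (2) lborel_distr_shift[of c, symmetric]) (simp add: integral_distr)

lemma nn_integral_shift:
  fixes f :: "'a::euclidean_space \<Rightarrow> ennreal"
  assumes "f \<in> borel_measurable borel"
  shows "(\<integral>\<^sup>+x. f (x + c) \<partial>lborel) = (\<integral>\<^sup>+x. f x \<partial>lborel)"
  using assms by (subst (2) lborel_distr_shift[of c, symmetric]) (simp add: nn_integral_distr)

lemma integrable_mult_bounded:
  fixes f g :: "'a \<Rightarrow> real"
  assumes "integrable M f" "g \<in> borel_measurable M" "\<And>x. \<bar>g x\<bar> \<le> B"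
  shows "integrable M (\<lambda>x. g x * f x)"
proof (rule Bochner_Integration.integrable_bound)
  show "integrable M (\<lambda>x. B * f x)" using assms(1) by simp
  show "AE x in M. norm (g x * f x) \<le> norm (B * f x)"
  proof (rule AE_I2)
    fix x
    have "\<bar>g x\<bar> * \<bar>f x\<bar> \<le> \<bar>B\<bar> * \<bar>f x\<bar>" using assms(3)[of x] by (intro mult_right_mono) auto
    then show "norm (g x * f x) \<le> norm (B * f x)" by (simp add: abs_mult)
  qed
qed (use assms in auto)

text \<open>Dominated convergence carries the orthogonality from test functions to indicators of
  open boxes. These form a generator stable under intersection, so the measures with densities f^+
  and f^- agree, which forces both densities to vanish almost everywhere.\<close>

lemma fundamental_lemma:
  fixes f :: "'a::euclidean_space \<Rightarrow> real"
  assumes f: "integrable lborel f"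
    and ortho: "\<And>\<phi>. test_function UNIV \<phi> \<Longrightarrow> (\<integral>x. \<phi> x * f x \<partial>lborel) = 0"
  shows "AE x in lborel. f x = 0"
proof -
  have [measurable]: "f \<in> borel_measurable borel" using f by auto
  have box0: "(\<integral>x. indicator (box a c) x * f x \<partial>lborel) = 0" for a c
  proof -
    obtain \<psi> where \<psi>: "\<And>n S. cbox a c \<subseteq> S \<Longrightarrow> test_function S (\<psi> n)" "\<And>n x. \<bar>\<psi> n x\<bar> \<le> 1"
      "\<And>n x. x \<notin> cbox a c \<Longrightarrow> \<psi> n x = 0" "\<And>x. (\<lambda>n. \<psi> n x) \<longlonglongrightarrow> indicat_real (box a c) x"
      by (rule box_bump_exists[of a c]) blast
    have [measurable]: "\<psi> n \<in> borel_measurable borel" for n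
    proof -
      have "C_order 0 (\<psi> n)" using \<psi>(1)[of UNIV n] unfolding test_function_def by blast
      then show ?thesis by (intro borel_measurable_continuous_onI) simp
    qed
    have "(\<lambda>n. \<integral>x. \<psi> n x * f x \<partial>lborel) \<longlonglongrightarrow> (\<integral>x. indicator (box a c) x * f x \<partial>lborel)"
    proof (rule integral_dominated_convergence[where w = "\<lambda>x. \<bar>f x\<bar>"])
      show "AE x in lborel. (\<lambda>n. \<psi> n x * f x) \<longlonglongrightarrow> indicator (box a c) x * f x"
        by (intro AE_I2 tendsto_mult \<psi>(4) tendsto_const)
      show "AE x in lborel. norm (\<psi> n x * f x) \<le> \<bar>f x\<bar>" for n
        using \<psi>(2)[of n] by (intro AE_I2) (auto simp: abs_mult mult_left_le_one_le)
    qed (use f in auto)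
    moreover have "(\<lambda>n. \<integral>x. \<psi> n x * f x \<partial>lborel) = (\<lambda>n. 0)"
      using ortho \<psi>(1)[of UNIV] by auto
    ultimately show ?thesis by (simp add: LIMSEQ_const_iff)
  qed
  \<comment> \<open>\<open>ennreal\<close> sends negative numbers to 0, so these are the measures
    with densities f^+ and f^-.\<close>
  define M where "M = density lborel (\<lambda>x. ennreal (f x))"
  define N where "N = density lborel (\<lambda>x. ennreal (- f x))"
  have em: "emeasure M A = ennreal (\<integral>x. indicator A x * max (f x) 0 \<partial>lborel)"
           "emeasure N A = ennreal (\<integral>x. indicator A x * max (- f x) 0 \<partial>lborel)" if [measurable]: "A \<in> sets borel" for A
  proof -
    have i: "integrable lborel (\<lambda>x. indicator A x * max (f x) 0)" "integrable lborel (\<lambda>x. indicator A x * max (- f x) 0)"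
      using f by (auto intro!: integrable_mult_bounded[where B=1])
    have "emeasure M A = (\<integral>\<^sup>+x. ennreal (indicator A x * max (f x) 0) \<partial>lborel)"
      unfolding M_def by (subst emeasure_density) (auto intro!: nn_integral_cong split: split_indicator simp: max_def ennreal_neg)
    then show "emeasure M A = ennreal (\<integral>x. indicator A x * max (f x) 0 \<partial>lborel)"
      using i by (subst (asm) nn_integral_eq_integral) auto
    have "emeasure N A = (\<integral>\<^sup>+x. ennreal (indicator A x * max (- f x) 0) \<partial>lborel)"
      unfolding N_def by (subst emeasure_density) (auto intro!: nn_integral_cong split: split_indicator simp: max_def ennreal_neg)
    then show "emeasure N A = ennreal (\<integral>x. indicator A x * max (- f x) 0 \<partial>lborel)"
      using i by (subst (asm) nn_integral_eq_integral) auto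
  qed
  have "M = N"
  proof (rule measure_eqI_generator_eq[where \<Omega> = UNIV and E = "range (\<lambda>(a,b). box a b)" and A = "\<lambda>n::nat. box (- (real n *\<^sub>R One)) (real n *\<^sub>R One)"])
    show "Int_stable (range (\<lambda>(a, b). box a b :: 'a set))"
      by (auto simp: Int_stable_def box_Int_box)
    show "emeasure M X = emeasure N X" if X: "X \<in> range (\<lambda>(a, b). box a b)" for X
    proof -
      obtain a c where [simp]: "X = box a c" using X by auto
      have i: "integrable lborel (\<lambda>x. indicator X x * max (f x) 0)" "integrable lborel (\<lambda>x. indicator X x * max (- f x) 0)"
        using f by (auto intro!: integrable_mult_bounded[where B=1])
      have "(\<integral>x. indicator X x * max (f x) 0 \<partial>lborel) - (\<integral>x. indicator X x * max (- f x) 0 \<partial>lborel) =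
        (\<integral>x. indicator X x * max (f x) 0 - indicator X x * max (- f x) 0 \<partial>lborel)"
        using i by (intro Bochner_Integration.integral_diff[symmetric])
      also have "\<dots> = (\<integral>x. indicator X x * f x \<partial>lborel)"
        by (intro Bochner_Integration.integral_cong) (auto simp: max_def split: split_indicator)
      finally have "(\<integral>x. indicator X x * max (f x) 0 \<partial>lborel) - (\<integral>x. indicator X x * max (- f x) 0 \<partial>lborel) =
        (\<integral>x. indicator X x * f x \<partial>lborel)" .
      then show ?thesis using box0[of a c] by (simp add: em)
    qed
    show "sets M = sigma_sets UNIV (range (\<lambda>(a, b). box a b))" "sets N = sigma_sets UNIV (range (\<lambda>(a, b). box a b))"
      by (simp_all add: borel_eq_box M_def N_def)
    show "(\<Union>n. box (- (real n *\<^sub>R One)) (real n *\<^sub>R One)) = (UNIV :: 'a set)"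
      by (rule UN_box_eq_UNIV)
    show "emeasure M (box (- (real i *\<^sub>R One)) (real i *\<^sub>R One)) \<noteq> \<infinity>" for i
      by (subst em) auto
  qed auto
  \<comment> \<open>The right-hand measure gives no mass to {g > 0}; by equality the integral of g
    over that set is 0, so the set is null.\<close>
  have z: "AE x in lborel. \<not> 0 < g x" if eq: "density lborel (\<lambda>x. ennreal (g x)) = density lborel (\<lambda>x. ennreal (- g x))"
    and [measurable]: "g \<in> borel_measurable borel" for g :: "'a \<Rightarrow> real"
  proof -
    have "emeasure (density lborel (\<lambda>x. ennreal (- g x))) {x. 0 < g x} = 0"
      by (subst emeasure_density) (auto simp: nn_integral_0_iff_AE ennreal_neg intro!: AE_I2 split: split_indicator)
    then have "(\<integral>\<^sup>+x. ennreal (g x) * indicator {x. 0 < g x} x \<partial>lborel) = 0"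
      using eq by (subst (asm) eq[symmetric], subst (asm) emeasure_density) auto
    then have "AE x in lborel. ennreal (g x) * indicator {x. 0 < g x} x = 0"
      by (subst (asm) nn_integral_0_iff_AE) auto
    then show ?thesis by eventually_elim (auto split: split_indicator)
  qed
  have "AE x in lborel. \<not> 0 < f x" using \<open>M = N\<close> unfolding M_def N_def by (intro z) auto
  moreover have "AE x in lborel. \<not> 0 < - f x" using \<open>M = N\<close>[symmetric] unfolding M_def N_def by (intro z) auto
  ultimately show ?thesis by eventually_elim auto
qed

text \<open>Induction over integrable functions: indicators of open sets, then of Borel sets by
  outer regularity, then sums and dominated limits.\<close>

lemma L1_shift_tendsto:
  fixes f :: "'a::euclidean_space \<Rightarrow> real"
  assumes f: "integrable lborel f" and H: "H \<longlonglongrightarrow> 0"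
  shows "(\<lambda>n. \<integral>x. \<bar>f (x + H n) - f x\<bar> \<partial>lborel) \<longlonglongrightarrow> 0"
  using f
proof (induction rule: integrable_induct)
  case (base A c)
  define D where "D B n = (\<integral>x. \<bar>indicator B (x + H n) - indicator B x\<bar> \<partial>lborel :: real)" for B :: "'a set" and n
  have [measurable]: "A \<in> sets borel" using base by simp
  have int: "integrable lborel (\<lambda>x. indicator B (x + h) :: real)"
    if "B \<in> sets borel" "emeasure lborel B < \<infinity>" for B :: "'a set" and h
    using that by (intro integrable_shift) auto
  \<comment> \<open>For x in the open set U the shifted point is eventually in U, but at boundary
    points the indicators need not converge. So only the part where U is left is passed to the
    limit: the difference d of the indicators satisfies |d| = 2 max(-d, 0) + d, and d integrates to
    0 by translation invariance.\<close>
  have op: "D U \<longlonglongrightarrow> 0" if U: "open U" "emeasure lborel U < \<infinity>" for U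
  proof -
    have [measurable]: "U \<in> sets borel" using U by simp
    note i = int[OF \<open>U \<in> sets borel\<close> U(2)]
    have i0: "integrable lborel (indicator U :: 'a \<Rightarrow> real)" using i[of 0] by simp
    have D: "D U n = 2 * (\<integral>x. max (indicator U x - indicator U (x + H n)) 0 \<partial>lborel)" for n
    proof -
      have m: "integrable lborel (\<lambda>x. max (indicator U x - indicator U (x + H n)) 0 :: real)"
        by (intro integrable_max Bochner_Integration.integrable_diff i i0 integrable_zero)
      have "D U n = (\<integral>x. 2 * max (indicator U x - indicator U (x + H n)) 0 + (indicator U (x + H n) - indicator U x) \<partial>lborel)"
        unfolding D_def by (intro Bochner_Integration.integral_cong) (auto simp: max_def split: split_indicator)
      also have "\<dots> = 2 * (\<integral>x. max (indicator U x - indicator U (x + H n)) 0 \<partial>lborel) +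
         ((\<integral>x. indicator U (x + H n) \<partial>lborel) - (\<integral>x. indicator U x \<partial>lborel))"
        by (subst Bochner_Integration.integral_add)
          (use m i i0 in \<open>simp_all del: integral_indicator\<close>)
      also have "(\<integral>x. indicator U (x + H n) \<partial>lborel) = (\<integral>x. indicator U x \<partial>lborel :: real)"
        by (rule integral_shift) simp
      finally show ?thesis by simp
    qed
    have "(\<lambda>n. \<integral>x. max (indicator U x - indicator U (x + H n)) 0 \<partial>lborel) \<longlonglongrightarrow> (\<integral>x. 0 \<partial>(lborel::'a measure) :: real)"
    proof (rule integral_dominated_convergence[where w = "indicator U"])
      show "AE x in lborel. (\<lambda>n. max (indicator U x - indicator U (x + H n)) 0) \<longlonglongrightarrow> (0::real)"
      proof (rule AE_I2)
        fix x :: 'a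
        show "(\<lambda>n. max (indicator U x - indicator U (x + H n)) 0) \<longlonglongrightarrow> (0::real)"
        proof (cases "x \<in> U")
          case True
          have "(\<lambda>n. x + H n) \<longlonglongrightarrow> x + 0" by (intro tendsto_intros H)
          then have "eventually (\<lambda>n. x + H n \<in> U) sequentially"
            using U(1) True topological_tendstoD by fastforce
          then have "eventually (\<lambda>n. max (indicator U x - indicator U (x + H n)) 0 = (0::real)) sequentially"
            by eventually_elim (simp split: split_indicator)
          then show ?thesis by (rule tendsto_eventually)
        qed (auto simp: indicator_def max_def)
      qed
    qed (use i0 in \<open>auto simp: indicator_def max_def\<close>)
    then have "(\<lambda>n. 2 * (\<integral>x. max (indicator U x - indicator U (x + H n)) 0 \<partial>lborel)) \<longlonglongrightarrow> (2 * 0 :: real)"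
      by (intro tendsto_mult) auto
    then show ?thesis using D by (simp add: D_def[abs_def])
  qed
  have "D A \<longlonglongrightarrow> 0"
  proof (rule LIMSEQ_I)
    fix e :: real assume "0 < e"
    \<comment> \<open>Replacing A by an open superset U costs the measure of U - A twice, once
      shifted and once not; hence e/4 here and e/2 for U.\<close>
    then obtain U where U: "open U" "A \<subseteq> U" "emeasure lborel (U - A) < ennreal (e/4)"
      using outer_regular_lborel[of A "e/4"] by (auto simp: less_ennreal.rep_eq)
    have [measurable]: "U \<in> sets borel" using U by simp
    have fin: "emeasure lborel (U - A) < \<infinity>" using U(3) order.strict_trans by fastforce
    have "emeasure lborel U = emeasure lborel A + emeasure lborel (U - A)"
      using U(2) by (subst plus_emeasure) (auto simp: Un_absorb1)
    then have finU: "emeasure lborel U < \<infinity>" using fin base(2) by simp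
    have "eventually (\<lambda>n. D U n < e/2) sequentially"
      using op[OF U(1) finU] \<open>0 < e\<close> by (intro order_tendstoD(2)) auto
    then obtain n0 where n0: "\<And>n. n \<ge> n0 \<Longrightarrow> D U n < e/2" by (auto simp: eventually_sequentially)
    have m: "measure lborel (U - A) < e/4"
      using U(3) \<open>0 < e\<close> fin by (simp add: emeasure_eq_ennreal_measure ennreal_less_iff)
    show "\<exists>no. \<forall>n\<ge>no. norm (D A n - 0) < e"
    proof (intro exI allI impI)
      fix n assume "n0 \<le> n"
      have i: "integrable lborel (\<lambda>x. indicator (U - A) x + indicator (U - A) (x + H n) + \<bar>indicator U (x + H n) - indicator U x\<bar> :: real)"
        using int[of U] int[of "U - A"] int[of U 0] int[of "U - A" 0] fin finU by (auto intro!: integrable_abs)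
      have "D A n \<le> (\<integral>x. indicator (U - A) x + indicator (U - A) (x + H n) + \<bar>indicator U (x + H n) - indicator U x\<bar> \<partial>lborel)"
        unfolding D_def using i U(2) int[of A] int[of A 0] base(2)
        by (intro integral_mono) (auto split: split_indicator)
      also have "\<dots> = (\<integral>x. indicator (U - A) x \<partial>lborel) + (\<integral>x. indicator (U - A) (x + H n) \<partial>lborel) + D U n"
        unfolding D_def using int[of U] int[of "U - A"] int[of U 0] int[of "U - A" 0] fin finU
        by (subst Bochner_Integration.integral_add) (auto intro!: integrable_abs)
      also have "(\<integral>x. indicator (U - A) (x + H n) \<partial>lborel) = (\<integral>x. indicator (U - A) x \<partial>lborel :: real)"
        by (rule integral_shift) auto
      also have "(\<integral>x. indicator (U - A) x \<partial>lborel) = measure lborel (U - A)" by simp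
      finally have "D A n < e" using n0[OF \<open>n0 \<le> n\<close>] m by simp
      moreover have "D A n \<ge> 0" unfolding D_def by simp
      ultimately show "norm (D A n - 0) < e" by simp
    qed
  qed
  then have "(\<lambda>n. \<bar>c\<bar> * D A n) \<longlonglongrightarrow> \<bar>c\<bar> * 0" by (intro tendsto_intros)
  moreover have "\<bar>c\<bar> * D A n = (\<integral>x. \<bar>indicator A (x + H n) *\<^sub>R c - indicator A x *\<^sub>R c\<bar> \<partial>lborel)" for n
    unfolding D_def by (subst Bochner_Integration.integral_mult_right_zero[symmetric])
      (auto intro!: Bochner_Integration.integral_cong simp: abs_mult[symmetric] algebra_simps)
  ultimately show ?case by simp
next
  case (add f g)
  have "(\<lambda>n. (\<integral>x. \<bar>f (x + H n) - f x\<bar> \<partial>lborel) + (\<integral>x. \<bar>g (x + H n) - g x\<bar> \<partial>lborel)) \<longlonglongrightarrow> 0 + 0"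
    using add by (intro tendsto_add)
  then have z: "(\<lambda>n. (\<integral>x. \<bar>f (x + H n) - f x\<bar> \<partial>lborel) + (\<integral>x. \<bar>g (x + H n) - g x\<bar> \<partial>lborel)) \<longlonglongrightarrow> 0" by simp
  show ?case
  proof (rule Lim_null_comparison[OF _ z])
    show "eventually (\<lambda>n. norm (\<integral>x. \<bar>f (x + H n) + g (x + H n) - (f x + g x)\<bar> \<partial>lborel) \<le>
      (\<integral>x. \<bar>f (x + H n) - f x\<bar> \<partial>lborel) + (\<integral>x. \<bar>g (x + H n) - g x\<bar> \<partial>lborel)) sequentially"
    proof (intro always_eventually allI)
      fix n
      have i: "integrable lborel (\<lambda>x. \<bar>f (x + H n) - f x\<bar>)" "integrable lborel (\<lambda>x. \<bar>g (x + H n) - g x\<bar>)"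
        "integrable lborel (\<lambda>x. \<bar>f (x + H n) + g (x + H n) - (f x + g x)\<bar>)"
        using add.hyps integrable_shift[OF add.hyps(1)] integrable_shift[OF add.hyps(2)] by auto
      have "(\<integral>x. \<bar>f (x + H n) + g (x + H n) - (f x + g x)\<bar> \<partial>lborel) \<le>
        (\<integral>x. \<bar>f (x + H n) - f x\<bar> + \<bar>g (x + H n) - g x\<bar> \<partial>lborel)"
        using i by (intro integral_mono Bochner_Integration.integrable_add) auto
      then show "norm (\<integral>x. \<bar>f (x + H n) + g (x + H n) - (f x + g x)\<bar> \<partial>lborel) \<le>
        (\<integral>x. \<bar>f (x + H n) - f x\<bar> \<partial>lborel) + (\<integral>x. \<bar>g (x + H n) - g x\<bar> \<partial>lborel)"
        using i by simp
    qed
  qed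
next
  case (lim f s)
  note [simp] = \<open>integrable lborel f\<close> \<open>\<And>i. integrable lborel (s i)\<close>
  have fs: "(\<lambda>i. \<integral>x. \<bar>s i x - f x\<bar> \<partial>lborel) \<longlonglongrightarrow> (\<integral>x. 0 \<partial>(lborel::'a measure))"
  proof (rule integral_dominated_convergence[where w = "\<lambda>x. 3 * \<bar>f x\<bar>"])
    show "AE x in lborel. (\<lambda>i. \<bar>s i x - f x\<bar>) \<longlonglongrightarrow> 0"
      using lim by (intro AE_I2 tendsto_rabs_zero LIM_zero) auto
    show "(\<lambda>x. \<bar>s i x - f x\<bar>) \<in> borel_measurable lborel" for i
      using borel_measurable_integrable[OF lim.hyps(1)[of i]] borel_measurable_integrable[OF lim.hyps(4)] by simp
    show "AE x in lborel. norm (\<bar>s i x - f x\<bar>) \<le> 3 * \<bar>f x\<bar>" for i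
    proof (rule AE_I2)
      fix x :: 'a
      have "norm (s i x) \<le> 2 * norm (f x)" using lim.hyps(3)[where i = i and x = x] by simp
      then show "norm (\<bar>s i x - f x\<bar>) \<le> 3 * \<bar>f x\<bar>" by simp
    qed
  qed auto
  show ?case
  proof (rule LIMSEQ_I)
    fix e :: real assume "0 < e"
    have "eventually (\<lambda>i. (\<integral>x. \<bar>s i x - f x\<bar> \<partial>lborel) < e/4) sequentially"
      using fs \<open>0 < e\<close> by (intro order_tendstoD(2)) auto
    then obtain i where i: "(\<integral>x. \<bar>s i x - f x\<bar> \<partial>lborel) < e/4" by (auto simp: eventually_sequentially)
    have "eventually (\<lambda>n. (\<integral>x. \<bar>s i (x + H n) - s i x\<bar> \<partial>lborel) < e/4) sequentially"
      using lim.IH[of i] \<open>0 < e\<close> by (intro order_tendstoD(2)) auto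
    then obtain n0 where n0: "\<And>n. n \<ge> n0 \<Longrightarrow> (\<integral>x. \<bar>s i (x + H n) - s i x\<bar> \<partial>lborel) < e/4"
      by (auto simp: eventually_sequentially)
    show "\<exists>no. \<forall>n\<ge>no. norm ((\<integral>x. \<bar>f (x + H n) - f x\<bar> \<partial>lborel) - 0) < e"
    proof (intro exI allI impI)
      fix n assume "n0 \<le> n"
      note sh = integrable_shift[of f "H n"] integrable_shift[of "s i" "H n"]
      have d: "integrable lborel (\<lambda>x. \<bar>s i x - f x\<bar>)" by (intro integrable_abs Bochner_Integration.integrable_diff) auto
      have "(\<integral>x. \<bar>f (x + H n) - f x\<bar> \<partial>lborel) \<le>
        (\<integral>x. \<bar>s i (x + H n) - f (x + H n)\<bar> + \<bar>s i (x + H n) - s i x\<bar> + \<bar>s i x - f x\<bar> \<partial>lborel)"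
        using sh by (intro integral_mono) (auto intro!: integrable_abs)
      also have "\<dots> = (\<integral>x. \<bar>s i (x + H n) - f (x + H n)\<bar> \<partial>lborel) + (\<integral>x. \<bar>s i (x + H n) - s i x\<bar> \<partial>lborel) + (\<integral>x. \<bar>s i x - f x\<bar> \<partial>lborel)"
        using sh by simp
      also have "(\<integral>x. \<bar>s i (x + H n) - f (x + H n)\<bar> \<partial>lborel) = (\<integral>x. \<bar>s i x - f x\<bar> \<partial>lborel)"
        using integral_shift[of "\<lambda>x. \<bar>s i x - f x\<bar>" "H n"] d by auto
      finally have "(\<integral>x. \<bar>f (x + H n) - f x\<bar> \<partial>lborel) < e" using i n0[OF \<open>n0 \<le> n\<close>] \<open>0 < e\<close> by simp
      then show "norm ((\<integral>x. \<bar>f (x + H n) - f x\<bar> \<partial>lborel) - 0) < e" by simp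
    qed
  qed
qed

section \<open>Directional weak derivatives\<close>

text \<open>All Sobolev functions below are multiplied by a cutoff first, so that integrable functions on the
  whole space suffice.\<close>

definition weak_deriv :: "'a::euclidean_space \<Rightarrow> ('a \<Rightarrow> real) \<Rightarrow> ('a \<Rightarrow> real) \<Rightarrow> bool" where
  "weak_deriv h u g \<longleftrightarrow> integrable lborel u \<and> integrable lborel g \<and>
     (\<forall>\<phi> D. test_function UNIV \<phi> \<and> (\<forall>x. GDERIV \<phi> x :> D x) \<longrightarrow>
        (\<integral>x. u x * (D x \<bullet> h) \<partial>lborel) = - (\<integral>x. \<phi> x * g x \<partial>lborel))"

lemma weak_derivD:
  assumes "weak_deriv h u g"
  shows "integrable lborel u" "integrable lborel g"
    "\<And>\<phi> D. test_function UNIV \<phi> \<Longrightarrow> (\<And>x. GDERIV \<phi> x :> D x) \<Longrightarrow>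
        (\<integral>x. u x * (D x \<bullet> h) \<partial>lborel) = - (\<integral>x. \<phi> x * g x \<partial>lborel)"
  using assms unfolding weak_deriv_def by blast+

lemma weak_deriv_scale:
  assumes "weak_deriv h u g"
  shows "weak_deriv (c *\<^sub>R h) u (\<lambda>x. c * g x)"
  unfolding weak_deriv_def
proof (intro conjI allI impI)
  fix \<phi> :: "'a \<Rightarrow> real" and D
  assume a: "test_function UNIV \<phi> \<and> (\<forall>x. GDERIV \<phi> x :> D x)"
  have "(\<integral>x. u x * (D x \<bullet> (c *\<^sub>R h)) \<partial>lborel) = c * (\<integral>x. u x * (D x \<bullet> h) \<partial>lborel)"
    by (subst Bochner_Integration.integral_mult_right_zero[symmetric]) (simp add: mult_ac)
  also have "\<dots> = - (c * (\<integral>x. \<phi> x * g x \<partial>lborel))"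
    using weak_derivD(3)[OF assms, of \<phi> D] a by simp
  also have "c * (\<integral>x. \<phi> x * g x \<partial>lborel) = (\<integral>x. \<phi> x * (c * g x) \<partial>lborel)"
    by (subst Bochner_Integration.integral_mult_right_zero[symmetric]) (simp add: mult_ac)
  finally show "(\<integral>x. u x * (D x \<bullet> (c *\<^sub>R h)) \<partial>lborel) = - (\<integral>x. \<phi> x * (c * g x) \<partial>lborel)" .
qed (use weak_derivD[OF assms] in auto)

lemma test_function_measurable:
  assumes "test_function S \<phi>" "\<And>x. GDERIV \<phi> x :> D x"
  shows "\<phi> \<in> borel_measurable borel" "D \<in> borel_measurable borel"
  using test_functionD(1,2)[OF assms] by (auto intro: borel_measurable_continuous_onI)

lemma GDERIV_shift:
  assumes "\<And>x. GDERIV f x :> D x"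
  shows "GDERIV (\<lambda>x. f (x + c)) x :> D (x + c)"
proof -
  have "((\<lambda>x. x + c) has_derivative (\<lambda>h. h)) (at x)" by (auto intro!: derivative_eq_intros)
  from has_derivative_compose[OF this, of f "\<lambda>h. h \<bullet> D (x + c)"] assms[of "x + c"]
  show ?thesis unfolding gderiv_def by simp
qed

lemma C_order_shift: "C_order k f \<Longrightarrow> C_order k (\<lambda>x. f (x + c))"
proof (induction k arbitrary: f)
  case 0
  then show ?case by (auto intro!: continuous_on_compose2[of UNIV f] continuous_intros)
next
  case (Suc k)
  then obtain Df where D: "\<And>x. GDERIV f x :> Df x" "\<And>b. b \<in> Basis \<Longrightarrow> C_order k (\<lambda>x. Df x \<bullet> b)" by auto
  show ?case unfolding C_order.simps
    by (intro exI[of _ "\<lambda>x. Df (x + c)"] conjI allI ballI GDERIV_shift[OF D(1)] Suc.IH[OF D(2)])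
qed

lemma test_function_shift:
  assumes "test_function UNIV f"
  shows "test_function UNIV (\<lambda>x. f (x + c))"
proof (rule test_function_compactI[where K = "(\<lambda>x. x - c) ` closure {x. f x \<noteq> 0}"])
  show "C_order k (\<lambda>x. f (x + c))" for k
    using assms unfolding test_function_def by (blast intro: C_order_shift)
  show "compact ((\<lambda>x. x - c) ` closure {x. f x \<noteq> 0})"
    using assms unfolding test_function_def by (intro compact_continuous_image continuous_intros) blast
  show "f (x + c) = 0" if x: "x \<notin> (\<lambda>x. x - c) ` closure {x. f x \<noteq> 0}" for x
  proof (rule ccontr)
    assume "f (x + c) \<noteq> 0"
    then have "x + c \<in> closure {x. f x \<noteq> 0}" using closure_subset[of "{x. f x \<noteq> 0}"] by auto
    then have "(x + c) - c \<in> (\<lambda>x. x - c) ` closure {x. f x \<noteq> 0}" by (rule imageI)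
    then show False using x by simp
  qed
qed simp

text \<open>The form of Fubini needed for averages over the segment from x to x + h: there all
  slices have L1 norms with one common bound, by translation invariance.\<close>

lemma integrable_prod_unit_interval:
  fixes F :: "real \<times> 'a::euclidean_space \<Rightarrow> real"
  assumes [measurable]: "F \<in> borel_measurable borel"
    and int: "\<And>t. integrable lborel (\<lambda>x. F (t, x))"
    and bound: "\<And>t. (\<integral>x. \<bar>F (t, x)\<bar> \<partial>lborel) \<le> B"
  shows "integrable (lborel \<Otimes>\<^sub>M lborel) (\<lambda>(t, x). indicator {0..1} t * F (t, x))"
proof (rule lborel_pair.Fubini_integrable)
  have [measurable]: "F \<in> borel_measurable (lborel \<Otimes>\<^sub>M lborel)" by (simp add: lborel_prod)
  show "(\<lambda>(t, x). indicator {0..1} t * F (t, x)) \<in> borel_measurable (lborel \<Otimes>\<^sub>M lborel)" by measurable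
  show "AE t in lborel. integrable lborel (\<lambda>x. case (t, x) of (t, x) \<Rightarrow> indicator {0..1} t * F (t, x))"
    using int by simp
  have "integrable lborel (\<lambda>t::real. indicator {0..1} t * B)" by simp
  then show "integrable lborel (\<lambda>t. \<integral>x. norm (case (t, x) of (t, x) \<Rightarrow> indicator {0..1} t * F (t, x)) \<partial>lborel)"
  proof (rule Bochner_Integration.integrable_bound)
    show "AE t in lborel. norm (\<integral>x. norm (case (t, x) of (t, x) \<Rightarrow> indicator {0..1} t * F (t, x)) \<partial>lborel)
       \<le> norm (indicator {0..1} t * B)"
      using bound by (intro AE_I2) (auto simp: indicator_def intro: order_trans[OF _ abs_ge_self])
  qed measurable
qed

text \<open>Duality: against a test function \<psi> the left side becomes the integral of u(x)
  (\<psi>(x - h) - \<psi>(x)), which is an integral over t of directional derivatives of \<psi>.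
  Fubini, the weak derivative identity for each shifted test function, and translation back turn it
  into the right side; \<open>fundamental_lemma\<close> concludes.\<close>

lemma weak_deriv_translation:
  assumes w: "weak_deriv h u g"
  shows "AE x in lborel. u (x + h) - u x = (\<integral>t. indicator {0..1} t * g (x + t *\<^sub>R h) \<partial>lborel)"
    and "integrable lborel (\<lambda>x. \<integral>t. indicator {0..1} t * g (x + t *\<^sub>R h) \<partial>lborel)"
proof -
  note ug = weak_derivD(1,2)[OF w]
  have [measurable]: "u \<in> borel_measurable borel" "g \<in> borel_measurable borel" using ug by auto
  define J where "J x = (\<integral>t. indicator {0..1} t * g (x + t *\<^sub>R h) \<partial>lborel)" for x
  have iG: "integrable (lborel \<Otimes>\<^sub>M lborel) (\<lambda>(t, x). indicator {0..1} t * g (x + t *\<^sub>R h))"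
    using integrable_prod_unit_interval[of "\<lambda>(t, x). g (x + t *\<^sub>R h)" "\<integral>x. \<bar>g x\<bar> \<partial>lborel"]
      integrable_shift[OF ug(2)] integral_shift[of "\<lambda>x. \<bar>g x\<bar>"] by (simp add: borel_prod[symmetric])
  show iJ: "integrable lborel (\<lambda>x. \<integral>t. indicator {0..1} t * g (x + t *\<^sub>R h) \<partial>lborel)"
    using lborel_pair.integrable_snd[of "\<lambda>t x. indicator {0..1} t * g (x + t *\<^sub>R h)"] iG by simp
  have "AE x in lborel. u (x + h) - u x - J x = 0"
  proof (rule fundamental_lemma)
    show "integrable lborel (\<lambda>x. u (x + h) - u x - J x)"
      using iJ integrable_shift[OF ug(1)] ug(1) unfolding J_def by auto
    fix \<psi> :: "'a \<Rightarrow> real" assume \<psi>: "test_function UNIV \<psi>"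
    obtain D where D: "\<And>x. GDERIV \<psi> x :> D x" using test_function_obtain[OF \<psi>] by blast
    obtain B where B: "\<And>x. \<bar>\<psi> x\<bar> \<le> B" "\<And>x. norm (D x) \<le> B" "0 < B" using test_function_bounded[OF \<psi> D] by blast
    note [measurable] = test_function_measurable[OF \<psi> D]
    have bD: "\<bar>D x \<bullet> h\<bar> \<le> B * norm h" for x
      using Cauchy_Schwarz_ineq2[of "D x" h] mult_right_mono[OF B(2)[of x], of "norm h"] by simp
    have bi: "integrable lborel (\<lambda>x. k x * f x)" if "k \<in> borel_measurable borel" "\<And>x. \<bar>k x\<bar> \<le> c" "integrable lborel f"
      for k f :: "'a \<Rightarrow> real" and c using integrable_mult_bounded[OF that(3), of k c] that by simp
    have FTC: "(\<integral>t. indicator {0..1} t * (D (x - t *\<^sub>R h) \<bullet> h) \<partial>lborel) = \<psi> x - \<psi> (x - h)" for x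
    proof -
      have "(\<integral>t. indicator {0..1} t *\<^sub>R (D (x - t *\<^sub>R h) \<bullet> h) \<partial>lborel) = - \<psi> (x - 1 *\<^sub>R h) - (- \<psi> (x - 0 *\<^sub>R h))"
      proof (rule integral_FTC_atLeastAtMost)
        show "continuous_on {0..1} (\<lambda>t. D (x - t *\<^sub>R h) \<bullet> h)"
          by (intro continuous_intros continuous_on_compose2[OF test_functionD(2)[OF \<psi> D]]) auto
        show "((\<lambda>t. - \<psi> (x - t *\<^sub>R h)) has_vector_derivative D (x - t *\<^sub>R h) \<bullet> h) (at t within {0..1})" for t
        proof -
          have "((\<lambda>t. x - t *\<^sub>R h) has_derivative (\<lambda>s. 0 - s *\<^sub>R h)) (at t)" by (intro derivative_intros)
          from has_derivative_compose[OF this, of \<psi> "\<lambda>y. y \<bullet> D (x - t *\<^sub>R h)"] D[of "x - t *\<^sub>R h"]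
          have "((\<lambda>t. \<psi> (x - t *\<^sub>R h)) has_derivative (\<lambda>s. (0 - s *\<^sub>R h) \<bullet> D (x - t *\<^sub>R h))) (at t)"
            unfolding gderiv_def by simp
          then have "((\<lambda>t. - \<psi> (x - t *\<^sub>R h)) has_derivative (\<lambda>s. - ((0 - s *\<^sub>R h) \<bullet> D (x - t *\<^sub>R h)))) (at t)"
            by (rule has_derivative_minus)
          then show ?thesis unfolding has_vector_derivative_def
            by (auto simp: inner_commute intro: has_derivative_at_withinI)
        qed
      qed simp
      then show ?thesis by simp
    qed
    have iu: "integrable lborel (\<lambda>x. \<psi> (x - h) * u x)" "integrable lborel (\<lambda>x. \<psi> x * u x)"
       "integrable lborel (\<lambda>x. \<psi> x * u (x + h))" "integrable lborel (\<lambda>x. \<psi> x * J x)"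
      using B ug iJ integrable_shift[OF ug(1), of h] unfolding J_def by (auto intro!: bi)
    have iP: "integrable (lborel \<Otimes>\<^sub>M lborel) (\<lambda>(t, x). indicator {0..1} t * (u x * (D (x - t *\<^sub>R h) \<bullet> h)))"
    proof -
      have 1: "integrable lborel (\<lambda>x. u x * (D (x - t *\<^sub>R h) \<bullet> h))" for t
        using bi[of "\<lambda>x. D (x - t *\<^sub>R h) \<bullet> h" "B * norm h" u] bD ug by (simp add: mult.commute)
      have 2: "(\<integral>x. \<bar>u x * (D (x - t *\<^sub>R h) \<bullet> h)\<bar> \<partial>lborel) \<le> (\<integral>x. \<bar>u x\<bar> * (B * norm h) \<partial>lborel)" for t
        using bD ug
        by (intro integral_mono[OF integrable_abs[OF 1]]) (auto simp: abs_mult intro!: mult_left_mono)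
      show ?thesis
        using integrable_prod_unit_interval[of "\<lambda>(t, x). u x * (D (x - t *\<^sub>R h) \<bullet> h)" "\<integral>x. \<bar>u x\<bar> * (B * norm h) \<partial>lborel"] 1 2
        by (simp add: borel_prod[symmetric])
    qed
    have iQ: "integrable (lborel \<Otimes>\<^sub>M lborel) (\<lambda>(t, x). indicator {0..1} t * (\<psi> x * g (x + t *\<^sub>R h)))"
    proof -
      have 1: "integrable lborel (\<lambda>x. \<psi> x * g (x + t *\<^sub>R h))" for t
        using B integrable_shift[OF ug(2)] by (intro bi) auto
      have 2: "(\<integral>x. \<bar>\<psi> x * g (x + t *\<^sub>R h)\<bar> \<partial>lborel) \<le> B * (\<integral>x. \<bar>g x\<bar> \<partial>lborel)" for t
      proof -
        have "(\<integral>x. \<bar>\<psi> x * g (x + t *\<^sub>R h)\<bar> \<partial>lborel) \<le> (\<integral>x. B * \<bar>g (x + t *\<^sub>R h)\<bar> \<partial>lborel)"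
          using B integrable_shift[OF ug(2)]
          by (intro integral_mono[OF integrable_abs[OF 1]]) (auto simp: abs_mult intro!: mult_right_mono)
        then show ?thesis using integral_shift[of "\<lambda>x. \<bar>g x\<bar>" "t *\<^sub>R h"] by simp
      qed
      show ?thesis
        using integrable_prod_unit_interval[of "\<lambda>(t, x). \<psi> x * g (x + t *\<^sub>R h)" "B * (\<integral>x. \<bar>g x\<bar> \<partial>lborel)"] 1 2
        by (simp add: borel_prod[symmetric])
    qed
    have slice: "(\<integral>x. u x * (D (x - t *\<^sub>R h) \<bullet> h) \<partial>lborel) = - (\<integral>x. \<psi> x * g (x + t *\<^sub>R h) \<partial>lborel)" for t
    proof -
      have "(\<integral>x. u x * (D (x + - (t *\<^sub>R h)) \<bullet> h) \<partial>lborel) = - (\<integral>x. \<psi> (x + - (t *\<^sub>R h)) * g x \<partial>lborel)"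
        by (rule weak_derivD(3)[OF w test_function_shift[OF \<psi>] GDERIV_shift[OF D]])
      also have "(\<integral>x. \<psi> (x + - (t *\<^sub>R h)) * g x \<partial>lborel) = (\<integral>x. \<psi> x * g (x + t *\<^sub>R h) \<partial>lborel)"
        using integral_shift[of "\<lambda>x. \<psi> (x + - (t *\<^sub>R h)) * g x" "t *\<^sub>R h"] by simp
      finally show ?thesis by simp
    qed
    have "(\<integral>x. \<psi> (x - h) * u x \<partial>lborel) - (\<integral>x. \<psi> x * u x \<partial>lborel)
      = - (\<integral>x. (\<integral>t. indicator {0..1} t * (u x * (D (x - t *\<^sub>R h) \<bullet> h)) \<partial>lborel) \<partial>lborel)"
    proof -
      have "(\<integral>t. indicator {0..1} t * (u x * (D (x - t *\<^sub>R h) \<bullet> h)) \<partial>lborel) = \<psi> x * u x - \<psi> (x - h) * u x" for x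
      proof -
        have "(\<integral>t. indicator {0..1} t * (u x * (D (x - t *\<^sub>R h) \<bullet> h)) \<partial>lborel) = u x * (\<integral>t. indicator {0..1} t * (D (x - t *\<^sub>R h) \<bullet> h) \<partial>lborel)"
          by (subst Bochner_Integration.integral_mult_right_zero[symmetric]) (simp add: mult_ac)
        then show ?thesis by (simp add: FTC algebra_simps)
      qed
      then show ?thesis using iu by simp
    qed
    also have "\<dots> = - (\<integral>t. (\<integral>x. indicator {0..1} t * (u x * (D (x - t *\<^sub>R h) \<bullet> h)) \<partial>lborel) \<partial>lborel)"
      using lborel_pair.Fubini_integral[OF iP] by simp
    also have "\<dots> = (\<integral>t. (\<integral>x. indicator {0..1} t * (\<psi> x * g (x + t *\<^sub>R h)) \<partial>lborel) \<partial>lborel)"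
      by (simp add: slice)
    also have "\<dots> = (\<integral>x. (\<integral>t. indicator {0..1} t * (\<psi> x * g (x + t *\<^sub>R h)) \<partial>lborel) \<partial>lborel)"
      using lborel_pair.Fubini_integral[OF iQ] by simp
    also have "\<dots> = (\<integral>x. \<psi> x * J x \<partial>lborel)"
      unfolding J_def by (subst Bochner_Integration.integral_mult_right_zero[symmetric]) (simp add: mult_ac)
    also have "(\<integral>x. \<psi> (x - h) * u x \<partial>lborel) = (\<integral>x. \<psi> x * u (x + h) \<partial>lborel)"
      using integral_shift[of "\<lambda>x. \<psi> (x - h) * u x" h] by simp
    finally show "(\<integral>x. \<psi> x * (u (x + h) - u x - J x) \<partial>lborel) = 0"
      using iu by (simp add: right_diff_distrib)
  qed
  then show "AE x in lborel. u (x + h) - u x = (\<integral>t. indicator {0..1} t * g (x + t *\<^sub>R h) \<partial>lborel)"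
    by eventually_elim (simp add: J_def)
qed

text \<open>By the translation formula the quotient minus g is the average over t in [0,1] of g(x +
  t T h) - g(x). Its L1 norm is at most the average of the L1 moduli \<open>om\<close>, which tend
  to 0 by continuity of translations and are bounded by twice the norm of g.\<close>

lemma weak_deriv_difference_quotient:
  assumes w: "weak_deriv h u g" and T: "T \<longlonglongrightarrow> 0" "\<And>n. T n \<noteq> 0"
  shows "(\<lambda>n. \<integral>x. \<bar>(u (x + T n *\<^sub>R h) - u x) / T n - g x\<bar> \<partial>lborel) \<longlonglongrightarrow> 0"
proof -
  note ug = weak_derivD(1,2)[OF w]
  have [measurable]: "u \<in> borel_measurable borel" "g \<in> borel_measurable borel" using ug by auto
  define om where "om y = (\<integral>x. \<bar>g (x + y) - g x\<bar> \<partial>lborel)" for y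
  have sh: "integrable lborel (\<lambda>x. \<bar>g (x + y) - g x\<bar>)" for y
    using ug integrable_shift[OF ug(2)] by auto
  have om_le: "om y \<le> 2 * (\<integral>x. \<bar>g x\<bar> \<partial>lborel)" for y
  proof -
    have "om y \<le> (\<integral>x. \<bar>g (x + y)\<bar> + \<bar>g x\<bar> \<partial>lborel)"
      unfolding om_def using sh ug integrable_shift[OF ug(2)] by (intro integral_mono) auto
    also have "\<dots> = (\<integral>x. \<bar>g (x + y)\<bar> \<partial>lborel) + (\<integral>x. \<bar>g x\<bar> \<partial>lborel)"
      using ug integrable_shift[OF ug(2)] by simp
    finally show ?thesis using integral_shift[of "\<lambda>x. \<bar>g x\<bar>" y] by simp
  qed
  have om_nonneg: "0 \<le> om y" for y unfolding om_def by simp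
  have om_meas: "(\<lambda>t. om (t *\<^sub>R y)) \<in> borel_measurable borel" for y
    unfolding om_def by measurable
  have le: "(\<integral>x. \<bar>(u (x + \<tau> *\<^sub>R h) - u x) / \<tau> - g x\<bar> \<partial>lborel) \<le> (\<integral>t. indicator {0..1} t * om (t *\<^sub>R (\<tau> *\<^sub>R h)) \<partial>lborel)"
    if \<tau>: "\<tau> \<noteq> 0" for \<tau>
  proof -
    let ?F = "\<lambda>(t, x). g (x + t *\<^sub>R (\<tau> *\<^sub>R h)) - g x"
    have iF: "integrable (lborel \<Otimes>\<^sub>M lborel) (\<lambda>(t, x). indicator {0..1} t * \<bar>g (x + t *\<^sub>R (\<tau> *\<^sub>R h)) - g x\<bar>)"
      using integrable_prod_unit_interval[of "\<lambda>(t, x). \<bar>g (x + t *\<^sub>R (\<tau> *\<^sub>R h)) - g x\<bar>" "2 * (\<integral>x. \<bar>g x\<bar> \<partial>lborel)"]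
        sh om_le[unfolded om_def] by (simp add: borel_prod[symmetric])
    have iG: "integrable (lborel \<Otimes>\<^sub>M lborel) (\<lambda>(t, x). indicator {0..1} t * g (x + t *\<^sub>R (\<tau> *\<^sub>R h)))"
      using integrable_prod_unit_interval[of "\<lambda>(t, x). g (x + t *\<^sub>R (\<tau> *\<^sub>R h))" "\<integral>x. \<bar>g x\<bar> \<partial>lborel"]
        integrable_shift[OF ug(2)] integral_shift[of "\<lambda>x. \<bar>g x\<bar>"] by (simp add: borel_prod[symmetric])
    have aeG: "AE x in lborel. integrable lborel (\<lambda>t. indicator {0..1} t * g (x + t *\<^sub>R (\<tau> *\<^sub>R h)))"
      using lborel_pair.AE_integrable_snd[of "\<lambda>t x. indicator {0..1} t * g (x + t *\<^sub>R (\<tau> *\<^sub>R h))"] iG by simp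
    have "AE x in lborel. \<bar>(u (x + \<tau> *\<^sub>R h) - u x) / \<tau> - g x\<bar> \<le>
       (\<integral>t. indicator {0..1} t * \<bar>g (x + t *\<^sub>R (\<tau> *\<^sub>R h)) - g x\<bar> \<partial>lborel)"
      using weak_deriv_translation(1)[OF weak_deriv_scale[OF w, of \<tau>]] aeG
    proof eventually_elim
      fix x assume e: "u (x + \<tau> *\<^sub>R h) - u x = (\<integral>t. indicator {0..1} t * (\<tau> * g (x + t *\<^sub>R (\<tau> *\<^sub>R h))) \<partial>lborel)"
        and i: "integrable lborel (\<lambda>t. indicator {0..1} t * g (x + t *\<^sub>R (\<tau> *\<^sub>R h)))"
      have "(\<integral>t. indicator {0..1} t * (\<tau> * g (x + t *\<^sub>R (\<tau> *\<^sub>R h))) \<partial>lborel) =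
         \<tau> * (\<integral>t. indicator {0..1} t * g (x + t *\<^sub>R (\<tau> *\<^sub>R h)) \<partial>lborel)"
        by (subst Bochner_Integration.integral_mult_right_zero[symmetric]) (simp add: mult_ac)
      then have "(u (x + \<tau> *\<^sub>R h) - u x) / \<tau> - g x =
         (\<integral>t. indicator {0..1} t * g (x + t *\<^sub>R (\<tau> *\<^sub>R h)) \<partial>lborel) - (\<integral>t. indicator {0..1::real} t * g x \<partial>lborel)"
        using e \<tau> by simp
      also have "\<dots> = (\<integral>t. indicator {0..1} t * g (x + t *\<^sub>R (\<tau> *\<^sub>R h)) - indicator {0..1::real} t * g x \<partial>lborel)"
        by (rule Bochner_Integration.integral_diff[symmetric, OF i]) simp
      finally have "\<bar>(u (x + \<tau> *\<^sub>R h) - u x) / \<tau> - g x\<bar> \<le>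
         (\<integral>t. \<bar>indicator {0..1} t * g (x + t *\<^sub>R (\<tau> *\<^sub>R h)) - indicator {0..1::real} t * g x\<bar> \<partial>lborel)"
        using integral_abs_bound by metis
      also have "\<dots> = (\<integral>t. indicator {0..1} t * \<bar>g (x + t *\<^sub>R (\<tau> *\<^sub>R h)) - g x\<bar> \<partial>lborel)"
        by (intro Bochner_Integration.integral_cong) (auto split: split_indicator)
      finally show "\<bar>(u (x + \<tau> *\<^sub>R h) - u x) / \<tau> - g x\<bar> \<le> \<dots>" .
    qed
    then have "(\<integral>x. \<bar>(u (x + \<tau> *\<^sub>R h) - u x) / \<tau> - g x\<bar> \<partial>lborel) \<le>
       (\<integral>x. (\<integral>t. indicator {0..1} t * \<bar>g (x + t *\<^sub>R (\<tau> *\<^sub>R h)) - g x\<bar> \<partial>lborel) \<partial>lborel)"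
      using lborel_pair.integrable_snd[of "\<lambda>t x. indicator {0..1} t * \<bar>g (x + t *\<^sub>R (\<tau> *\<^sub>R h)) - g x\<bar>"] iF
        ug integrable_shift[OF ug(1), of "\<tau> *\<^sub>R h"]
      by (intro integral_mono_AE) (auto intro!: integrable_abs)
    also have "\<dots> = (\<integral>t. (\<integral>x. indicator {0..1} t * \<bar>g (x + t *\<^sub>R (\<tau> *\<^sub>R h)) - g x\<bar> \<partial>lborel) \<partial>lborel)"
      using lborel_pair.Fubini_integral[OF iF] by simp
    finally show ?thesis by (simp add: om_def)
  qed
  have "(\<lambda>n. \<integral>t. indicator {0..1} t * om (t *\<^sub>R (T n *\<^sub>R h)) \<partial>lborel) \<longlonglongrightarrow> (\<integral>t. 0 \<partial>(lborel::real measure))"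
  proof (rule integral_dominated_convergence[where w = "\<lambda>t. indicator {0..1} t * (2 * (\<integral>x. \<bar>g x\<bar> \<partial>lborel))"])
    show "AE t in lborel. (\<lambda>n. indicator {0..1} t * om (t *\<^sub>R (T n *\<^sub>R h))) \<longlonglongrightarrow> 0"
    proof (rule AE_I2)
      fix t :: real
      have "(\<lambda>n. t *\<^sub>R (T n *\<^sub>R h)) \<longlonglongrightarrow> t *\<^sub>R (0 *\<^sub>R h)" by (intro tendsto_intros T)
      then have "(\<lambda>n. om (t *\<^sub>R (T n *\<^sub>R h))) \<longlonglongrightarrow> 0"
        unfolding om_def using L1_shift_tendsto[OF ug(2)] by simp
      then show "(\<lambda>n. indicator {0..1} t * om (t *\<^sub>R (T n *\<^sub>R h))) \<longlonglongrightarrow> 0" by (rule tendsto_mult_right_zero)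
    qed
    show "AE t in lborel. norm (indicator {0..1} t * om (t *\<^sub>R (T n *\<^sub>R h))) \<le> indicator {0..1} t * (2 * (\<integral>x. \<bar>g x\<bar> \<partial>lborel))" for n
      using om_le om_nonneg by (intro AE_I2) (auto split: split_indicator)
    show "(\<lambda>t. indicator {0..1} t * om (t *\<^sub>R (T n *\<^sub>R h))) \<in> borel_measurable lborel" for n
      using om_meas[of "T n *\<^sub>R h"] by simp
  qed auto
  then have z: "(\<lambda>n. \<integral>t. indicator {0..1} t * om (t *\<^sub>R (T n *\<^sub>R h)) \<partial>lborel) \<longlonglongrightarrow> 0" by simp
  show ?thesis
    by (rule Lim_null_comparison[OF _ z]) (use le T in auto)
qed

section \<open>Chain, truncation and product rules for weak derivatives\<close>

lemma test_function_Lipschitz: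
  assumes D: "\<And>x. GDERIV \<phi> x :> D x" "\<And>x. norm (D x) \<le> B"
  shows "\<bar>\<phi> x - \<phi> y\<bar> \<le> B * norm (x - y)"
proof -
  have "norm (\<phi> x - \<phi> y) \<le> B * norm (x - y)"
  proof (rule differentiable_bound[of UNIV \<phi> "\<lambda>x h. h \<bullet> D x"])
    show "(\<phi> has_derivative (\<lambda>h. h \<bullet> D x)) (at x within UNIV)" for x
      using D(1)[of x] by (simp add: gderiv_def)
    show "onorm (\<lambda>h. h \<bullet> D x) \<le> B" for x
    proof (rule onorm_bound)
      show "0 \<le> B" using D(2)[of x] norm_ge_zero order_trans by blast
      fix h
      show "norm (h \<bullet> D x) \<le> B * norm h"
        using Cauchy_Schwarz_ineq2[of h "D x"] mult_right_mono[OF D(2)[of x], of "norm h"] by (simp add: mult.commute)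
    qed
  qed auto
  then show ?thesis by simp
qed

text \<open>The rule is first proved for difference quotients. Along a subsequence those of u
  converge almost everywhere, so u(x + T h) tends to u(x) and pointwise differentiability of F
  identifies the limit of the quotients of F(u). They converge in L1 as well, and a discrete
  integration by parts passes to the limit.\<close>

lemma weak_deriv_chain:
  assumes w: "weak_deriv h u g"
    and F: "\<And>t. DERIV F t :> F' t" "\<And>t. \<bar>F' t\<bar> \<le> 1" "F 0 = 0"
    and [measurable]: "F' \<in> borel_measurable borel"
  shows "weak_deriv h (\<lambda>x. F (u x)) (\<lambda>x. F' (u x) * g x)"
proof -
  note ug = weak_derivD(1,2)[OF w]
  have [measurable]: "u \<in> borel_measurable borel" "g \<in> borel_measurable borel" using ug by auto
  have "continuous_on UNIV F" using F(1) by (meson DERIV_isCont continuous_at_imp_continuous_on)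
  then have [measurable]: "F \<in> borel_measurable borel" by (rule borel_measurable_continuous_onI)
  have lip: "\<bar>F a - F b\<bar> \<le> \<bar>a - b\<bar>" for a b
    using field_differentiable_bound[of UNIV F F' 1 a b] F by simp
  have iFu: "integrable lborel (\<lambda>x. F (u x))"
    by (rule Bochner_Integration.integrable_bound[OF ug(1)]) (use lip[of _ 0] F(3) in auto)
  have iG: "integrable lborel (\<lambda>x. F' (u x) * g x)"
    using ug F(2) by (intro integrable_mult_bounded[where B = 1]) auto
  define T where "T n = 1 / real (Suc n)" for n
  have T: "T \<longlonglongrightarrow> 0" "\<And>n. 0 < T n"
    using lim_inverse_n[THEN LIMSEQ_Suc] by (simp_all add: T_def[abs_def] inverse_eq_divide)
  define dq where "dq n x = (u (x + T n *\<^sub>R h) - u x) / T n" for n x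
  have idq: "integrable lborel (dq n)" for n
    using integrable_shift[OF ug(1)] ug(1) by (simp add: dq_def[abs_def])
  have L1: "(\<lambda>n. \<integral>x. \<bar>dq n x - g x\<bar> \<partial>lborel) \<longlonglongrightarrow> 0"
    unfolding dq_def using weak_deriv_difference_quotient[OF w T(1)] T(2) by (simp add: less_imp_neq[symmetric])
  obtain r :: "nat \<Rightarrow> nat" where r: "strict_mono r" and ae: "AE x in lborel. (\<lambda>n. dq (r n) x - g x) \<longlonglongrightarrow> 0"
    using tendsto_L1_AE_subseq[of lborel "\<lambda>n x. dq n x - g x"] L1 idq ug by auto
  have Tr: "(\<lambda>n. T (r n)) \<longlonglongrightarrow> 0" using LIMSEQ_subseq_LIMSEQ[OF T(1) r] by (simp add: o_def)
  define q where "q n x = (F (u (x + T (r n) *\<^sub>R h)) - F (u x)) / T (r n)" for n x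
  have iq: "integrable lborel (q n)" for n
    using integrable_shift[OF iFu] iFu by (simp add: q_def[abs_def])
  have q_le: "\<bar>q n x\<bar> \<le> \<bar>dq (r n) x\<bar>" for n x
    unfolding q_def dq_def using lip T(2)[of "r n"] by (simp add: abs_divide divide_right_mono)
  have q_lim: "AE x in lborel. (\<lambda>n. q n x) \<longlonglongrightarrow> F' (u x) * g x"
    using ae
  proof eventually_elim
    fix x assume "(\<lambda>n. dq (r n) x - g x) \<longlonglongrightarrow> 0"
    then have d: "(\<lambda>n. dq (r n) x) \<longlonglongrightarrow> g x" by (rule LIM_zero_cancel)
    \<comment> \<open>Caratheodory's form of differentiability, F(z) - F(u x) = \<gamma>(z) (z - u
      x) with \<gamma> continuous at u x, avoids a division by u(x + T h) - u(x), which may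
      vanish.\<close>
    obtain \<gamma> where \<gamma>: "\<And>z. F z - F (u x) = \<gamma> z * (z - u x)" "isCont \<gamma> (u x)" "\<gamma> (u x) = F' (u x)"
      using F(1)[of "u x"] unfolding CARAT_DERIV by auto
    have "(\<lambda>n. u x + T (r n) * dq (r n) x) \<longlonglongrightarrow> u x + 0 * g x" by (intro tendsto_intros Tr d)
    then have "(\<lambda>n. u (x + T (r n) *\<^sub>R h)) \<longlonglongrightarrow> u x"
      using T(2) by (simp add: dq_def less_imp_neq[symmetric])
    from isCont_tendsto_compose[OF \<gamma>(2) this]
    have "(\<lambda>n. \<gamma> (u (x + T (r n) *\<^sub>R h)) * dq (r n) x) \<longlonglongrightarrow> \<gamma> (u x) * g x"
      by (intro tendsto_mult d)
    moreover have "q n x = \<gamma> (u (x + T (r n) *\<^sub>R h)) * dq (r n) x" for n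
      unfolding q_def dq_def \<gamma>(1) by simp
    ultimately show "(\<lambda>n. q n x) \<longlonglongrightarrow> F' (u x) * g x" by (simp add: \<gamma>(3))
  qed
  \<comment> \<open>The natural majorants |dq| change with n. Subtracting the error |dq - g|, which
    is small in L1, and truncating at 0 leaves functions dominated by |g| + |F'(u) g|: this is
    generalized dominated convergence.\<close>
  have m: "integrable lborel (\<lambda>x. max (\<bar>q n x - F' (u x) * g x\<bar> - \<bar>dq (r n) x - g x\<bar>) 0)" for n
    using iq iG idq ug by (intro integrable_max Bochner_Integration.integrable_diff integrable_abs integrable_zero)
  have "(\<lambda>n. \<integral>x. max (\<bar>q n x - F' (u x) * g x\<bar> - \<bar>dq (r n) x - g x\<bar>) 0 \<partial>lborel) \<longlonglongrightarrow> (\<integral>x. 0 \<partial>(lborel::'a measure))"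
  proof (rule integral_dominated_convergence[where w = "\<lambda>x. \<bar>g x\<bar> + \<bar>F' (u x) * g x\<bar>"])
    show "AE x in lborel. (\<lambda>n. max (\<bar>q n x - F' (u x) * g x\<bar> - \<bar>dq (r n) x - g x\<bar>) 0) \<longlonglongrightarrow> 0"
      using q_lim ae
    proof eventually_elim
      case (elim x)
      have "(\<lambda>n. max (\<bar>q n x - F' (u x) * g x\<bar> - \<bar>dq (r n) x - g x\<bar>) 0) \<longlonglongrightarrow> max (\<bar>F' (u x) * g x - F' (u x) * g x\<bar> - \<bar>0\<bar>) 0"
        by (intro tendsto_max tendsto_diff tendsto_rabs tendsto_const elim)
      then show ?case by simp
    qed
    show "AE x in lborel. norm (max (\<bar>q n x - F' (u x) * g x\<bar> - \<bar>dq (r n) x - g x\<bar>) 0) \<le> \<bar>g x\<bar> + \<bar>F' (u x) * g x\<bar>" for n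
    proof (rule AE_I2)
      fix x
      show "norm (max (\<bar>q n x - F' (u x) * g x\<bar> - \<bar>dq (r n) x - g x\<bar>) 0) \<le> \<bar>g x\<bar> + \<bar>F' (u x) * g x\<bar>"
      proof -
        have "\<bar>q n x - F' (u x) * g x\<bar> - \<bar>dq (r n) x - g x\<bar> \<le> \<bar>g x\<bar> + \<bar>F' (u x) * g x\<bar>"
          using q_le[of n x] by linarith
        then show ?thesis by simp
      qed
    qed
    show "(\<lambda>x. max (\<bar>q n x - F' (u x) * g x\<bar> - \<bar>dq (r n) x - g x\<bar>) 0) \<in> borel_measurable lborel" for n
      using m[of n] by (rule borel_measurable_integrable)
  qed (use ug iG in auto)
  then have z1: "(\<lambda>n. (\<integral>x. max (\<bar>q n x - F' (u x) * g x\<bar> - \<bar>dq (r n) x - g x\<bar>) 0 \<partial>lborel) + (\<integral>x. \<bar>dq (r n) x - g x\<bar> \<partial>lborel)) \<longlonglongrightarrow> 0"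
    using LIMSEQ_subseq_LIMSEQ[OF L1 r] tendsto_add by (fastforce simp: o_def)
  have E0: "(\<lambda>n. \<integral>x. \<bar>q n x - F' (u x) * g x\<bar> \<partial>lborel) \<longlonglongrightarrow> 0"
  proof (rule Lim_null_comparison[OF _ z1], intro always_eventually allI)
    fix n
    have i: "integrable lborel (\<lambda>x. \<bar>dq (r n) x - g x\<bar>)" "integrable lborel (\<lambda>x. \<bar>q n x - F' (u x) * g x\<bar>)"
      by (rule integrable_abs[OF Bochner_Integration.integrable_diff[OF idq ug(2)]],
          rule integrable_abs[OF Bochner_Integration.integrable_diff[OF iq iG]])
    have "(\<integral>x. \<bar>q n x - F' (u x) * g x\<bar> \<partial>lborel) \<le>
      (\<integral>x. max (\<bar>q n x - F' (u x) * g x\<bar> - \<bar>dq (r n) x - g x\<bar>) 0 + \<bar>dq (r n) x - g x\<bar> \<partial>lborel)"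
      using i m by (intro integral_mono Bochner_Integration.integrable_add) auto
    then show "norm (\<integral>x. \<bar>q n x - F' (u x) * g x\<bar> \<partial>lborel) \<le> (\<integral>x. max (\<bar>q n x - F' (u x) * g x\<bar> - \<bar>dq (r n) x - g x\<bar>) 0 \<partial>lborel) + (\<integral>x. \<bar>dq (r n) x - g x\<bar> \<partial>lborel)"
      using i m by simp
  qed
  show ?thesis unfolding weak_deriv_def
  proof (intro conjI allI impI iFu iG)
    fix \<phi> :: "'a \<Rightarrow> real" and D
    assume a: "test_function UNIV \<phi> \<and> (\<forall>x. GDERIV \<phi> x :> D x)"
    then have \<phi>: "test_function UNIV \<phi>" and D: "\<And>x. GDERIV \<phi> x :> D x" by auto
    obtain B where B: "\<And>x. \<bar>\<phi> x\<bar> \<le> B" "\<And>x. norm (D x) \<le> B" "0 < B" using test_function_bounded[OF \<phi> D] by blast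
    note [measurable] = test_function_measurable[OF \<phi> D]
    have i1: "integrable lborel (\<lambda>x. \<phi> (x + c) * f x)" if "integrable lborel f" for f :: "'a \<Rightarrow> real" and c
      using that B by (intro integrable_mult_bounded[where B = B]) auto
    have i2: "integrable lborel (\<lambda>x. \<phi> x * f x)" if "integrable lborel f" for f :: "'a \<Rightarrow> real"
      using i1[of f 0] that by simp
    have "(\<lambda>n. B * (\<integral>x. \<bar>q n x - F' (u x) * g x\<bar> \<partial>lborel)) \<longlonglongrightarrow> B * 0" by (intro tendsto_intros E0)
    then have z2: "(\<lambda>n. B * (\<integral>x. \<bar>q n x - F' (u x) * g x\<bar> \<partial>lborel)) \<longlonglongrightarrow> 0" by simp
    have "(\<lambda>n. (\<integral>x. \<phi> x * q n x \<partial>lborel) - (\<integral>x. \<phi> x * (F' (u x) * g x) \<partial>lborel)) \<longlonglongrightarrow> 0"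
    proof (rule Lim_null_comparison[OF _ z2], intro always_eventually allI)
      fix n
      have i: "integrable lborel (\<lambda>x. \<bar>\<phi> x * (q n x - F' (u x) * g x)\<bar>)" "integrable lborel (\<lambda>x. \<bar>q n x - F' (u x) * g x\<bar>)"
        by (rule integrable_abs[OF i2[OF Bochner_Integration.integrable_diff[OF iq iG]]],
            rule integrable_abs[OF Bochner_Integration.integrable_diff[OF iq iG]])
      have "(\<integral>x. \<phi> x * q n x \<partial>lborel) - (\<integral>x. \<phi> x * (F' (u x) * g x) \<partial>lborel) = (\<integral>x. \<phi> x * (q n x - F' (u x) * g x) \<partial>lborel)"
        using i2[OF iq, of n] i2[OF iG] by (simp add: right_diff_distrib)
      also have "\<bar>\<dots>\<bar> \<le> (\<integral>x. \<bar>\<phi> x * (q n x - F' (u x) * g x)\<bar> \<partial>lborel)" by (rule integral_abs_bound)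
      also have "\<dots> \<le> (\<integral>x. B * \<bar>q n x - F' (u x) * g x\<bar> \<partial>lborel)"
        using B by (intro integral_mono[OF i(1)] integrable_mult_right i(2)) (auto simp: abs_mult intro!: mult_right_mono)
      finally show "norm ((\<integral>x. \<phi> x * q n x \<partial>lborel) - (\<integral>x. \<phi> x * (F' (u x) * g x) \<partial>lborel)) \<le> B * (\<integral>x. \<bar>q n x - F' (u x) * g x\<bar> \<partial>lborel)"
        by simp
    qed
    then have lim1: "(\<lambda>n. \<integral>x. \<phi> x * q n x \<partial>lborel) \<longlonglongrightarrow> (\<integral>x. \<phi> x * (F' (u x) * g x) \<partial>lborel)"
      by (rule LIM_zero_cancel)
    \<comment> \<open>Discrete integration by parts: a translation moves the shift from F(u) to the
      test function and reverses its direction.\<close>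
    have eq: "(\<integral>x. \<phi> x * q n x \<partial>lborel) = (\<integral>x. F (u x) * ((\<phi> (x - T (r n) *\<^sub>R h) - \<phi> x) / T (r n)) \<partial>lborel)" for n
    proof -
      let ?t = "T (r n)"
      have "(\<integral>x. \<phi> x * q n x \<partial>lborel) = (\<integral>x. (\<phi> x * F (u (x + ?t *\<^sub>R h)) - \<phi> x * F (u x)) / ?t \<partial>lborel)"
        by (intro Bochner_Integration.integral_cong) (auto simp: q_def right_diff_distrib)
      also have "\<dots> = ((\<integral>x. \<phi> x * F (u (x + ?t *\<^sub>R h)) \<partial>lborel) - (\<integral>x. \<phi> x * F (u x) \<partial>lborel)) / ?t"
        using i2[OF integrable_shift[OF iFu]] i2[OF iFu] by simp
      also have "(\<integral>x. \<phi> x * F (u (x + ?t *\<^sub>R h)) \<partial>lborel) = (\<integral>x. \<phi> (x - ?t *\<^sub>R h) * F (u x) \<partial>lborel)"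
        using integral_shift[of "\<lambda>x. \<phi> (x - ?t *\<^sub>R h) * F (u x)" "?t *\<^sub>R h"] by simp
      also have "((\<integral>x. \<phi> (x - ?t *\<^sub>R h) * F (u x) \<partial>lborel) - (\<integral>x. \<phi> x * F (u x) \<partial>lborel)) / ?t =
         (\<integral>x. (\<phi> (x - ?t *\<^sub>R h) * F (u x) - \<phi> x * F (u x)) / ?t \<partial>lborel)"
        using i1[OF iFu, of "- (?t *\<^sub>R h)"] i2[OF iFu] by simp
      also have "\<dots> = (\<integral>x. F (u x) * ((\<phi> (x - ?t *\<^sub>R h) - \<phi> x) / ?t) \<partial>lborel)"
        by (intro Bochner_Integration.integral_cong) (auto simp: field_simps)
      finally show ?thesis .
    qed
    have "(\<lambda>n. \<integral>x. F (u x) * ((\<phi> (x - T (r n) *\<^sub>R h) - \<phi> x) / T (r n)) \<partial>lborel) \<longlonglongrightarrow> (\<integral>x. F (u x) * - (D x \<bullet> h) \<partial>lborel)"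
    proof (rule integral_dominated_convergence[where w = "\<lambda>x. \<bar>F (u x)\<bar> * (B * norm h)"])
      show "AE x in lborel. (\<lambda>n. F (u x) * ((\<phi> (x - T (r n) *\<^sub>R h) - \<phi> x) / T (r n))) \<longlonglongrightarrow> F (u x) * - (D x \<bullet> h)"
      proof (intro AE_I2 tendsto_mult tendsto_const)
        fix x
        have "((\<lambda>s. x - s *\<^sub>R h) has_derivative (\<lambda>s. 0 - s *\<^sub>R h)) (at 0)" by (intro derivative_intros)
        from has_derivative_compose[OF this, of \<phi> "\<lambda>y. y \<bullet> D x"] D[of x]
        have "((\<lambda>s. \<phi> (x - s *\<^sub>R h)) has_derivative (\<lambda>s. (0 - s *\<^sub>R h) \<bullet> D x)) (at 0)"
          unfolding gderiv_def by simp
        then have "DERIV (\<lambda>s. \<phi> (x - s *\<^sub>R h)) 0 :> - (D x \<bullet> h)"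
          unfolding has_field_derivative_def by (rule has_derivative_eq_rhs) (auto simp: inner_commute)
        then have "((\<lambda>s. (\<phi> (x - s *\<^sub>R h) - \<phi> x) / s) \<longlongrightarrow> - (D x \<bullet> h)) (at 0)" by (simp add: DERIV_def)
        moreover have "filterlim (\<lambda>n. T (r n)) (at 0) sequentially"
          using Tr T(2) by (intro filterlim_atI) (auto simp: less_imp_neq[symmetric])
        ultimately show "(\<lambda>n. (\<phi> (x - T (r n) *\<^sub>R h) - \<phi> x) / T (r n)) \<longlonglongrightarrow> - (D x \<bullet> h)"
          by (rule filterlim_compose)
      qed
      show "AE x in lborel. norm (F (u x) * ((\<phi> (x - T (r n) *\<^sub>R h) - \<phi> x) / T (r n))) \<le> \<bar>F (u x)\<bar> * (B * norm h)" for n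
      proof (rule AE_I2)
        fix x
        have "\<bar>\<phi> (x - T (r n) *\<^sub>R h) - \<phi> x\<bar> \<le> B * norm h * T (r n)"
          using test_function_Lipschitz[OF D B(2), of "x - T (r n) *\<^sub>R h" x] T(2)[of "r n"] by (simp add: mult_ac)
        then have "\<bar>(\<phi> (x - T (r n) *\<^sub>R h) - \<phi> x) / T (r n)\<bar> \<le> B * norm h"
          using T(2)[of "r n"] by (simp add: abs_divide field_simps)
        then show "norm (F (u x) * ((\<phi> (x - T (r n) *\<^sub>R h) - \<phi> x) / T (r n))) \<le> \<bar>F (u x)\<bar> * (B * norm h)"
          unfolding real_norm_def abs_mult by (intro mult_left_mono) auto
      qed
    qed (use iFu in auto)
    then have "(\<lambda>n. \<integral>x. \<phi> x * q n x \<partial>lborel) \<longlonglongrightarrow> - (\<integral>x. F (u x) * (D x \<bullet> h) \<partial>lborel)" by (simp add: eq)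
    from LIMSEQ_unique[OF this lim1]
    show "(\<integral>x. F (u x) * (D x \<bullet> h) \<partial>lborel) = - (\<integral>x. \<phi> x * (F' (u x) * g x) \<partial>lborel)" by simp
  qed
qed

lemma DERIV_max_square: "DERIV (\<lambda>t. (max (t - k) 0)\<^sup>2) t :> 2 * max (t - k) (0::real)"
proof (cases t k rule: linorder_cases)
  case less
  have ev: "eventually (\<lambda>s. 0 = (max (s - k) 0)\<^sup>2) (nhds t)"
    using eventually_nhds_in_open[OF open_lessThan[of k], of t] less by (auto elim!: eventually_mono)
  show ?thesis using DERIV_cong_ev[OF refl ev refl, of 0] less by simp
next
  case greater
  have ev: "eventually (\<lambda>s. (s - k)\<^sup>2 = (max (s - k) 0)\<^sup>2) (nhds t)"
    using eventually_nhds_in_open[OF open_greaterThan[of k], of t] greater by (auto elim!: eventually_mono)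
  have "DERIV (\<lambda>s. (s - k)\<^sup>2) t :> 2 * (t - k)" by (auto intro!: derivative_eq_intros)
  then show ?thesis using DERIV_cong_ev[OF refl ev refl, of "2 * (t - k)"] greater by simp
next
  case equal
  have "((\<lambda>h. ((max (t + h - k) 0)\<^sup>2 - (max (t - k) 0)\<^sup>2) / h) \<longlongrightarrow> 0) (at 0)"
  proof (rule Lim_null_comparison)
    show "((\<lambda>h. \<bar>h\<bar>) \<longlongrightarrow> 0) (at (0::real))" using tendsto_rabs_zero[OF tendsto_ident_at] .
    show "eventually (\<lambda>h. norm (((max (t + h - k) 0)\<^sup>2 - (max (t - k) 0)\<^sup>2) / h) \<le> \<bar>h\<bar>) (at 0)"
      using equal by (intro always_eventually allI) (auto simp: max_def power2_eq_square abs_mult)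
  qed
  then show ?thesis using equal by (simp add: DERIV_def)
qed

text \<open>The positive part is approximated by F(t) = sqrt((t-k)_+^2 + e^2) - e. Its derivatives
  stay in [0,1] and converge pointwise to the indicator of t > k; at t = k they are 0 for every e.
  The condition 0 \<le> k gives F(0) = 0, on which integrability rests.\<close>

lemma weak_deriv_pos_part:
  assumes w: "weak_deriv h u g" and k: "0 \<le> k"
  shows "weak_deriv h (\<lambda>x. max (u x - k) 0) (\<lambda>x. indicator {x. k < u x} x * g x)"
proof -
  note ug = weak_derivD(1,2)[OF w]
  have [measurable]: "u \<in> borel_measurable borel" "g \<in> borel_measurable borel" using ug by auto
  define e where "e n = 1 / real (Suc n)" for n
  have e: "e \<longlonglongrightarrow> 0" "\<And>n. 0 < e n"
    using lim_inverse_n[THEN LIMSEQ_Suc] by (simp_all add: e_def[abs_def] inverse_eq_divide)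
  define F where "F n t = sqrt ((max (t - k) 0)\<^sup>2 + (e n)\<^sup>2) - e n" for n t
  define F' where "F' n t = max (t - k) 0 / sqrt ((max (t - k) 0)\<^sup>2 + (e n)\<^sup>2)" for n t
  have pos: "0 < (max (t - k) 0)\<^sup>2 + (e n)\<^sup>2" for t n
    using e(2)[of n] by (simp add: add_nonneg_pos)
  have DF: "DERIV (F n) t :> F' n t" for n t
  proof -
    have "DERIV (F n) t :> inverse (sqrt ((max (t - k) 0)\<^sup>2 + (e n)\<^sup>2)) / 2 * (2 * max (t - k) 0 + 0) - 0"
      unfolding F_def[abs_def]
      by (intro DERIV_diff DERIV_const DERIV_chain2[where f = sqrt and g = "\<lambda>t. (max (t - k) 0)\<^sup>2 + (e n)\<^sup>2", OF DERIV_real_sqrt[OF pos]] DERIV_add DERIV_max_square)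
    then show ?thesis by (simp add: F'_def field_simps)
  qed
  have F'1: "\<bar>F' n t\<bar> \<le> 1" for n t
  proof -
    have "max (t - k) 0 \<le> sqrt ((max (t - k) 0)\<^sup>2 + (e n)\<^sup>2)" by (rule real_le_rsqrt) simp
    then show ?thesis unfolding F'_def using pos[of t n] by (simp add: abs_divide)
  qed
  have F0: "F n 0 = 0" for n using k e(2)[of n] by (simp add: F_def max_def)
  have [measurable]: "F' n \<in> borel_measurable borel" for n unfolding F'_def[abs_def] by measurable
  have ch: "weak_deriv h (\<lambda>x. F n (u x)) (\<lambda>x. F' n (u x) * g x)" for n
    by (rule weak_deriv_chain[OF w DF F'1 F0]) simp
  have F_le: "\<bar>F n t\<bar> \<le> \<bar>t\<bar>" for n t
    using field_differentiable_bound[of UNIV "F n" "F' n" 1 t 0] DF F'1 F0 by simp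
  have F_lim: "(\<lambda>n. F n t) \<longlonglongrightarrow> max (t - k) 0" for t
  proof -
    have "(\<lambda>n. F n t) \<longlonglongrightarrow> sqrt ((max (t - k) 0)\<^sup>2 + 0\<^sup>2) - 0" unfolding F_def by (intro tendsto_intros e)
    then show ?thesis by simp
  qed
  have F'_lim: "(\<lambda>n. F' n t) \<longlonglongrightarrow> (if k < t then 1 else 0)" for t
  proof (cases "k < t")
    case True
    have "(\<lambda>n. F' n t) \<longlonglongrightarrow> max (t - k) 0 / sqrt ((max (t - k) 0)\<^sup>2 + 0\<^sup>2)"
      unfolding F'_def using True by (intro tendsto_intros e) (simp add: max_def)
    then show ?thesis using True by (simp add: max_def)
  qed (simp add: F'_def max_def)
  show ?thesis unfolding weak_deriv_def
  proof (intro conjI allI impI)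
    show "integrable lborel (\<lambda>x. max (u x - k) 0)"
      by (rule Bochner_Integration.integrable_bound[OF ug(1)]) (use k in auto)
    show "integrable lborel (\<lambda>x. indicator {x. k < u x} x * g x)"
      using ug by (intro integrable_mult_bounded[where B = 1]) auto
    fix \<phi> :: "'a \<Rightarrow> real" and D
    assume a: "test_function UNIV \<phi> \<and> (\<forall>x. GDERIV \<phi> x :> D x)"
    then have \<phi>: "test_function UNIV \<phi>" and D: "\<And>x. GDERIV \<phi> x :> D x" by auto
    obtain B where B: "\<And>x. \<bar>\<phi> x\<bar> \<le> B" "\<And>x. norm (D x) \<le> B" "0 < B" using test_function_bounded[OF \<phi> D] by blast
    note [measurable] = test_function_measurable[OF \<phi> D]
    have [measurable]: "F n \<in> borel_measurable borel" for n unfolding F_def[abs_def] by measurable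
    have bD: "\<bar>D x \<bullet> h\<bar> \<le> B * norm h" for x
      using Cauchy_Schwarz_ineq2[of "D x" h] mult_right_mono[OF B(2)[of x], of "norm h"] by simp
    have 1: "(\<lambda>n. \<integral>x. F n (u x) * (D x \<bullet> h) \<partial>lborel) \<longlonglongrightarrow> (\<integral>x. max (u x - k) 0 * (D x \<bullet> h) \<partial>lborel)"
    proof (rule integral_dominated_convergence[where w = "\<lambda>x. \<bar>u x\<bar> * (B * norm h)"])
      show "AE x in lborel. norm (F n (u x) * (D x \<bullet> h)) \<le> \<bar>u x\<bar> * (B * norm h)" for n
        using F_le bD B(3) unfolding real_norm_def abs_mult by (intro AE_I2 mult_mono) auto
      show "AE x in lborel. (\<lambda>n. F n (u x) * (D x \<bullet> h)) \<longlonglongrightarrow> max (u x - k) 0 * (D x \<bullet> h)"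
        by (intro AE_I2 tendsto_mult F_lim tendsto_const)
    qed (use ug in auto)
    have 2: "(\<lambda>n. \<integral>x. \<phi> x * (F' n (u x) * g x) \<partial>lborel) \<longlonglongrightarrow> (\<integral>x. \<phi> x * (indicator {x. k < u x} x * g x) \<partial>lborel)"
    proof (rule integral_dominated_convergence[where w = "\<lambda>x. B * (1 * \<bar>g x\<bar>)"])
      show "AE x in lborel. norm (\<phi> x * (F' n (u x) * g x)) \<le> B * (1 * \<bar>g x\<bar>)" for n
        using F'1 B unfolding real_norm_def abs_mult by (intro AE_I2 mult_mono) auto
      show "AE x in lborel. (\<lambda>n. \<phi> x * (F' n (u x) * g x)) \<longlonglongrightarrow> \<phi> x * (indicator {x. k < u x} x * g x)"
      proof (intro AE_I2 tendsto_mult tendsto_const)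
        fix x show "(\<lambda>n. F' n (u x)) \<longlonglongrightarrow> indicator {x. k < u x} x"
          using F'_lim[of "u x"] by (cases "k < u x") simp_all
      qed
    qed (use ug in auto)
    have "(\<lambda>n. \<integral>x. F n (u x) * (D x \<bullet> h) \<partial>lborel) = (\<lambda>n. - (\<integral>x. \<phi> x * (F' n (u x) * g x) \<partial>lborel))"
      using weak_derivD(3)[OF ch \<phi> D] by simp
    with tendsto_minus[OF 2] have "(\<lambda>n. \<integral>x. F n (u x) * (D x \<bullet> h) \<partial>lborel) \<longlonglongrightarrow> - (\<integral>x. \<phi> x * (indicator {x. k < u x} x * g x) \<partial>lborel)"
      by simp
    from LIMSEQ_unique[OF 1 this]
    show "(\<integral>x. max (u x - k) 0 * (D x \<bullet> h) \<partial>lborel) = - (\<integral>x. \<phi> x * (indicator {x. k < u x} x * g x) \<partial>lborel)" .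
  qed
qed

text \<open>Test the identity for u with \<zeta>\<phi> and move the term with the gradient of
  \<zeta> to the other side.\<close>

lemma weak_deriv_mult:
  assumes w: "weak_deriv h u g" and z: "test_function UNIV \<zeta>" "\<And>x. GDERIV \<zeta> x :> Z x"
  shows "weak_deriv h (\<lambda>x. \<zeta> x * u x) (\<lambda>x. \<zeta> x * g x + u x * (Z x \<bullet> h))"
proof -
  note ug = weak_derivD(1,2)[OF w]
  obtain B where B: "\<And>x. \<bar>\<zeta> x\<bar> \<le> B" "\<And>x. norm (Z x) \<le> B" "0 < B" using test_function_bounded[OF z] by blast
  note [measurable] = test_function_measurable[OF z]
  have bZ: "\<bar>Z x \<bullet> h\<bar> \<le> B * norm h" for x
    using Cauchy_Schwarz_ineq2[of "Z x" h] mult_right_mono[OF B(2)[of x], of "norm h"] by simp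
  have i: "integrable lborel (\<lambda>x. \<zeta> x * u x)" "integrable lborel (\<lambda>x. \<zeta> x * g x)" "integrable lborel (\<lambda>x. (Z x \<bullet> h) * u x)"
    using ug B bZ by (auto intro!: integrable_mult_bounded)
  show ?thesis unfolding weak_deriv_def
  proof (intro conjI allI impI)
    show "integrable lborel (\<lambda>x. \<zeta> x * u x)" "integrable lborel (\<lambda>x. \<zeta> x * g x + u x * (Z x \<bullet> h))"
      using i by (auto simp: mult.commute)
    fix \<phi> :: "'a \<Rightarrow> real" and D
    assume a: "test_function UNIV \<phi> \<and> (\<forall>x. GDERIV \<phi> x :> D x)"
    then have \<phi>: "test_function UNIV \<phi>" and D: "\<And>x. GDERIV \<phi> x :> D x" by auto
    obtain B' where B': "\<And>x. \<bar>\<phi> x\<bar> \<le> B'" "\<And>x. norm (D x) \<le> B'" "0 < B'" using test_function_bounded[OF \<phi> D] by blast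
    note [measurable] = test_function_measurable[OF \<phi> D]
    have bD: "\<bar>D x \<bullet> h\<bar> \<le> B' * norm h" for x
      using Cauchy_Schwarz_ineq2[of "D x" h] mult_right_mono[OF B'(2)[of x], of "norm h"] by simp
    have j: "integrable lborel (\<lambda>x. (D x \<bullet> h) * (\<zeta> x * u x))" "integrable lborel (\<lambda>x. \<phi> x * ((Z x \<bullet> h) * u x))"
        "integrable lborel (\<lambda>x. \<phi> x * (\<zeta> x * g x))"
      using i B' bD by (auto intro!: integrable_mult_bounded)
    have "(\<integral>x. u x * ((\<zeta> x *\<^sub>R D x + \<phi> x *\<^sub>R Z x) \<bullet> h) \<partial>lborel) = - (\<integral>x. \<zeta> x * \<phi> x * g x \<partial>lborel)"
    proof (rule weak_derivD(3)[OF w])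
      show "test_function UNIV (\<lambda>x. \<zeta> x * \<phi> x)"
        using \<phi> by (intro test_function_mult[OF z(1)]) (simp add: test_function_def)
      show "GDERIV (\<lambda>x. \<zeta> x * \<phi> x) x :> \<zeta> x *\<^sub>R D x + \<phi> x *\<^sub>R Z x" for x
        by (rule GDERIV_mult[OF z(2) D])
    qed
    also have "(\<integral>x. u x * ((\<zeta> x *\<^sub>R D x + \<phi> x *\<^sub>R Z x) \<bullet> h) \<partial>lborel)
      = (\<integral>x. (D x \<bullet> h) * (\<zeta> x * u x) + \<phi> x * ((Z x \<bullet> h) * u x) \<partial>lborel)"
      by (intro Bochner_Integration.integral_cong) (auto simp: inner_add_left algebra_simps)
    also have "\<dots> = (\<integral>x. (D x \<bullet> h) * (\<zeta> x * u x) \<partial>lborel) + (\<integral>x. \<phi> x * ((Z x \<bullet> h) * u x) \<partial>lborel)"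
      using j by simp
    finally have "(\<integral>x. (D x \<bullet> h) * (\<zeta> x * u x) \<partial>lborel) = - ((\<integral>x. \<phi> x * (\<zeta> x * g x) \<partial>lborel) + (\<integral>x. \<phi> x * ((Z x \<bullet> h) * u x) \<partial>lborel))"
      by (simp add: mult_ac)
    also have "\<dots> = - (\<integral>x. \<phi> x * (\<zeta> x * g x) + \<phi> x * ((Z x \<bullet> h) * u x) \<partial>lborel)" using j by simp
    finally show "(\<integral>x. \<zeta> x * u x * (D x \<bullet> h) \<partial>lborel) = - (\<integral>x. \<phi> x * (\<zeta> x * g x + u x * (Z x \<bullet> h)) \<partial>lborel)"
      by (simp add: algebra_simps)
  qed
qed

section \<open>The Faber-Krahn inequality\<close>

text \<open>Convexity of the power function in tangent form, obtained from Young's inequality for a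
  and m^(p-1) with the exponents p and p/(p-1).\<close>

lemma powr_tangent:
  fixes a m p :: real
  assumes p: "1 < p" and a: "0 \<le> a" and m: "0 < m"
  shows "m powr p + p * m powr (p - 1) * (a - m) \<le> a powr p"
proof -
  define q where "q = p / (p - 1)"
  have q: "1 < q" "1/p + 1/q = 1" "q * (p - 1) = p" using p by (auto simp: q_def field_simps)
  have "a * m powr (p - 1) \<le> a powr p / p + (m powr (p - 1)) powr q / q"
    using Youngs_inequality[of p q a "m powr (p - 1)"] p q a by simp
  also have "(m powr (p - 1)) powr q = m powr p" using q(3) by (simp add: powr_powr mult.commute)
  finally have "p * (a * m powr (p - 1)) \<le> p * (a powr p / p + m powr p / q)"
    using p by (intro mult_left_mono) auto
  also have "\<dots> = a powr p + (p - 1) * m powr p" using p by (simp add: q_def field_simps)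
  finally have le: "p * (a * m powr (p - 1)) \<le> a powr p + (p - 1) * m powr p" .
  have e: "m powr (p - 1) * m = m powr p" using m by (simp add: powr_diff)
  have "m powr p + p * m powr (p - 1) * (a - m) = m powr p + p * (a * m powr (p - 1)) - p * (m powr (p - 1) * m)"
    by (simp add: algebra_simps)
  also have "\<dots> = m powr p + p * (a * m powr (p - 1)) - p * m powr p" unfolding e ..
  finally have E: "m powr p + p * m powr (p - 1) * (a - m) = m powr p + p * (a * m powr (p - 1)) - p * m powr p" .
  have "(p - 1) * m powr p = p * m powr p - m powr p" by (simp add: left_diff_distrib)
  then show ?thesis using le unfolding E by linarith
qed

text \<open>Integrating the tangent inequality at the mean m over [0,1] makes the linear term drop
  out. This requires m > 0 and a finite right side; the remaining cases are trivial.\<close>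

lemma unit_interval_Jensen:
  fixes f :: "real \<Rightarrow> real"
  assumes p: "1 < p" and i: "integrable lborel (\<lambda>t. indicator {0..1} t * f t)" and f: "\<And>t. 0 \<le> f t"
    and [measurable]: "f \<in> borel_measurable borel"
  shows "ennreal ((\<integral>t. indicator {0..1} t * f t \<partial>lborel) powr p) \<le> (\<integral>\<^sup>+t. ennreal (f t powr p) * indicator {0..1} t \<partial>lborel)"
proof -
  define m where "m = (\<integral>t. indicator {0..1} t * f t \<partial>lborel)"
  have "0 \<le> m" unfolding m_def using f by (intro Bochner_Integration.integral_nonneg) auto
  have eq: "(\<integral>\<^sup>+t. ennreal (f t powr p) * indicator {0..1} t \<partial>lborel) = (\<integral>\<^sup>+t. ennreal (indicator {0..1} t * f t powr p) \<partial>lborel)"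
    by (intro nn_integral_cong) (auto split: split_indicator)
  show ?thesis
  proof (cases "m = 0 \<or> (\<integral>\<^sup>+t. ennreal (indicator {0..1} t * f t powr p) \<partial>lborel) = \<infinity>")
    case True
    then show ?thesis unfolding m_def[symmetric] eq using p by auto
  next
    case False
    then have m: "0 < m" using \<open>0 \<le> m\<close> by simp
    have ip: "integrable lborel (\<lambda>t. indicator {0..1} t * f t powr p)"
      using False by (intro integrableI_nonneg) (auto simp: less_top)
    have 1: "integrable lborel (\<lambda>t. indicator {0..1::real} t * (m powr p - p * m powr (p - 1) * m))" by simp
    have 2: "integrable lborel (\<lambda>t. p * m powr (p - 1) * (indicator {0..1} t * f t))"
      using i by simp
    have "m powr p = (m powr p - p * m powr (p - 1) * m) + p * m powr (p - 1) * m" by simp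
    also have "\<dots> = (\<integral>t. indicator {0..1::real} t * (m powr p - p * m powr (p - 1) * m) + p * m powr (p - 1) * (indicator {0..1} t * f t) \<partial>lborel)"
      using 1 2 by (subst Bochner_Integration.integral_add) (simp_all add: m_def)
    also have "\<dots> \<le> (\<integral>t. indicator {0..1} t * f t powr p \<partial>lborel)"
    proof (rule integral_mono[OF Bochner_Integration.integrable_add[OF 1 2] ip])
      fix t :: real
      show "indicator {0..1} t * (m powr p - p * m powr (p - 1) * m) + p * m powr (p - 1) * (indicator {0..1} t * f t) \<le> indicator {0..1} t * f t powr p"
        using powr_tangent[OF p f m, of t] by (auto simp: indicator_def algebra_simps)
    qed
    finally have "ennreal (m powr p) \<le> ennreal (\<integral>t. indicator {0..1} t * f t powr p \<partial>lborel)" by (rule ennreal_leI)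
    also have "\<dots> = (\<integral>\<^sup>+t. ennreal (indicator {0..1} t * f t powr p) \<partial>lborel)"
      using ip by (intro nn_integral_eq_integral[symmetric]) auto
    finally show ?thesis unfolding m_def[symmetric] eq .
  qed
qed

text \<open>Jensen on the segment from x to x + h, then Tonelli; shifting back shows that every t
  contributes the same integral of |g|^p, with g the derivative along h.\<close>

lemma Lp_translation:
  fixes v :: "'a::euclidean_space \<Rightarrow> real" and G :: "'a \<Rightarrow> 'a"
  assumes p: "1 < p" and w: "weak_deriv h v (\<lambda>x. G x \<bullet> h)" and [measurable]: "G \<in> borel_measurable borel"
  shows "(\<integral>\<^sup>+x. ennreal (\<bar>v (x + h) - v x\<bar> powr p) \<partial>lborel) \<le> ennreal (norm h powr p) * (\<integral>\<^sup>+x. ennreal (norm (G x) powr p) \<partial>lborel)"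
proof -
  note vg = weak_derivD(1,2)[OF w]
  define g where "g x = G x \<bullet> h" for x
  have [measurable]: "g \<in> borel_measurable borel" unfolding g_def[abs_def] by measurable
  have ig: "integrable lborel g" using vg(2) unfolding g_def[abs_def] .
  have iG: "integrable (lborel \<Otimes>\<^sub>M lborel) (\<lambda>(t, x). indicator {0..1} t * \<bar>g (x + t *\<^sub>R h)\<bar>)"
    using integrable_prod_unit_interval[of "\<lambda>(t, x). \<bar>g (x + t *\<^sub>R h)\<bar>" "\<integral>x. \<bar>g x\<bar> \<partial>lborel"]
      integrable_shift[OF integrable_abs[OF ig]] integral_shift[of "\<lambda>x. \<bar>g x\<bar>"] by (simp add: borel_prod[symmetric])
  have aeG: "AE x in lborel. integrable lborel (\<lambda>t. indicator {0..1} t * \<bar>g (x + t *\<^sub>R h)\<bar>)"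
    using lborel_pair.AE_integrable_snd[of "\<lambda>t x. indicator {0..1} t * \<bar>g (x + t *\<^sub>R h)\<bar>"] iG by simp
  have "AE x in lborel. ennreal (\<bar>v (x + h) - v x\<bar> powr p) \<le> (\<integral>\<^sup>+t. ennreal (\<bar>g (x + t *\<^sub>R h)\<bar> powr p) * indicator {0..1} t \<partial>lborel)"
    using weak_deriv_translation(1)[OF w] aeG
  proof eventually_elim
    case (elim x)
    have "\<bar>v (x + h) - v x\<bar> \<le> (\<integral>t. \<bar>indicator {0..1} t * g (x + t *\<^sub>R h)\<bar> \<partial>lborel)"
      unfolding elim(1) g_def by (rule integral_abs_bound)
    also have "\<dots> = (\<integral>t. indicator {0..1} t * \<bar>g (x + t *\<^sub>R h)\<bar> \<partial>lborel)"
      by (simp add: abs_mult)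
    finally have "\<bar>v (x + h) - v x\<bar> powr p \<le> \<dots> powr p" using p by (intro powr_mono2) auto
    then have "ennreal (\<bar>v (x + h) - v x\<bar> powr p) \<le> ennreal \<dots>" by (rule ennreal_leI)
    also have "\<dots> \<le> (\<integral>\<^sup>+t. ennreal (\<bar>g (x + t *\<^sub>R h)\<bar> powr p) * indicator {0..1} t \<partial>lborel)"
      by (rule unit_interval_Jensen[OF p elim(2)]) auto
    finally show ?case .
  qed
  then have "(\<integral>\<^sup>+x. ennreal (\<bar>v (x + h) - v x\<bar> powr p) \<partial>lborel) \<le>
     (\<integral>\<^sup>+x. (\<integral>\<^sup>+t. ennreal (\<bar>g (x + t *\<^sub>R h)\<bar> powr p) * indicator {0..1} t \<partial>lborel) \<partial>lborel)"
    by (rule nn_integral_mono_AE)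
  also have "\<dots> = (\<integral>\<^sup>+t. (\<integral>\<^sup>+x. ennreal (\<bar>g (x + t *\<^sub>R h)\<bar> powr p) * indicator {0..1} t \<partial>lborel) \<partial>lborel)"
    by (rule lborel_pair.Fubini') (simp add: borel_prod[symmetric])
  also have "\<dots> = (\<integral>\<^sup>+t. (\<integral>\<^sup>+x. ennreal (\<bar>g x\<bar> powr p) \<partial>lborel) * indicator {0..1::real} t \<partial>lborel)"
    using nn_integral_shift[of "\<lambda>x. ennreal (\<bar>g x\<bar> powr p)"] by (simp add: nn_integral_multc)
  also have "\<dots> = (\<integral>\<^sup>+x. ennreal (\<bar>g x\<bar> powr p) \<partial>lborel)"
    by (simp add: nn_integral_cmult)
  also have "\<dots> \<le> (\<integral>\<^sup>+x. ennreal (norm h powr p) * ennreal (norm (G x) powr p) \<partial>lborel)"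
  proof (rule nn_integral_mono)
    fix x
    have "\<bar>g x\<bar> powr p \<le> (norm h * norm (G x)) powr p"
      unfolding g_def using Cauchy_Schwarz_ineq2[of "G x" h] p by (intro powr_mono2) (auto simp: mult.commute)
    then show "ennreal (\<bar>g x\<bar> powr p) \<le> ennreal (norm h powr p) * ennreal (norm (G x) powr p)"
      by (simp add: powr_mult ennreal_mult[symmetric] ennreal_leI)
  qed
  also have "\<dots> = ennreal (norm h powr p) * (\<integral>\<^sup>+x. ennreal (norm (G x) powr p) \<partial>lborel)"
    by (rule nn_integral_cmult) simp
  finally show ?thesis .
qed

text \<open>If \<open>v\<close> vanishes outside a set of at most half the volume of a ball of radius \<open>R\<close>, then for each
  \<open>x\<close> at least half of the shifts \<open>h\<close> in that ball satisfy \<open>v (x + h) = 0\<close>, so that averaging the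
  translation estimate over \<open>h\<close> bounds \<open>v\<close> itself.  This replaces the Sobolev inequality and has the
  same scaling.\<close>

lemma Faber_Krahn:
  fixes v :: "'a::euclidean_space \<Rightarrow> real" and G :: "'a \<Rightarrow> 'a"
  assumes p: "1 < p" and w: "\<And>h. weak_deriv h v (\<lambda>x. G x \<bullet> h)" and [measurable]: "G \<in> borel_measurable borel"
    and R: "0 < R" "2 * emeasure lborel {x. v x \<noteq> 0} \<le> emeasure lborel (ball (0::'a) R)"
  shows "(\<integral>\<^sup>+x. ennreal (\<bar>v x\<bar> powr p) \<partial>lborel) \<le> ennreal (2 * R powr p) * (\<integral>\<^sup>+x. ennreal (norm (G x) powr p) \<partial>lborel)"
proof -
  have [measurable]: "v \<in> borel_measurable borel" using weak_derivD(1)[OF w] by auto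
  define A where "A = {x. v x \<noteq> 0}"
  have [measurable]: "A \<in> sets borel" unfolding A_def by measurable
  define I where "I = (\<integral>\<^sup>+x. ennreal (norm (G x) powr p) \<partial>lborel)"
  define J where "J = (\<integral>\<^sup>+x. ennreal (\<bar>v x\<bar> powr p) \<partial>lborel)"
  have [measurable]: "ball (0::'a) R \<in> sets borel" by simp
  define b where "b = emeasure lborel (ball (0::'a) R)"
  have b: "b \<noteq> 0" "b \<noteq> \<infinity>"
    using content_ball_pos[OF R(1), of "0::'a"] emeasure_bounded_finite[of "ball (0::'a) R"]
    by (auto simp: b_def measure_def)
  have half: "b \<le> 2 * emeasure lborel (ball 0 R - (\<lambda>h. x + h) -` A)" for x
  proof -
    have [measurable]: "(\<lambda>h. x + h) -` A \<in> sets borel" using measurable_sets[of "\<lambda>h. x + h" borel borel A] by simp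
    have "emeasure lborel ((\<lambda>h. x + h) -` A) = emeasure (distr lborel borel ((+) x)) A"
      by (subst emeasure_distr) auto
    then have e: "emeasure lborel ((\<lambda>h. x + h) -` A) = emeasure lborel A" by (simp add: lborel_distr_plus)
    have "b \<le> emeasure lborel ((ball 0 R - (\<lambda>h. x + h) -` A) \<union> (\<lambda>h. x + h) -` A)"
      unfolding b_def by (intro emeasure_mono) auto
    also have "\<dots> \<le> emeasure lborel (ball 0 R - (\<lambda>h. x + h) -` A) + emeasure lborel ((\<lambda>h. x + h) -` A)"
      by (intro emeasure_subadditive) auto
    finally have "2 * b \<le> 2 * emeasure lborel (ball 0 R - (\<lambda>h. x + h) -` A) + 2 * emeasure lborel A"
      unfolding e distrib_left[symmetric] by (intro mult_left_mono) auto
    also have "\<dots> \<le> 2 * emeasure lborel (ball 0 R - (\<lambda>h. x + h) -` A) + b"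
      using R(2) by (intro add_left_mono) (simp add: A_def b_def)
    finally show ?thesis using b(2) by (simp add: mult_2 ennreal_add_left_cancel_le add.commute)
  qed
  have "b * J = (\<integral>\<^sup>+x. ennreal (\<bar>v x\<bar> powr p) * b \<partial>lborel)"
    unfolding J_def by (subst nn_integral_multc) (auto simp: mult.commute)
  also have "\<dots> \<le> (\<integral>\<^sup>+x. 2 * (\<integral>\<^sup>+h. ennreal (\<bar>v (x + h) - v x\<bar> powr p) * indicator (ball 0 R) h \<partial>lborel) \<partial>lborel)"
  proof (rule nn_integral_mono)
    fix x
    have [measurable]: "(\<lambda>h. x + h) -` A \<in> sets borel" using measurable_sets[of "\<lambda>h. x + h" borel borel A] by simp
    have "ennreal (\<bar>v x\<bar> powr p) * b \<le> ennreal (\<bar>v x\<bar> powr p) * (2 * emeasure lborel (ball 0 R - (\<lambda>h. x + h) -` A))"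
      by (intro mult_left_mono half) auto
    also have "\<dots> = 2 * (\<integral>\<^sup>+h. ennreal (\<bar>v x\<bar> powr p) * indicator (ball 0 R - (\<lambda>h. x + h) -` A) h \<partial>lborel)"
      by (subst nn_integral_cmult_indicator) (auto simp: mult_ac)
    also have "\<dots> \<le> 2 * (\<integral>\<^sup>+h. ennreal (\<bar>v (x + h) - v x\<bar> powr p) * indicator (ball 0 R) h \<partial>lborel)"
      by (intro mult_left_mono nn_integral_mono) (auto simp: A_def split: split_indicator)
    finally show "ennreal (\<bar>v x\<bar> powr p) * b \<le> 2 * (\<integral>\<^sup>+h. ennreal (\<bar>v (x + h) - v x\<bar> powr p) * indicator (ball 0 R) h \<partial>lborel)" .
  qed
  also have "\<dots> = 2 * (\<integral>\<^sup>+x. (\<integral>\<^sup>+h. ennreal (\<bar>v (x + h) - v x\<bar> powr p) * indicator (ball 0 R) h \<partial>lborel) \<partial>lborel)"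
    by (rule nn_integral_cmult) measurable
  also have "(\<integral>\<^sup>+x. (\<integral>\<^sup>+h. ennreal (\<bar>v (x + h) - v x\<bar> powr p) * indicator (ball 0 R) h \<partial>lborel) \<partial>lborel)
     = (\<integral>\<^sup>+h. (\<integral>\<^sup>+x. ennreal (\<bar>v (x + h) - v x\<bar> powr p) * indicator (ball 0 R) h \<partial>lborel) \<partial>lborel)"
    by (rule lborel_pair.Fubini'[symmetric]) measurable
  also have "\<dots> \<le> (\<integral>\<^sup>+h. (ennreal (R powr p) * I) * indicator (ball (0::'a) R) h \<partial>lborel)"
  proof (rule nn_integral_mono)
    fix h :: 'a
    show "(\<integral>\<^sup>+x. ennreal (\<bar>v (x + h) - v x\<bar> powr p) * indicator (ball 0 R) h \<partial>lborel) \<le> (ennreal (R powr p) * I) * indicator (ball (0::'a) R) h"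
    proof (cases "h \<in> ball 0 R")
      case True
      have "(\<integral>\<^sup>+x. ennreal (\<bar>v (x + h) - v x\<bar> powr p) \<partial>lborel) \<le> ennreal (norm h powr p) * I"
        unfolding I_def by (rule Lp_translation[OF p w]) simp
      also have "\<dots> \<le> ennreal (R powr p) * I"
        using True p by (intro mult_right_mono ennreal_leI powr_mono2) auto
      finally show ?thesis using True by simp
    qed simp
  qed
  also have "\<dots> = ennreal (R powr p) * I * b" unfolding b_def by (subst nn_integral_cmult_indicator) auto
  finally have "b * J \<le> 2 * (ennreal (R powr p) * I * b)" by (simp add: mult_left_mono)
  also have "\<dots> = b * (ennreal (2 * R powr p) * I)" by (simp add: ennreal_mult mult_ac)
  finally show ?thesis
    using b by (subst (asm) ennreal_mult_le_mult_iff) (auto simp: I_def J_def)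
qed

text \<open>No integrability is assumed: where the Bochner integral takes its default value \<open>0\<close> the bound is trivial.\<close>

lemma ennreal_uminus_integral_le: "ennreal (- (\<integral>x. f x \<partial>M)) \<le> (\<integral>\<^sup>+x. ennreal (- f x) \<partial>M)"
proof (cases "integrable M f")
  case True
  have i: "integrable M (\<lambda>x. max (- f x) 0)" using True by auto
  have "- (\<integral>x. f x \<partial>M) = (\<integral>x. - f x \<partial>M)" by simp
  also have "\<dots> \<le> (\<integral>x. max (- f x) 0 \<partial>M)" using True i by (intro integral_mono) auto
  finally have "ennreal (- (\<integral>x. f x \<partial>M)) \<le> ennreal (\<integral>x. max (- f x) 0 \<partial>M)" by (rule ennreal_leI)
  also have "\<dots> = (\<integral>\<^sup>+x. ennreal (max (- f x) 0) \<partial>M)" using i by (intro nn_integral_eq_integral[symmetric]) auto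
  also have "\<dots> = (\<integral>\<^sup>+x. ennreal (- f x) \<partial>M)" by (intro nn_integral_cong) (auto simp: max_def ennreal_neg)
  finally show ?thesis .
qed (simp add: not_integrable_integral_eq)

text \<open>On the dyadic shell R/2^(i+1) \<le> |z| < R/2^i the integrand is at most (R/2^i)^q
  (R/2^(i+1))^(-N), and the volume of the ball of radius R/2^i turns the sum into 2^N times a
  geometric series of ratio 2^(-q). The denominator stays explicit because it degenerates as q tends
  to 0, which for q = p(1-s) means s tending to 1.\<close>

lemma nn_integral_norm_powr_ball:
  fixes q R :: real
  assumes q: "0 < q" and R: "0 < R"
  shows "(\<integral>\<^sup>+z. ennreal (norm z powr (q - real DIM('a))) * indicator (ball 0 R) z \<partial>(lborel :: 'a::euclidean_space measure))
     \<le> ennreal (measure lborel (ball (0::'a) 1) * 2 ^ DIM('a) * R powr q / (1 - 2 powr (- q)))"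
proof -
  define N where "N = real DIM('a)"
  define c where "c = measure lborel (ball (0::'a) 1)"
  define R' where "R' i = R / 2 ^ i" for i :: nat
  have [measurable]: "ball (0::'a) (R' i) \<in> sets borel" for i by simp
  have R': "0 < R' i" for i using R by (simp add: R'_def)
  define k where "k i = R' i powr q * R' (Suc i) powr (- N)" for i
  have "(\<integral>\<^sup>+z. ennreal (norm z powr (q - N)) * indicator (ball 0 R) z \<partial>(lborel :: 'a measure))
     \<le> (\<integral>\<^sup>+z. (\<Sum>i. ennreal (k i) * indicator (ball 0 (R' i)) z) \<partial>(lborel :: 'a measure))"
  proof (rule nn_integral_mono)
    fix z :: 'a
    show "ennreal (norm z powr (q - N)) * indicator (ball 0 R) z \<le> (\<Sum>i. ennreal (k i) * indicator (ball 0 (R' i)) z)"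
    \<comment> \<open>At z = 0 the integrand is 0, because \<open>0 powr\<close> any exponent is
      0.\<close>
    proof (cases "z = 0 \<or> z \<notin> ball 0 R")
      case True
      then show ?thesis by auto
    next
      case False
      have "\<exists>i. R' i \<le> norm z"
      proof -
        have "(\<lambda>i. R * (1/2) ^ i) \<longlonglongrightarrow> R * 0" by (intro tendsto_intros LIMSEQ_realpow_zero) auto
        then have "eventually (\<lambda>i. R * (1/2) ^ i < norm z) sequentially" using False by (intro order_tendstoD(2)) auto
        then obtain i where "R * (1/2) ^ i < norm z" by (auto simp: eventually_sequentially)
        then show ?thesis by (intro exI[of _ i]) (simp add: R'_def power_one_over field_simps)
      qed
      moreover have "\<not> R' 0 \<le> norm z" using False by (simp add: R'_def)
      ultimately obtain i where i: "\<not> R' i \<le> norm z" "R' (Suc i) \<le> norm z"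
        using nat_induct[of "\<lambda>i. \<not> R' i \<le> norm z"] by blast
      have "norm z powr (q - N) = norm z powr q * norm z powr (- N)"
        using False by (simp flip: powr_add)
      also have "\<dots> \<le> k i"
        unfolding k_def using i q R'[of "Suc i"] by (intro mult_mono powr_mono2 powr_mono2') (auto simp: N_def)
      finally have "ennreal (norm z powr (q - N)) * indicator (ball 0 R) z \<le> ennreal (k i) * indicator (ball 0 (R' i)) z"
        using i(1) by (auto intro: ennreal_leI split: split_indicator)
      also have "\<dots> \<le> (\<Sum>i. ennreal (k i) * indicator (ball 0 (R' i)) z)"
      proof -
        define F where "F i = ennreal (k i) * indicator (ball 0 (R' i)) z" for i
        have "(\<Sum>i\<in>{i}. F i) \<le> suminf F" by (rule sum_le_suminf) auto
        then have "F i \<le> suminf F" by simp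
        then show ?thesis unfolding F_def[abs_def] .
      qed
      finally show ?thesis .
    qed
  qed
  also have "\<dots> = (\<Sum>i. \<integral>\<^sup>+z. ennreal (k i) * indicator (ball 0 (R' i)) z \<partial>(lborel :: 'a measure))"
    by (rule nn_integral_suminf) measurable
  also have "\<dots> = (\<Sum>i. ennreal (c * 2 ^ DIM('a) * R powr q * (2 powr (- q)) ^ i))"
  proof (rule suminf_cong)
    fix i
    have "emeasure lborel (ball (0::'a) (R' i)) = ennreal (measure lborel (ball (0::'a) (R' i)))"
      using emeasure_bounded_finite[of "ball (0::'a) (R' i)"] by (intro emeasure_eq_ennreal_measure) auto
    also have "measure lborel (ball (0::'a) (R' i)) = R' i powr N * c"
      using R'[of i] content_ball_conv_unit_ball[of "R' i" "0::'a"] by (simp add: c_def N_def powr_realpow)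
    finally have em: "emeasure lborel (ball (0::'a) (R' i)) = ennreal (R' i powr N * c)" .
    have pe: "k i * (R' i powr N * c) = c * 2 ^ DIM('a) * R powr q * (2 powr (- q)) ^ i"
    proof -
      have a: "R' (Suc i) powr (- N) * R' i powr N = 2 ^ DIM('a)"
      proof -
        have "R' i = 2 * R' (Suc i)" by (simp add: R'_def)
        then have "R' i powr N = 2 powr N * R' (Suc i) powr N" by (simp add: powr_mult)
        then have "R' (Suc i) powr (- N) * R' i powr N = 2 powr N"
          using R'[of "Suc i"] by (simp add: powr_minus)
        then show ?thesis by (simp add: N_def powr_realpow)
      qed
      have b: "R' i powr q = R powr q * (2 powr (- q)) ^ i"
      proof -
        have "(2 ^ i) powr q = (2::real) powr (real i * q)" by (simp add: powr_powr flip: powr_realpow)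
        moreover have "(2 powr (- q)) ^ i = (2::real) powr (real i * - q)" by (rule powr_power) simp
        moreover have "R' i powr q = R powr q / (2 ^ i) powr q" using R by (simp add: R'_def powr_divide)
        ultimately show ?thesis by (simp add: powr_minus divide_inverse)
      qed
      have "k i * (R' i powr N * c) = R' i powr q * (R' (Suc i) powr (- N) * R' i powr N) * c"
        unfolding k_def by simp
      then show ?thesis unfolding a b by (simp add: mult_ac)
    qed
    have eq: "ennreal (k i) * ennreal (R' i powr N * c) = ennreal (c * 2 ^ DIM('a) * R powr q * (2 powr (- q)) ^ i)"
      unfolding pe[symmetric] by (rule ennreal_mult''[symmetric]) (simp add: c_def)
    show "(\<integral>\<^sup>+z. ennreal (k i) * indicator (ball 0 (R' i)) z \<partial>(lborel :: 'a measure)) = ennreal (c * 2 ^ DIM('a) * R powr q * (2 powr (- q)) ^ i)"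
      by (subst nn_integral_cmult_indicator) (simp_all only: em eq, simp)
  qed
  also have "\<dots> = ennreal (c * 2 ^ DIM('a) * R powr q * (1 / (1 - 2 powr (- q))))"
  proof (rule suminf_ennreal_eq)
    show "0 \<le> c * 2 ^ DIM('a) * R powr q * (2 powr (- q)) ^ i" for i by (simp add: c_def)
    have "2 powr (- q) < 2 powr 0" using q by (intro powr_less_mono) auto
    then show "(\<lambda>i. c * 2 ^ DIM('a) * R powr q * (2 powr (- q)) ^ i) sums (c * 2 ^ DIM('a) * R powr q * (1 / (1 - 2 powr (- q))))"
      by (intro sums_mult geometric_sums) auto
  qed
  finally show ?thesis by (simp add: N_def c_def)
qed

section \<open>Pointwise inequalities\<close>

lemma power_Suc_diff_le:
  fixes A B :: real
  assumes "0 \<le> A" "A \<le> B"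
  shows "B ^ Suc n - A ^ Suc n \<le> real (Suc n) * B ^ n * (B - A)"
proof (induction n)
  case (Suc n)
  have "B ^ Suc (Suc n) - A ^ Suc (Suc n) = B * (B ^ Suc n - A ^ Suc n) + A ^ Suc n * (B - A)"
    by (simp add: algebra_simps)
  also have "\<dots> \<le> B * (real (Suc n) * B ^ n * (B - A)) + B ^ Suc n * (B - A)"
    using assms Suc by (intro add_mono mult_left_mono mult_right_mono power_mono) auto
  also have "\<dots> = real (Suc (Suc n)) * B ^ Suc n * (B - A)" by (simp add: algebra_simps)
  finally show ?case .
qed simp

lemma p_flux_real_nonneg: "0 \<le> t \<Longrightarrow> p_flux p (t::real) = t powr (p - 1)"
  by (cases "t = 0") (auto simp: p_flux_def powr_diff power2_eq_square field_simps)

lemma p_flux_minus: "p_flux p (- x) = - p_flux p x"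
  by (simp add: p_flux_def)

text \<open>The two products are compared without Young's inequality: with \<open>d = w a - w b\<close> and
  \<open>Y = m (w a) (B - A)\<close>, the critical term is \<open>d\<^bsup>p-1\<^esup> B\<^bsup>m-1\<^esup> (d B - Y)\<close>, which is either nonnegative
  or has \<open>d B < Y\<close>.\<close>

lemma p_flux_cutoff_aux:
  fixes a b k A B p :: real and m :: nat
  assumes p: "1 < p" "p \<le> real m" and AB: "0 \<le> A" "A \<le> 1" "0 \<le> B" "B \<le> 1" and "b \<le> a"
  shows "- ((real m * max (a - k) 0 * \<bar>A - B\<bar>) powr p) \<le> p_flux p (a - b) * (A ^ m * max (a - k) 0 - B ^ m * max (b - k) 0)"
proof -
  let ?w = "max (a - k) 0"
  have fl: "p_flux p (a - b) = (a - b) powr (p - 1)" using \<open>b \<le> a\<close> by (intro p_flux_real_nonneg) auto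
  have fl0: "0 \<le> p_flux p (a - b)" unfolding fl by simp
  consider "b \<le> k" | "k < b" "B \<le> A" | "k < b" "A < B" by linarith
  then show ?thesis
  proof cases
    case 1
    have "0 \<le> p_flux p (a - b) * (A ^ m * ?w - B ^ m * max (b - k) 0)"
      using 1 AB fl0 by simp
    then show ?thesis using powr_ge_zero by (smt (verit))
  next
    case 2
    have "B ^ m * max (b - k) 0 \<le> A ^ m * ?w"
      using 2 AB \<open>b \<le> a\<close> by (intro mult_mono power_mono) auto
    then have "0 \<le> p_flux p (a - b) * (A ^ m * ?w - B ^ m * max (b - k) 0)"
      using fl0 by simp
    then show ?thesis using powr_ge_zero by (smt (verit))
  next
    case 3
    define d where "d = a - b"
    define Y where "Y = real m * ?w * (B - A)"
    have d: "0 \<le> d" using \<open>b \<le> a\<close> by (simp add: d_def)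
    have w: "?w = a - k" "max (b - k) 0 = b - k" using 3 \<open>b \<le> a\<close> by auto
    obtain n where m: "m = Suc n" using p by (cases m) auto
    have Y: "0 \<le> Y" using 3 by (simp add: Y_def)
    have "B ^ m - A ^ m \<le> real m * B ^ n * (B - A)"
      unfolding m using AB 3 by (intro power_Suc_diff_le) auto
    then have "?w * (B ^ m - A ^ m) \<le> ?w * (real m * B ^ n * (B - A))" by (intro mult_left_mono) auto
    \<comment> \<open>The right side equals B^m d - w(a) (B^m - A^m), since w(a) - w(b) = d when
      both values exceed k.\<close>
    then have 1: "B ^ n * (d * B - Y) \<le> A ^ m * ?w - B ^ m * max (b - k) 0"
      unfolding w by (simp add: Y_def d_def m algebra_simps w)
    have 2: "- (Y powr p) \<le> d powr (p - 1) * (B ^ n * (d * B - Y))"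
    proof (cases "Y \<le> d * B")
      case True
      then have "0 \<le> d powr (p - 1) * (B ^ n * (d * B - Y))" using AB by simp
      then show ?thesis using powr_ge_zero by (smt (verit))
    next
      case False
      \<comment> \<open>This is where m \<ge> p matters: B \<le> 1 and n \<ge> p - 1 provide one
        power of B for each power of d, so that (d B)^(p-1) can be compared with Y^(p-1).\<close>
      have "B ^ n \<le> B powr (p - 1)"
      proof (cases "B = 0")
        case True
        then show ?thesis using m p by (cases n) auto
      next
        case False
        have "B ^ n = B powr real n" using False AB by (simp add: powr_realpow)
        also have "\<dots> \<le> B powr (p - 1)" using False AB p m by (intro powr_mono') auto
        finally show ?thesis .
      qed
      then have "d powr (p - 1) * B ^ n * Y \<le> d powr (p - 1) * B powr (p - 1) * Y"
        using Y by (intro mult_left_mono mult_right_mono) auto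
      also have "\<dots> = (d * B) powr (p - 1) * Y" using d AB by (simp add: powr_mult)
      also have "\<dots> \<le> Y powr (p - 1) * Y"
        using False Y d AB p by (intro mult_right_mono powr_mono2) auto
      also have "\<dots> = Y powr p" using Y by (cases "Y = 0") (auto simp: powr_diff)
      finally have "d powr (p - 1) * B ^ n * Y \<le> Y powr p" .
      moreover have "0 \<le> d powr (p - 1) * (B ^ n * (d * B))" using d AB by simp
      ultimately show ?thesis by (simp add: algebra_simps)
    qed
    have "(real m * ?w * \<bar>A - B\<bar>) = Y" using 3 by (simp add: Y_def)
    moreover have "p_flux p (a - b) = d powr (p - 1)" using fl by (simp add: d_def)
    ultimately show ?thesis
      using 2 mult_left_mono[OF 1, of "d powr (p - 1)"] by simp
  qed
qed

text \<open>The summand of the larger of a and b suffices; both are kept so that the bound is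
  symmetric and its two halves can be integrated separately.\<close>

lemma p_flux_cutoff_lower:
  fixes a b k A B p :: real and m :: nat
  assumes p: "1 < p" "p \<le> real m" and AB: "0 \<le> A" "A \<le> 1" "0 \<le> B" "B \<le> 1"
  shows "- (p_flux p (a - b) * (A ^ m * max (a - k) 0 - B ^ m * max (b - k) 0))
     \<le> real m powr p * max (a - k) 0 powr p * \<bar>A - B\<bar> powr p + real m powr p * max (b - k) 0 powr p * \<bar>B - A\<bar> powr p"
proof (cases "b \<le> a")
  case True
  from p_flux_cutoff_aux[OF p AB True, of k]
  have "- (p_flux p (a - b) * (A ^ m * max (a - k) 0 - B ^ m * max (b - k) 0)) \<le> real m powr p * max (a - k) 0 powr p * \<bar>A - B\<bar> powr p"
    by (simp add: powr_mult)
  then show ?thesis using AB by (smt (verit) mult_nonneg_nonneg powr_ge_zero)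
next
  case False
  then have "a \<le> b" by simp
  from p_flux_cutoff_aux[OF p AB(3,4,1,2) this, of k]
  have "- (p_flux p (b - a) * (B ^ m * max (b - k) 0 - A ^ m * max (a - k) 0)) \<le> real m powr p * max (b - k) 0 powr p * \<bar>B - A\<bar> powr p"
    by (simp add: powr_mult)
  moreover have "p_flux p (b - a) = - p_flux p (a - b)" using p_flux_minus[of p "a - b"] by simp
  ultimately have "- (p_flux p (a - b) * (A ^ m * max (a - k) 0 - B ^ m * max (b - k) 0)) \<le> real m powr p * max (b - k) 0 powr p * \<bar>B - A\<bar> powr p"
    by (simp add: algebra_simps)
  then show ?thesis using AB by (smt (verit) mult_nonneg_nonneg powr_ge_zero)
qed

text \<open>The flux can only be harmful if k < a < b, and then b - a \<le> b - k. This produces the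
  power p - 1 in the tail.\<close>

lemma p_flux_far_lower:
  fixes a b k c p :: real
  assumes p: "1 < p" and c: "0 \<le> c"
  shows "- (p_flux p (a - b) * (c * max (a - k) 0)) \<le> max (b - k) 0 powr (p - 1) * (c * max (a - k) 0)"
proof (cases "b \<le> a \<or> a \<le> k")
  case True
  have "0 \<le> p_flux p (a - b) * (c * max (a - k) 0)"
    using True c by (auto simp: p_flux_real_nonneg)
  moreover have "0 \<le> max (b - k) 0 powr (p - 1) * (c * max (a - k) 0)" using c by simp
  ultimately show ?thesis by linarith
next
  case False
  have "- p_flux p (a - b) = (b - a) powr (p - 1)"
    using p_flux_minus[of p "a - b"] p_flux_real_nonneg[of "b - a" p] False by simp
  also have "\<dots> \<le> max (b - k) 0 powr (p - 1)" using False p by (intro powr_mono2) auto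
  finally have "- p_flux p (a - b) * (c * max (a - k) 0) \<le> max (b - k) 0 powr (p - 1) * (c * max (a - k) 0)"
    using c by (intro mult_right_mono) auto
  then show ?thesis by simp
qed

lemma powr_add_le:
  fixes x y p :: real
  assumes "0 \<le> x" "0 \<le> y" "0 \<le> p"
  shows "(x + y) powr p \<le> 2 powr p * (x powr p + y powr p)"
proof -
  have "(x + y) powr p \<le> (2 * max x y) powr p" using assms by (intro powr_mono2) auto
  also have "\<dots> = 2 powr p * max x y powr p" using assms by (simp add: powr_mult)
  also have "\<dots> \<le> 2 powr p * (x powr p + y powr p)" by (intro mult_left_mono) (auto simp: max_def)
  finally show ?thesis .
qed

lemma powr_minus_one_mult_le:
  fixes x y p :: real
  assumes "0 \<le> x" "0 \<le> y" "1 < p"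
  shows "x powr (p - 1) * y \<le> x powr p + y powr p"
proof -
  have "x powr (p - 1) * y \<le> max x y powr (p - 1) * max x y" using assms by (intro mult_mono powr_mono2) auto
  also have "\<dots> = max x y powr p" using assms by (cases "max x y = 0") (auto simp: powr_diff)
  also have "\<dots> \<le> x powr p + y powr p" by (auto simp: max_def)
  finally show ?thesis .
qed

lemma norm_p_flux: "1 < p \<Longrightarrow> norm (p_flux p x) = norm x powr (p - 1)"
  by (cases "x = 0") (auto simp: p_flux_def powr_diff power2_eq_square field_simps)

lemma p_flux_inner_self: "1 < p \<Longrightarrow> p_flux p x \<bullet> x = norm x powr p"
  by (cases "x = 0") (auto simp: p_flux_def powr_diff power2_norm_eq_inner[symmetric] power2_eq_square field_simps)

text \<open>With X = |g| and Y = 2 m w |Z| the cross term is at most half of \<phi>^(m-1) X^(p-1) Y.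
  If Y \<le> \<phi> X, this is absorbed by half of \<phi>^m X^p; otherwise \<phi>^(m-1) \<le>
  \<phi>^(p-1) bounds it by half of Y^p. The factor 2 in Y is what leaves one half of the gradient
  term.\<close>

lemma p_flux_local_lower:
  fixes g Z :: "'a::euclidean_space" and \<phi> w p :: real and m :: nat
  assumes p: "1 < p" "p \<le> real m" and \<phi>: "0 \<le> \<phi>" "\<phi> \<le> 1" and w: "0 \<le> w"
  shows "1/2 * (\<phi> ^ m * norm g powr p) - 1/2 * (2 * real m * w * norm Z) powr p
    \<le> p_flux p g \<bullet> (\<phi> ^ m *\<^sub>R g + (w * (real m * \<phi> ^ (m - 1))) *\<^sub>R Z)"
proof -
  obtain n where m: "m = Suc n" using p by (cases m) auto
  define Y where "Y = 2 * real m * w * norm Z"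
  define X where "X = norm g"
  have XY: "0 \<le> X" "0 \<le> Y" using w by (auto simp: X_def Y_def)
  have "\<bar>p_flux p g \<bullet> Z\<bar> \<le> X powr (p - 1) * norm Z"
    using Cauchy_Schwarz_ineq2[of "p_flux p g" Z] norm_p_flux[OF p(1), of g] by (simp add: X_def)
  then have "(w * (real m * \<phi> ^ n)) * \<bar>p_flux p g \<bullet> Z\<bar> \<le> (w * (real m * \<phi> ^ n)) * (X powr (p - 1) * norm Z)"
    using w \<phi> by (intro mult_left_mono) auto
  moreover have "- ((w * (real m * \<phi> ^ n)) * \<bar>p_flux p g \<bullet> Z\<bar>) \<le> (w * (real m * \<phi> ^ n)) * (p_flux p g \<bullet> Z)"
    using mult_left_mono[of "- \<bar>p_flux p g \<bullet> Z\<bar>" "p_flux p g \<bullet> Z" "w * (real m * \<phi> ^ n)"] w \<phi> by auto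
  ultimately have 1: "- ((w * (real m * \<phi> ^ n)) * (X powr (p - 1) * norm Z)) \<le> (w * (real m * \<phi> ^ n)) * (p_flux p g \<bullet> Z)"
    by linarith
  have 2: "(w * (real m * \<phi> ^ n)) * (X powr (p - 1) * norm Z) = 1/2 * (\<phi> ^ n * X powr (p - 1) * Y)" by (simp add: Y_def)
  have 3: "\<phi> ^ n * X powr (p - 1) * Y \<le> \<phi> ^ m * X powr p + Y powr p"
  proof (cases "Y \<le> \<phi> * X")
    case True
    have "\<phi> ^ n * X powr (p - 1) * Y \<le> \<phi> ^ n * X powr (p - 1) * (\<phi> * X)" using True \<phi> by (intro mult_left_mono) auto
    also have "\<dots> = \<phi> ^ m * X powr p" using XY by (cases "X = 0") (auto simp: m powr_diff)
    finally show ?thesis using powr_ge_zero[of Y p] by linarith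
  next
    case False
    have "\<phi> ^ n \<le> \<phi> powr (p - 1)"
    proof (cases "\<phi> = 0")
      case True
      then show ?thesis using m p by (cases n) auto
    next
      case False
      have "\<phi> ^ n = \<phi> powr real n" using False \<phi> by (simp add: powr_realpow)
      also have "\<dots> \<le> \<phi> powr (p - 1)" using False \<phi> p m by (intro powr_mono') auto
      finally show ?thesis .
    qed
    then have "\<phi> ^ n * X powr (p - 1) * Y \<le> \<phi> powr (p - 1) * X powr (p - 1) * Y"
      using XY by (intro mult_right_mono) auto
    also have "\<dots> = (\<phi> * X) powr (p - 1) * Y" using XY \<phi> by (simp add: powr_mult)
    also have "\<dots> \<le> Y powr (p - 1) * Y" using False XY \<phi> p by (intro mult_right_mono powr_mono2) auto
    also have "\<dots> = Y powr p" using XY by (cases "Y = 0") (auto simp: powr_diff)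
    finally have "\<phi> ^ n * X powr (p - 1) * Y \<le> Y powr p" .
    moreover have "0 \<le> \<phi> ^ m * X powr p" using \<phi> by simp
    ultimately show ?thesis by linarith
  qed
  have "p_flux p g \<bullet> (\<phi> ^ m *\<^sub>R g + (w * (real m * \<phi> ^ (m - 1))) *\<^sub>R Z) = \<phi> ^ m * X powr p + (w * (real m * \<phi> ^ n)) * (p_flux p g \<bullet> Z)"
    using p_flux_inner_self[OF p(1), of g] by (simp add: inner_add_right m X_def)
  then show ?thesis using 1 2 3 unfolding Y_def[symmetric] X_def[symmetric] by linarith
qed

text \<open>The gradient term keeps the weight \<phi>^m, since (\<phi>^m)^p \<le> \<phi>^m; this is
  the weight that the local form controls.\<close>

lemma norm_cutoff_gradient_powr:
  fixes g Z :: "'a::euclidean_space" and \<phi> w p :: real and m :: nat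
  assumes p: "1 < p" and \<phi>: "0 \<le> \<phi>" "\<phi> \<le> 1" and w: "0 \<le> w"
  shows "norm (\<phi> ^ m *\<^sub>R g + (w * (real m * \<phi> ^ (m - 1))) *\<^sub>R Z) powr p
    \<le> 2 powr p * (\<phi> ^ m * norm g powr p + (real m * w * norm Z) powr p)"
proof -
  have t1: "norm (\<phi> ^ m *\<^sub>R g) = \<phi> ^ m * norm g" using \<phi> by simp
  have "\<phi> ^ (m - 1) \<le> 1" using \<phi> by (intro power_le_one) auto
  then have t2: "norm ((w * (real m * \<phi> ^ (m - 1))) *\<^sub>R Z) \<le> real m * w * norm Z"
    using \<phi> w mult_left_mono[of "\<phi> ^ (m - 1)" 1 "real m * w * norm Z"] by (simp add: abs_mult mult_ac)
  have "norm (\<phi> ^ m *\<^sub>R g + (w * (real m * \<phi> ^ (m - 1))) *\<^sub>R Z) powr p \<le> (\<phi> ^ m * norm g + real m * w * norm Z) powr p"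
    using p t1 t2 norm_triangle_ineq[of "\<phi> ^ m *\<^sub>R g" "(w * (real m * \<phi> ^ (m - 1))) *\<^sub>R Z"] by (intro powr_mono2) auto
  also have "\<dots> \<le> 2 powr p * ((\<phi> ^ m * norm g) powr p + (real m * w * norm Z) powr p)"
    using \<phi> w p by (intro powr_add_le) auto
  also have "(\<phi> ^ m * norm g) powr p \<le> \<phi> ^ m * norm g powr p"
  proof -
    have "X powr p \<le> X" if "0 \<le> X" "X \<le> 1" for X :: real
      using powr_mono'[of 1 p X] p that by (cases "X = 0") auto
    from this[of "\<phi> ^ m"] have "(\<phi> ^ m) powr p \<le> \<phi> ^ m" using \<phi> by (simp add: power_le_one)
    then show ?thesis using \<phi> by (simp add: powr_mult mult_right_mono)
  qed
  finally show ?thesis by simp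
qed

text \<open>The majorant that makes the local form converge. Only its integrability on a ball
  matters, so the weight is estimated by 1.\<close>

lemma abs_p_flux_inner_le:
  fixes g Z :: "'a::euclidean_space" and \<phi> w p :: real and m :: nat
  assumes p: "1 < p" and \<phi>: "0 \<le> \<phi>" "\<phi> \<le> 1" and w: "0 \<le> w"
  shows "\<bar>p_flux p g \<bullet> (\<phi> ^ m *\<^sub>R g + (w * (real m * \<phi> ^ (m - 1))) *\<^sub>R Z)\<bar>
    \<le> norm g powr p + 2 powr p * (norm g powr p + (real m * w * norm Z) powr p)"
proof -
  let ?V = "\<phi> ^ m *\<^sub>R g + (w * (real m * \<phi> ^ (m - 1))) *\<^sub>R Z"
  have "\<bar>p_flux p g \<bullet> ?V\<bar> \<le> norm g powr (p - 1) * norm ?V"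
    using Cauchy_Schwarz_ineq2[of "p_flux p g" ?V] norm_p_flux[OF p, of g] by simp
  also have "\<dots> \<le> norm g powr p + norm ?V powr p" using p by (intro powr_minus_one_mult_le) auto
  also have "norm ?V powr p \<le> 2 powr p * (\<phi> ^ m * norm g powr p + (real m * w * norm Z) powr p)"
    by (rule norm_cutoff_gradient_powr[OF p \<phi> w])
  also have "\<dots> \<le> 2 powr p * (norm g powr p + (real m * w * norm Z) powr p)"
    using \<phi> by (intro mult_left_mono add_right_mono mult_left_le_one_le power_le_one) auto
  finally show ?thesis by simp
qed

text \<open>The constant is (1 - s) K(s) with K continuous on [0,1]. Convexity of s \<mapsto>
  2^(-p(1-s)) gives 1 - 2^(-p(1-s)) \<ge> (1-s)(1 - 2^(-p)), so the factor 1 - s cancels and the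
  quotient stays bounded up to s = 1.\<close>

lemma frac_const_bound:
  assumes p: "1 < p" and N: "1 \<le> N"
  shows "\<exists>M>0. \<forall>s\<in>{0<..<1}. 0 \<le> frac_const N p s \<and> frac_const N p s / (1 - 2 powr (- (p * (1 - s)))) \<le> M"
    and "continuous_on {0..1} (frac_const N p)"
proof -
  define K where "K s = (s * p / 2 * 2 powr (2 * s - 1)) / (pi powr ((real N - 1) / 2)) *
     (Gamma ((real N + p * s) / 2) / (Gamma ((p + 1) / 2) * Gamma (2 - s)))" for s
  have G: "0 < Gamma ((real N + p * s) / 2)" "0 < Gamma ((p + 1) / 2)" "0 < Gamma (2 - s)" if "s \<in> {0..1}" for s
    using that p N by (auto intro!: Gamma_real_pos add_pos_nonneg)
  have cK: "continuous_on {0..1} K"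
  proof -
    have g1: "continuous_on {0..1} (\<lambda>s. Gamma ((real N + p * s) / 2))"
    proof (rule continuous_on_compose2[where f = "\<lambda>s. (real N + p * s) / 2" and t = "{0<..}"])
      show "continuous_on {0<..} (Gamma :: real \<Rightarrow> real)"
        by (intro continuous_on_Gamma) (auto dest: nonpos_Ints_nonpos)
      show "(\<lambda>s. (real N + p * s) / 2) ` {0..1} \<subseteq> {0<..}" using p N by (auto intro!: add_pos_nonneg)
    qed (intro continuous_intros, simp)
    have g2: "continuous_on {0..1} (\<lambda>s. Gamma (2 - s :: real))"
    proof (rule continuous_on_compose2[where f = "\<lambda>s. 2 - s" and t = "{0<..}"])
      show "continuous_on {0<..} (Gamma :: real \<Rightarrow> real)"
        by (intro continuous_on_Gamma) (auto dest: nonpos_Ints_nonpos)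
    qed (intro continuous_intros, auto)
    show ?thesis unfolding K_def[abs_def]
      by (intro continuous_on_mult continuous_on_divide continuous_on_powr g1 g2 continuous_on_const
          continuous_on_id continuous_on_diff ballI)
        (use G in \<open>auto simp: less_imp_neq[symmetric]\<close>)
  qed
  have fK: "frac_const N p s = (1 - s) * K s" for s by (simp add: frac_const_def K_def field_simps)
  show "continuous_on {0..1} (frac_const N p)"
    unfolding fK[abs_def] by (intro continuous_intros cK)
  have "bounded (K ` {0..1})" using cK by (intro compact_imp_bounded compact_continuous_image) auto
  then obtain B where "\<forall>x\<in>K ` {0..1}. norm x \<le> B" unfolding bounded_iff by blast
  then have B: "\<bar>K s\<bar> \<le> B" if "s \<in> {0..1}" for s using that by simp
  have K0: "0 \<le> K s" if "s \<in> {0..1}" for s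
    unfolding K_def using G[OF that] that p by (intro mult_nonneg_nonneg divide_nonneg_nonneg) auto
  have tp: "2 powr (- p) < (1::real)" using powr_less_mono[of "- p" 0 "2::real"] p by simp
  show "\<exists>M>0. \<forall>s\<in>{0<..<1}. 0 \<le> frac_const N p s \<and> frac_const N p s / (1 - 2 powr (- (p * (1 - s)))) \<le> M"
  proof (intro exI[of _ "max 1 B / (1 - 2 powr (- p))"] conjI ballI)
    show "0 < max 1 B / (1 - 2 powr (- p))" using tp by simp
    fix s :: real assume s: "s \<in> {0<..<1}"
    show "0 \<le> frac_const N p s" using K0[of s] s by (simp add: fK)
    \<comment> \<open>Convexity in the form of the weighted arithmetic-geometric mean inequality for
      2^(-p) and 1.\<close>
    have "(2 powr (- p)) powr (1 - s) * 1 powr s \<le> (1 - s) * 2 powr (- p) + s * (1::real)"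
      using s by (intro Youngs_inequality_0) auto
    then have "(1 - s) * (1 - 2 powr (- p)) \<le> 1 - 2 powr (- (p * (1 - s)))"
      by (simp add: powr_powr algebra_simps)
    moreover have pos: "0 < (1 - s) * (1 - 2 powr (- p))" using s tp by simp
    ultimately have "frac_const N p s / (1 - 2 powr (- (p * (1 - s)))) \<le> (1 - s) * K s / ((1 - s) * (1 - 2 powr (- p)))"
      unfolding fK using K0[of s] s by (intro divide_left_mono) auto
    also have "\<dots> = K s / (1 - 2 powr (- p))" using s by simp
    also have "\<dots> \<le> max 1 B / (1 - 2 powr (- p))" using B[of s] s tp by (intro divide_right_mono) auto
    finally show "frac_const N p s / (1 - 2 powr (- (p * (1 - s)))) \<le> max 1 B / (1 - 2 powr (- p))" .
  qed
qed

text \<open>The bound a n \<le> a 0 * c^n is carried by induction. The ratio c is chosen so that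
  c^\<kappa> b = 1, which cancels the growth b^n, and the smallness of a 0 supplies one further
  factor c in each step.\<close>

lemma superlinear_recursion_tendsto_0:
  fixes a :: "nat \<Rightarrow> real"
  assumes a: "\<And>n. 0 \<le> a n" and Q: "0 < Q" and b: "1 < b" and \<kappa>: "0 < \<kappa>"
    and rec: "\<And>n. a (Suc n) \<le> Q * b ^ n * a n powr (1 + \<kappa>)"
    and a0: "Q * a 0 powr \<kappa> \<le> b powr (- (1 / \<kappa>))"
  shows "a \<longlonglongrightarrow> 0"
proof -
  define c where "c = b powr (- (1 / \<kappa>))"
  have c: "0 < c" "c < 1"
    using b \<kappa> powr_less_mono[of "- (1/\<kappa>)" 0 b] by (auto simp: c_def)
  have ck: "c powr \<kappa> * b = 1" using b \<kappa> by (simp add: c_def powr_powr)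
  have bound: "a n \<le> a 0 * c ^ n" for n
  proof (induction n)
    case (Suc n)
    have "a (Suc n) \<le> Q * b ^ n * a n powr (1 + \<kappa>)" by (rule rec)
    also have "\<dots> \<le> Q * b ^ n * (a 0 * c ^ n) powr (1 + \<kappa>)"
      using Suc a Q b \<kappa> by (intro mult_left_mono powr_mono2) auto
    also have "(a 0 * c ^ n) powr (1 + \<kappa>) = (a 0 * c ^ n) * (a 0 powr \<kappa> * (c powr \<kappa>) ^ n)"
    proof (cases "a 0 = 0")
      case False
      then have "0 < a 0 * c ^ n" using a[of 0] c by simp
      moreover have "(c ^ n) powr \<kappa> = (c powr \<kappa>) ^ n"
        using c by (simp add: powr_powr powr_power mult.commute flip: powr_realpow)
      ultimately show ?thesis using a c by (simp add: powr_add powr_mult)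
    qed (use \<kappa> in simp)
    also have "Q * b ^ n * ((a 0 * c ^ n) * (a 0 powr \<kappa> * (c powr \<kappa>) ^ n)) = (Q * a 0 powr \<kappa>) * (c powr \<kappa> * b) ^ n * (a 0 * c ^ n)"
      by (simp add: power_mult_distrib mult_ac)
    also have "\<dots> \<le> c * (a 0 * c ^ n)"
      unfolding ck using a0 a[of 0] c by (simp add: c_def[symmetric] mult_right_mono)
    finally show ?case by (simp add: mult_ac)
  qed simp
  have "(\<lambda>n. a 0 * c ^ n) \<longlonglongrightarrow> a 0 * 0" using c by (intro tendsto_intros LIMSEQ_realpow_zero) auto
  then have "(\<lambda>n. a 0 * c ^ n) \<longlonglongrightarrow> 0" by simp
  then show ?thesis by (rule Lim_null_comparison[rotated]) (use bound a in auto)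
qed

section \<open>The nonlocal form\<close>

text \<open>Allows u to be replaced by a Borel representative inside the double integral.\<close>

lemma AE_lborel_pair:
  assumes "AE x in (lborel :: 'a::euclidean_space measure). P x"
  shows "AE z in (lborel :: ('a \<times> 'a) measure). P (fst z) \<and> P (snd z)"
proof -
  obtain N where N: "N \<in> null_sets lborel" "{x. \<not> P x} \<subseteq> N"
    using assms by (auto simp: eventually_ae_filter)
  have N': "N \<in> sets borel" "emeasure lborel N = 0" using N(1) by auto
  have "emeasure (lborel \<Otimes>\<^sub>M lborel) (N \<times> (UNIV::'a set)) = 0" "emeasure (lborel \<Otimes>\<^sub>M lborel) ((UNIV::'a set) \<times> N) = 0"
    using N' by (simp_all add: lborel.emeasure_pair_measure_Times)
  moreover have "N \<times> (UNIV::'a set) \<in> sets (lborel \<Otimes>\<^sub>M lborel)" "(UNIV::'a set) \<times> N \<in> sets (lborel \<Otimes>\<^sub>M lborel)"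
    using N' by auto
  ultimately have "N \<times> UNIV \<in> null_sets (lborel :: ('a \<times> 'a) measure)" "UNIV \<times> N \<in> null_sets (lborel :: ('a \<times> 'a) measure)"
    unfolding lborel_prod by auto
  then have "AE z in (lborel :: ('a \<times> 'a) measure). z \<notin> N \<times> UNIV" "AE z in (lborel :: ('a \<times> 'a) measure). z \<notin> UNIV \<times> N"
    by (auto intro: AE_not_in)
  then show ?thesis
  proof eventually_elim
    case (elim z)
    then show ?case using N(2) by (cases z) auto
  qed
qed

text \<open>The Lipschitz bound spends p powers of the distance and leaves the integrable
  singularity of order N - p(1-s). On the diagonal both sides are 0, by the conventions for division
  by 0 and for powers of 0.\<close>

lemma Lipschitz_quotient_le:
  fixes x y :: "'a::euclidean_space"
  assumes Lip: "\<bar>A - B\<bar> \<le> L * norm (x - y)" and p: "0 < p"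
  shows "\<bar>A - B\<bar> powr p / norm (x - y) powr (real DIM('a) + s * p) \<le> L powr p * norm (y - x) powr (p * (1 - s) - real DIM('a))"
proof (cases "x = y")
  case False
  have "\<bar>A - B\<bar> powr p \<le> (L * norm (x - y)) powr p" using Lip p by (intro powr_mono2) auto
  moreover have "0 \<le> L" using Lip False by (smt (verit) mult_neg_pos zero_less_norm_iff right_minus_eq)
  ultimately have "\<bar>A - B\<bar> powr p / norm (x - y) powr (real DIM('a) + s * p) \<le> L powr p * (norm (x - y) powr p / norm (x - y) powr (real DIM('a) + s * p))"
    by (simp add: powr_mult divide_right_mono)
  also have "norm (x - y) powr p / norm (x - y) powr (real DIM('a) + s * p) = norm (y - x) powr (p * (1 - s) - real DIM('a))"
    using False by (simp add: powr_diff[symmetric] norm_minus_commute algebra_simps)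
  finally show ?thesis .
qed simp

text \<open>For fixed x the difference y - x lies in the ball of radius 2c, over which the kernel
  left by the Lipschitz bound is integrated. The restriction c \<le> 1 bounds (2c)^(p(1-s)) by 2^p,
  so s survives only in the denominator 1 - 2^(-p(1-s)).\<close>

lemma near_interaction:
  fixes \<phi> W :: "'a::euclidean_space \<Rightarrow> real"
  assumes p: "1 < p" and s: "0 < s" "s < 1" and c: "0 < c" "c \<le> 1" and W: "\<And>x. 0 \<le> W x"
    and [measurable]: "W \<in> borel_measurable borel" "\<phi> \<in> borel_measurable borel"
    and Lip: "\<And>x y. \<bar>\<phi> x - \<phi> y\<bar> \<le> L * norm (x - y)" and L: "0 \<le> L"
  shows "(\<integral>\<^sup>+x. (\<integral>\<^sup>+y. ennreal (W x * \<bar>\<phi> x - \<phi> y\<bar> powr p / norm (x - y) powr (real DIM('a) + s * p))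
      * indicator (ball x0 c) x * indicator (ball x0 c) y \<partial>lborel) \<partial>lborel)
    \<le> ennreal (L powr p * (measure lborel (ball (0::'a) 1) * 2 ^ DIM('a) * 2 powr p / (1 - 2 powr (- (p * (1 - s))))))
      * (\<integral>\<^sup>+x. ennreal (W x) * indicator (ball x0 c) x \<partial>lborel)"
proof -
  define q where "q = p * (1 - s)"
  have q: "0 < q" "q \<le> p" using p s by (auto simp: q_def mult_le_cancel_left1)
  define V where "V = measure lborel (ball (0::'a) 1) * 2 ^ DIM('a)"
  have V: "0 \<le> V" by (simp add: V_def)
  have tq: "2 powr (- q) < (1::real)" using powr_less_mono[of "- q" 0 "2::real"] q by simp
  have [measurable]: "ball (0::'a) (2 * c) \<in> sets borel" "ball x0 c \<in> sets borel" by simp_all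
  have inner: "(\<integral>\<^sup>+y. ennreal (W x * \<bar>\<phi> x - \<phi> y\<bar> powr p / norm (x - y) powr (real DIM('a) + s * p))
      * indicator (ball x0 c) x * indicator (ball x0 c) y \<partial>lborel)
      \<le> ennreal (L powr p * (V * 2 powr p / (1 - 2 powr (- q)))) * (ennreal (W x) * indicator (ball x0 c) x)" for x
  proof -
    have "(\<integral>\<^sup>+y. ennreal (W x * \<bar>\<phi> x - \<phi> y\<bar> powr p / norm (x - y) powr (real DIM('a) + s * p))
      * indicator (ball x0 c) x * indicator (ball x0 c) y \<partial>lborel)
      \<le> (\<integral>\<^sup>+y. (ennreal (W x * L powr p) * indicator (ball x0 c) x) * (ennreal (norm (y + - x) powr (q - real DIM('a))) * indicator (ball 0 (2 * c)) (y + - x)) \<partial>lborel)"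
    proof (rule nn_integral_mono)
      fix y
      show "ennreal (W x * \<bar>\<phi> x - \<phi> y\<bar> powr p / norm (x - y) powr (real DIM('a) + s * p)) * indicator (ball x0 c) x * indicator (ball x0 c) y
        \<le> (ennreal (W x * L powr p) * indicator (ball x0 c) x) * (ennreal (norm (y + - x) powr (q - real DIM('a))) * indicator (ball 0 (2 * c)) (y + - x))"
      proof (cases "x \<in> ball x0 c \<and> y \<in> ball x0 c")
        case True
        have "y + - x \<in> ball 0 (2 * c)"
          using True dist_triangle[of x y x0] by (simp add: dist_norm norm_minus_commute dist_commute)
        moreover have "W x * (\<bar>\<phi> x - \<phi> y\<bar> powr p / norm (x - y) powr (real DIM('a) + s * p)) \<le> W x * (L powr p * norm (y - x) powr (q - real DIM('a)))"
          unfolding q_def using Lipschitz_quotient_le[OF Lip, of p x y s] p W by (intro mult_left_mono) auto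
        ultimately show ?thesis
          using True W L by (simp add: ennreal_mult[symmetric] ennreal_leI mult.assoc)
      qed (auto split: split_indicator)
    qed
    also have "\<dots> = (ennreal (W x * L powr p) * indicator (ball x0 c) x) * (\<integral>\<^sup>+y. (ennreal (norm (y + - x) powr (q - real DIM('a))) * indicator (ball 0 (2 * c)) (y + - x)) \<partial>lborel)"
      by (rule nn_integral_cmult) measurable
    also have "\<dots> \<le> (ennreal (W x * L powr p) * indicator (ball x0 c) x) * ennreal (V * 2 powr p / (1 - 2 powr (- q)))"
    proof (rule mult_left_mono)
      have "(\<integral>\<^sup>+y. (ennreal (norm (y + - x) powr (q - real DIM('a))) * indicator (ball 0 (2 * c)) (y + - x)) \<partial>lborel)
        = (\<integral>\<^sup>+y. (ennreal (norm y powr (q - real DIM('a))) * indicator (ball (0::'a) (2 * c)) y) \<partial>lborel)"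
        by (rule nn_integral_shift[of "\<lambda>y. ennreal (norm y powr (q - real DIM('a))) * indicator (ball (0::'a) (2 * c)) y"]) measurable
      also have "\<dots> \<le> ennreal (V * (2 * c) powr q / (1 - 2 powr (- q)))"
        unfolding V_def using nn_integral_norm_powr_ball[OF q(1), of "2 * c", where 'a = 'a] c by (simp add: mult_ac)
      also have "\<dots> \<le> ennreal (V * 2 powr p / (1 - 2 powr (- q)))"
      proof -
        have "(2 * c) powr q \<le> 2 powr q" using c q by (intro powr_mono2) auto
        also have "\<dots> \<le> 2 powr p" using q by (intro powr_mono) auto
        finally show ?thesis using V tq by (intro ennreal_leI divide_right_mono mult_left_mono) auto
      qed
      finally show "(\<integral>\<^sup>+y. (ennreal (norm (y + - x) powr (q - real DIM('a))) * indicator (ball 0 (2 * c)) (y + - x)) \<partial>lborel)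
        \<le> ennreal (V * 2 powr p / (1 - 2 powr (- q)))" .
    qed simp
    also have "\<dots> = ennreal (L powr p * (V * 2 powr p / (1 - 2 powr (- q)))) * (ennreal (W x) * indicator (ball x0 c) x)"
    proof -
      have Z: "0 \<le> V * 2 powr p / (1 - 2 powr (- q))" using V tq by simp
      have "ennreal (L powr p * (V * 2 powr p / (1 - 2 powr (- q)))) = ennreal (L powr p) * ennreal (V * 2 powr p / (1 - 2 powr (- q)))"
        by (rule ennreal_mult[OF powr_ge_zero Z])
      moreover have "ennreal (W x * L powr p) = ennreal (W x) * ennreal (L powr p)" by (rule ennreal_mult[OF W powr_ge_zero])
      ultimately show ?thesis by (simp only: mult_ac)
    qed
    finally show ?thesis .
  qed
  have "(\<integral>\<^sup>+x. (\<integral>\<^sup>+y. ennreal (W x * \<bar>\<phi> x - \<phi> y\<bar> powr p / norm (x - y) powr (real DIM('a) + s * p))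
      * indicator (ball x0 c) x * indicator (ball x0 c) y \<partial>lborel) \<partial>lborel)
     \<le> (\<integral>\<^sup>+x. ennreal (L powr p * (V * 2 powr p / (1 - 2 powr (- q)))) * (ennreal (W x) * indicator (ball x0 c) x) \<partial>lborel)"
    by (intro nn_integral_mono inner)
  also have "\<dots> = ennreal (L powr p * (V * 2 powr p / (1 - 2 powr (- q)))) * (\<integral>\<^sup>+x. ennreal (W x) * indicator (ball x0 c) x \<partial>lborel)"
    by (rule nn_integral_cmult) measurable
  finally show ?thesis by (simp add: V_def q_def)
qed

text \<open>If x is in the ball of radius b and y outside that of radius c, then |y - x0| \<le>
  c/(c-b) |x - y|. So the kernel centred at x may be recentred at x0 and the double integral
  factorizes; s < 1 replaces the exponent N + sp of the constant by N + p. Since \<rho> \<le> c, the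
  domain of the y-integral is only enlarged.\<close>

lemma far_interaction:
  fixes v w W :: "'a::euclidean_space \<Rightarrow> real"
  assumes p: "1 < p" and s: "0 < s" "s < 1" and bc: "0 \<le> b" "b < c" and \<rho>: "\<rho> \<le> c"
    and v: "\<And>x. 0 \<le> v x" "\<And>x. x \<notin> ball x0 b \<Longrightarrow> v x = 0" and w: "\<And>x. 0 \<le> w x" "\<And>x. w x \<le> W x"
    and [measurable]: "v \<in> borel_measurable borel" "W \<in> borel_measurable borel"
  shows "(\<integral>\<^sup>+x. (\<integral>\<^sup>+y. ennreal (w y powr (p - 1) * v x / norm (x - y) powr (real DIM('a) + s * p)) * indicator (- ball x0 c) y \<partial>lborel) \<partial>lborel)
    \<le> ennreal ((c / (c - b)) powr (real DIM('a) + p)) * ((\<integral>\<^sup>+x. ennreal (v x) \<partial>lborel)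
      * (\<integral>\<^sup>+y. ennreal (W y powr (p - 1) / norm (y - x0) powr (real DIM('a) + s * p)) * indicator (- ball x0 \<rho>) y \<partial>lborel))"
proof -
  define \<theta> where "\<theta> = c / (c - b)"
  have \<theta>: "1 \<le> \<theta>" using bc by (simp add: \<theta>_def)
  define e where "e = real DIM('a) + s * p"
  have e: "0 < e" "e \<le> real DIM('a) + p" using p s by (auto simp: e_def mult_le_cancel_right1 intro!: add_pos_pos)
  define T where "T = (\<integral>\<^sup>+y. ennreal (W y powr (p - 1) / norm (y - x0) powr e) * indicator (- ball x0 \<rho>) y \<partial>lborel)"
  have [measurable]: "ball x0 c \<in> sets borel" "ball x0 \<rho> \<in> sets borel" by simp_all
  have pt: "ennreal (w y powr (p - 1) * v x / norm (x - y) powr e) * indicator (- ball x0 c) y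
     \<le> (ennreal (\<theta> powr (real DIM('a) + p)) * ennreal (v x)) * (ennreal (W y powr (p - 1) / norm (y - x0) powr e) * indicator (- ball x0 \<rho>) y)" for x y
  proof (cases "x \<in> ball x0 b \<and> y \<notin> ball x0 c")
    case True
    have y0: "c \<le> norm (y - x0)" using True by (simp add: dist_norm norm_minus_commute)
    have "norm (y - x0) \<le> norm (x - y) + b"
      using True norm_triangle_ineq[of "y - x" "x - x0"] by (simp add: dist_norm norm_minus_commute)
    \<comment> \<open>Multiply |y - x0| \<le> |x - y| + b by c and use c \<le> |y - x0| in the last
      term.\<close>
    then have "(c - b) * norm (y - x0) \<le> c * norm (x - y)"
      using bc y0 mult_left_mono[of "norm (y - x0)" "norm (x - y) + b" c] mult_left_mono[of c "norm (y - x0)" b]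
      by (simp add: algebra_simps)
    then have 1: "norm (y - x0) \<le> \<theta> * norm (x - y)"
      using bc by (simp add: \<theta>_def field_simps)
    have yp: "0 < norm (y - x0)" using y0 bc by linarith
    have xy: "0 < norm (x - y)" using 1 \<theta> yp by (smt (verit) mult_nonneg_nonpos zero_less_mult_pos)
    have "norm (y - x0) powr e \<le> (\<theta> * norm (x - y)) powr e" using 1 e by (intro powr_mono2) auto
    also have "\<dots> = \<theta> powr e * norm (x - y) powr e" using \<theta> by (simp add: powr_mult)
    also have "\<dots> \<le> \<theta> powr (real DIM('a) + p) * norm (x - y) powr e"
      using e \<theta> by (intro mult_right_mono powr_mono) auto
    finally have 2: "1 / norm (x - y) powr e \<le> \<theta> powr (real DIM('a) + p) / norm (y - x0) powr e"
      using xy yp by (simp add: field_simps)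
    have 3: "w y powr (p - 1) \<le> W y powr (p - 1)" using w p by (intro powr_mono2) auto
    have "w y powr (p - 1) * v x / norm (x - y) powr e = w y powr (p - 1) * v x * (1 / norm (x - y) powr e)" by simp
    also have "\<dots> \<le> W y powr (p - 1) * v x * (\<theta> powr (real DIM('a) + p) / norm (y - x0) powr e)"
      using 2 3 v by (intro mult_mono) auto
    finally have "ennreal (w y powr (p - 1) * v x / norm (x - y) powr e) \<le> ennreal ((\<theta> powr (real DIM('a) + p) * v x) * (W y powr (p - 1) / norm (y - x0) powr e))"
      by (intro ennreal_leI) (simp add: mult_ac)
    also have "\<dots> = ennreal (\<theta> powr (real DIM('a) + p)) * ennreal (v x) * ennreal (W y powr (p - 1) / norm (y - x0) powr e)"
      using v(1)[of x] by (subst ennreal_mult, simp, simp, subst ennreal_mult) auto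
    finally show ?thesis using True \<rho> by simp
  next
    case False
    then show ?thesis using v(2)[of x] by (auto split: split_indicator)
  qed
  have "(\<integral>\<^sup>+x. (\<integral>\<^sup>+y. ennreal (w y powr (p - 1) * v x / norm (x - y) powr e) * indicator (- ball x0 c) y \<partial>lborel) \<partial>lborel)
    \<le> (\<integral>\<^sup>+x. (ennreal (\<theta> powr (real DIM('a) + p)) * T) * ennreal (v x) \<partial>lborel)"
  proof (rule nn_integral_mono)
    fix x
    have "(\<integral>\<^sup>+y. ennreal (w y powr (p - 1) * v x / norm (x - y) powr e) * indicator (- ball x0 c) y \<partial>lborel)
      \<le> (\<integral>\<^sup>+y. (ennreal (\<theta> powr (real DIM('a) + p)) * ennreal (v x)) * (ennreal (W y powr (p - 1) / norm (y - x0) powr e) * indicator (- ball x0 \<rho>) y) \<partial>lborel)"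
      by (intro nn_integral_mono pt)
    also have "\<dots> = (ennreal (\<theta> powr (real DIM('a) + p)) * ennreal (v x)) * T"
      unfolding T_def by (rule nn_integral_cmult) measurable
    finally show "(\<integral>\<^sup>+y. ennreal (w y powr (p - 1) * v x / norm (x - y) powr e) * indicator (- ball x0 c) y \<partial>lborel)
      \<le> (ennreal (\<theta> powr (real DIM('a) + p)) * T) * ennreal (v x)" by (simp add: mult_ac)
  qed
  also have "\<dots> = (ennreal (\<theta> powr (real DIM('a) + p)) * T) * (\<integral>\<^sup>+x. ennreal (v x) \<partial>lborel)"
    by (rule nn_integral_cmult) measurable
  finally show ?thesis unfolding T_def e_def \<theta>_def by (simp add: mult_ac)
qed

text \<open>Pairs are split by membership in the ball of radius c. If both points are inside, the
  cutoff inequality applies; if just one is, the test function vanishes at the other and the flux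
  inequality for distant points applies; if neither is, nothing remains. Only the negative part of
  the integrand is estimated, as a nonnegative integral that may be infinite.\<close>

lemma nonlocal_slice:
  fixes u \<phi> :: "'a::euclidean_space \<Rightarrow> real"
  assumes p: "1 < p" "p \<le> real m" and s: "0 < s" "s < 1" and bc: "0 \<le> b" "b < c" "c \<le> 1" and \<rho>: "\<rho> \<le> c" and k: "0 \<le> k"
    and \<phi>: "\<And>x. 0 \<le> \<phi> x" "\<And>x. \<phi> x \<le> 1" "\<And>x. x \<notin> ball x0 b \<Longrightarrow> \<phi> x = 0"
    and Lip: "\<And>x y. \<bar>\<phi> x - \<phi> y\<bar> \<le> L * norm (x - y)" and L: "0 \<le> L"
    and [measurable]: "u \<in> borel_measurable borel" "\<phi> \<in> borel_measurable borel"
  shows "(\<integral>\<^sup>+(x, y). ennreal (- (p_flux p (u x - u y) * (\<phi> x ^ m * max (u x - k) 0 - \<phi> y ^ m * max (u y - k) 0)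
        / norm (x - y) powr (real DIM('a) + s * p))) \<partial>lborel)
     \<le> ennreal (2 * real m powr p * L powr p * (measure lborel (ball (0::'a) 1) * 2 ^ DIM('a) * 2 powr p / (1 - 2 powr (- (p * (1 - s))))))
          * (\<integral>\<^sup>+x. ennreal (max (u x - k) 0 powr p) * indicator (ball x0 c) x \<partial>lborel)
       + ennreal (2 * (c / (c - b)) powr (real DIM('a) + p)) * ((\<integral>\<^sup>+x. ennreal (\<phi> x ^ m * max (u x - k) 0) \<partial>lborel)
      * (\<integral>\<^sup>+y. ennreal (max (u y) 0 powr (p - 1) / norm (y - x0) powr (real DIM('a) + s * p)) * indicator (- ball x0 \<rho>) y \<partial>lborel))"
    (is "?LHS \<le> ennreal ?K * ?W + ?Th * (?v * ?T)")
proof -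
  define e where "e = real DIM('a) + s * p"
  define w where "w x = max (u x - k) 0" for x
  define v where "v x = \<phi> x ^ m * w x" for x
  have m: "0 < m" using p by (cases m) auto
  have [measurable]: "w \<in> borel_measurable borel" unfolding w_def[abs_def] by measurable
  have [measurable]: "v \<in> borel_measurable borel" unfolding v_def[abs_def] by measurable
  have [measurable]: "ball x0 c \<in> sets borel" by simp
  have w0: "0 \<le> w x" for x by (simp add: w_def)
  have v0: "0 \<le> v x" for x using \<phi> w0 by (simp add: v_def)
  have vz: "v x = 0" if "x \<notin> ball x0 b" for x using \<phi>(3)[OF that] m by (simp add: v_def)
  let ?B = "ball x0 c"
  define F1 where "F1 x y = ennreal (real m powr p * w x powr p * \<bar>\<phi> x - \<phi> y\<bar> powr p / norm (x - y) powr e) * indicator ?B x * indicator ?B y" for x y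
  define F2 where "F2 x y = ennreal (w y powr (p - 1) * v x / norm (x - y) powr e) * indicator (- ?B) y" for x y
  have m1[measurable]: "(\<lambda>(x, y). F1 x y) \<in> borel_measurable (lborel \<Otimes>\<^sub>M lborel)" unfolding F1_def by measurable
  have m2[measurable]: "(\<lambda>(x, y). F2 x y) \<in> borel_measurable (lborel \<Otimes>\<^sub>M lborel)" unfolding F2_def by measurable
  have m3[measurable]: "(\<lambda>(x, y). F1 y x) \<in> borel_measurable (lborel \<Otimes>\<^sub>M lborel)" unfolding F1_def by measurable
  have m4[measurable]: "(\<lambda>(x, y). F2 y x) \<in> borel_measurable (lborel \<Otimes>\<^sub>M lborel)" unfolding F2_def by measurable
  have pt: "ennreal (- (p_flux p (u x - u y) * (v x - v y) / norm (x - y) powr e)) \<le> F1 x y + F1 y x + (F2 x y + F2 y x)" for x y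
  proof -
    consider "x \<in> ?B" "y \<in> ?B" | "x \<in> ?B" "y \<notin> ?B" | "x \<notin> ?B" "y \<in> ?B" | "x \<notin> ?B" "y \<notin> ?B" by blast
    then show ?thesis
    proof cases
      case 1
      have "- (p_flux p (u x - u y) * (v x - v y)) \<le> real m powr p * w x powr p * \<bar>\<phi> x - \<phi> y\<bar> powr p + real m powr p * w y powr p * \<bar>\<phi> y - \<phi> x\<bar> powr p"
        unfolding v_def w_def using \<phi> by (intro p_flux_cutoff_lower p) auto
      then have "- (p_flux p (u x - u y) * (v x - v y)) / norm (x - y) powr e \<le>
        (real m powr p * w x powr p * \<bar>\<phi> x - \<phi> y\<bar> powr p + real m powr p * w y powr p * \<bar>\<phi> y - \<phi> x\<bar> powr p) / norm (x - y) powr e"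
        by (intro divide_right_mono) auto
      then have "ennreal (- (p_flux p (u x - u y) * (v x - v y) / norm (x - y) powr e)) \<le>
        ennreal (real m powr p * w x powr p * \<bar>\<phi> x - \<phi> y\<bar> powr p / norm (x - y) powr e + real m powr p * w y powr p * \<bar>\<phi> y - \<phi> x\<bar> powr p / norm (y - x) powr e)"
        by (intro ennreal_leI) (simp add: add_divide_distrib norm_minus_commute)
      also have "\<dots> = F1 x y + F1 y x" using 1 by (simp add: F1_def ennreal_plus)
      also have "\<dots> \<le> F1 x y + F1 y x + (F2 x y + F2 y x)" by simp
      finally show ?thesis .
    next
      case 2
      then have "y \<notin> ball x0 b" using bc by auto
      then have vy: "v y = 0" by (rule vz)
      have "- (p_flux p (u x - u y) * v x) \<le> w y powr (p - 1) * v x"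
        unfolding v_def w_def using \<phi> by (intro p_flux_far_lower p) auto
      then have "- (p_flux p (u x - u y) * v x) / norm (x - y) powr e \<le> w y powr (p - 1) * v x / norm (x - y) powr e"
        by (intro divide_right_mono) auto
      then have "ennreal (- (p_flux p (u x - u y) * (v x - v y) / norm (x - y) powr e)) \<le> F2 x y"
        using 2 by (simp add: F2_def vy ennreal_leI)
      also have "\<dots> \<le> F1 x y + F1 y x + (F2 x y + F2 y x)" by (simp add: add_increasing)
      finally show ?thesis .
    next
      case 3
      then have "x \<notin> ball x0 b" using bc by auto
      then have vx: "v x = 0" by (rule vz)
      have "- (p_flux p (u y - u x) * v y) \<le> w x powr (p - 1) * v y"
        unfolding v_def w_def using \<phi> by (intro p_flux_far_lower p) auto
      then have "- (p_flux p (u y - u x) * v y) / norm (y - x) powr e \<le> w x powr (p - 1) * v y / norm (y - x) powr e"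
        by (intro divide_right_mono) auto
      moreover have "p_flux p (u x - u y) = - p_flux p (u y - u x)" using p_flux_minus[of p "u y - u x"] by simp
      ultimately have "ennreal (- (p_flux p (u x - u y) * (v x - v y) / norm (x - y) powr e)) \<le> F2 y x"
        using 3 by (simp add: F2_def vx norm_minus_commute ennreal_leI)
      also have "\<dots> \<le> F1 x y + F1 y x + (F2 x y + F2 y x)" by (simp add: add_increasing)
      finally show ?thesis .
    next
      case 4
      then have "x \<notin> ball x0 b" "y \<notin> ball x0 b" using bc by auto
      then show ?thesis using vz by simp
    qed
  qed
  have "?LHS = (\<integral>\<^sup>+(x, y). ennreal (- (p_flux p (u x - u y) * (v x - v y) / norm (x - y) powr e)) \<partial>(lborel \<Otimes>\<^sub>M lborel))"
    by (simp add: lborel_prod v_def w_def e_def)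
  also have "\<dots> \<le> (\<integral>\<^sup>+(x, y). F1 x y + F1 y x + (F2 x y + F2 y x) \<partial>(lborel \<Otimes>\<^sub>M lborel))"
    using pt by (intro nn_integral_mono) auto
  also have "\<dots> = (\<integral>\<^sup>+z. (case z of (x, y) \<Rightarrow> F1 x y) + (case z of (x, y) \<Rightarrow> F1 y x) + ((case z of (x, y) \<Rightarrow> F2 x y) + (case z of (x, y) \<Rightarrow> F2 y x)) \<partial>(lborel \<Otimes>\<^sub>M lborel))"
    by (intro nn_integral_cong) auto
  also have "\<dots> = ((\<integral>\<^sup>+(x, y). F1 x y \<partial>(lborel \<Otimes>\<^sub>M lborel)) + (\<integral>\<^sup>+(x, y). F1 y x \<partial>(lborel \<Otimes>\<^sub>M lborel)))
      + ((\<integral>\<^sup>+(x, y). F2 x y \<partial>(lborel \<Otimes>\<^sub>M lborel)) + (\<integral>\<^sup>+(x, y). F2 y x \<partial>(lborel \<Otimes>\<^sub>M lborel)))"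
    using m1 m2 m3 m4 by (simp add: nn_integral_add)
  \<comment> \<open>Tonelli exchanges the variables, so each swapped term has the integral of its
    partner; hence the factors 2.\<close>
  also have "(\<integral>\<^sup>+(x, y). F1 y x \<partial>(lborel \<Otimes>\<^sub>M lborel)) = (\<integral>\<^sup>+x. \<integral>\<^sup>+y. F1 x y \<partial>lborel \<partial>lborel)"
    using lborel.nn_integral_fst[OF m3] lborel_pair.Fubini'[OF m1] by simp
  also have "(\<integral>\<^sup>+(x, y). F1 x y \<partial>(lborel \<Otimes>\<^sub>M lborel)) = (\<integral>\<^sup>+x. \<integral>\<^sup>+y. F1 x y \<partial>lborel \<partial>lborel)"
    using lborel.nn_integral_fst[OF m1] by simp
  also have "(\<integral>\<^sup>+(x, y). F2 y x \<partial>(lborel \<Otimes>\<^sub>M lborel)) = (\<integral>\<^sup>+x. \<integral>\<^sup>+y. F2 x y \<partial>lborel \<partial>lborel)"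
    using lborel.nn_integral_fst[OF m4] lborel_pair.Fubini'[OF m2] by simp
  also have "(\<integral>\<^sup>+(x, y). F2 x y \<partial>(lborel \<Otimes>\<^sub>M lborel)) = (\<integral>\<^sup>+x. \<integral>\<^sup>+y. F2 x y \<partial>lborel \<partial>lborel)"
    using lborel.nn_integral_fst[OF m2] by simp
  finally have LHS: "?LHS \<le> 2 * (\<integral>\<^sup>+x. \<integral>\<^sup>+y. F1 x y \<partial>lborel \<partial>lborel) + 2 * (\<integral>\<^sup>+x. \<integral>\<^sup>+y. F2 x y \<partial>lborel \<partial>lborel)"
    by (simp add: mult_2)
  define \<kappa> where "\<kappa> = L powr p * (measure lborel (ball (0::'a) 1) * 2 ^ DIM('a) * 2 powr p / (1 - 2 powr (- (p * (1 - s)))))"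
  have "2 powr (- (p * (1 - s))) < (1::real)" using powr_less_mono[of "- (p * (1 - s))" 0 "2::real"] p s by simp
  then have \<kappa>: "0 \<le> \<kappa>" by (simp add: \<kappa>_def)
  have "(\<integral>\<^sup>+x. \<integral>\<^sup>+y. F1 x y \<partial>lborel \<partial>lborel) \<le> ennreal \<kappa> * (\<integral>\<^sup>+x. ennreal (real m powr p * w x powr p) * indicator ?B x \<partial>lborel)"
    unfolding F1_def e_def \<kappa>_def using bc by (intro near_interaction p s Lip L) auto
  also have "(\<integral>\<^sup>+x. ennreal (real m powr p * w x powr p) * indicator ?B x \<partial>lborel) = ennreal (real m powr p) * ?W"
    by (subst nn_integral_cmult[symmetric]) (auto simp: ennreal_mult w_def mult_ac)
  finally have A1: "2 * (\<integral>\<^sup>+x. \<integral>\<^sup>+y. F1 x y \<partial>lborel \<partial>lborel) \<le> ennreal ?K * ?W"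
  proof -
    assume a: "(\<integral>\<^sup>+x. \<integral>\<^sup>+y. F1 x y \<partial>lborel \<partial>lborel) \<le> ennreal \<kappa> * (ennreal (real m powr p) * ?W)"
    have "2 * (\<integral>\<^sup>+x. \<integral>\<^sup>+y. F1 x y \<partial>lborel \<partial>lborel) \<le> 2 * (ennreal \<kappa> * (ennreal (real m powr p) * ?W))"
      by (intro mult_left_mono a) simp
    also have "\<dots> = ennreal (2 * real m powr p * \<kappa>) * ?W" using \<kappa> by (simp add: ennreal_mult mult_ac)
    finally show ?thesis by (simp add: \<kappa>_def mult_ac)
  qed
  have "(\<integral>\<^sup>+x. \<integral>\<^sup>+y. F2 x y \<partial>lborel \<partial>lborel) \<le> ennreal ((c / (c - b)) powr (real DIM('a) + p)) * ((\<integral>\<^sup>+x. ennreal (v x) \<partial>lborel)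
      * (\<integral>\<^sup>+y. ennreal (max (u y) 0 powr (p - 1) / norm (y - x0) powr (real DIM('a) + s * p)) * indicator (- ball x0 \<rho>) y \<partial>lborel))"
    unfolding F2_def e_def by (rule far_interaction[OF p(1) s bc(1,2) \<rho> v0 vz w0]) (use k in \<open>auto simp: w_def\<close>)
  then have "2 * (\<integral>\<^sup>+x. \<integral>\<^sup>+y. F2 x y \<partial>lborel \<partial>lborel) \<le> 2 * (ennreal ((c / (c - b)) powr (real DIM('a) + p)) * (?v * ?T))"
    unfolding v_def w_def by (intro mult_left_mono) auto
  also have "\<dots> = ?Th * (?v * ?T)" by (simp add: ennreal_mult mult_ac)
  finally show ?thesis using LHS A1 by (meson add_mono order_trans)
qed

section \<open>Integration over the order s\<close>

lemma measurable_unit_interval_borel: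
  fixes \<mu> :: "real measure"
  assumes sets: "sets \<mu> = sets (restrict_space borel {0..1})"
  shows "(\<lambda>s. s) \<in> borel_measurable \<mu>" "{0<..<1} \<in> sets \<mu>" "space \<mu> = {0..1}"
    "continuous_on {0..1} f \<Longrightarrow> (f :: real \<Rightarrow> real) \<in> borel_measurable \<mu>"
proof -
  have eq: "borel_measurable \<mu> = (borel_measurable (restrict_space borel {0..1}) :: (real \<Rightarrow> real) set)"
    by (rule measurable_cong_sets[OF sets refl])
  show "(\<lambda>s. s) \<in> borel_measurable \<mu>" unfolding eq by (rule measurable_restrict_space1) simp
  show "{0<..<1} \<in> sets \<mu>" unfolding sets by (subst sets_restrict_space_iff) auto
  show "space \<mu> = {0..1}" using sets_eq_imp_space_eq[OF sets] by (simp add: space_restrict_space)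
  show "continuous_on {0..1} f \<Longrightarrow> (f :: real \<Rightarrow> real) \<in> borel_measurable \<mu>"
    unfolding eq by (rule borel_measurable_continuous_on_restrict)
qed

text \<open>The inner integral of \<open>Tail\<close> for the positive part; the absolute value is
  kept so that it unfolds literally to the body of \<open>Tail\<close>.\<close>

definition tail_kernel :: "real \<Rightarrow> ('a::euclidean_space \<Rightarrow> real) \<Rightarrow> 'a \<Rightarrow> real \<Rightarrow> real \<Rightarrow> ennreal" where
  "tail_kernel p u x0 \<rho> s =
     (\<integral>\<^sup>+y\<in>- ball x0 \<rho>. ennreal (\<bar>max (u y) 0\<bar> powr (p - 1) / norm (y - x0) powr (real DIM('a) + s * p)) \<partial>lebesgue)"

text \<open>The power p - 1 of \<open>Tail\<close> divided by the power p of the radius: the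
  quantity that the energy estimate produces directly.\<close>

definition tail_integral :: "real measure \<Rightarrow> real \<Rightarrow> ('a::euclidean_space \<Rightarrow> real) \<Rightarrow> 'a \<Rightarrow> real \<Rightarrow> ennreal" where
  "tail_integral \<mu> p u x0 \<rho> = (\<integral>\<^sup>+s\<in>{0<..<1}. ennreal (frac_const DIM('a) p s) * tail_kernel p u x0 \<rho> s \<partial>\<mu>)"

text \<open>For the Borel representative the integrand is jointly measurable in (s, y), and it
  defines the same function of s.\<close>

lemma tail_kernel_measurable:
  fixes u u' :: "'a::euclidean_space \<Rightarrow> real" and \<mu> :: "real measure"
  assumes sets: "sets \<mu> = sets (restrict_space borel {0..1})"
    and [measurable]: "u' \<in> borel_measurable borel" and ae: "AE x in lborel. u x = u' x"
  shows "tail_kernel p u x0 \<rho> \<in> borel_measurable \<mu>"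
proof -
  note [measurable] = measurable_unit_interval_borel(1)[OF sets]
  have [measurable]: "ball x0 \<rho> \<in> sets borel" by simp
  have "tail_kernel p u x0 \<rho> s = (\<integral>\<^sup>+y. ennreal (\<bar>max (u' y) 0\<bar> powr (p - 1) / norm (y - x0) powr (real DIM('a) + s * p))
      * indicator (- ball x0 \<rho>) y \<partial>lborel)" for s
    unfolding tail_kernel_def nn_integral_completion by (rule nn_integral_cong_AE) (use ae in eventually_elim, simp)
  then have "tail_kernel p u x0 \<rho> = (\<lambda>s. \<integral>\<^sup>+y. ennreal (\<bar>max (u' y) 0\<bar> powr (p - 1) / norm (y - x0) powr (real DIM('a) + s * p))
      * indicator (- ball x0 \<rho>) y \<partial>lborel)" by (rule ext)
  moreover have "(\<lambda>(s, y). ennreal (\<bar>max (u' y) 0\<bar> powr (p - 1) / norm (y - x0) powr (real DIM('a) + s * p)) * indicator (- ball x0 \<rho>) y)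
    \<in> borel_measurable (\<mu> \<Otimes>\<^sub>M lborel)" by measurable
  ultimately show ?thesis by (simp add: lborel.borel_measurable_nn_integral)
qed

text \<open>The slices are integrated over s. Their near term carries the factor 1/(1 -
  2^(-p(1-s))), which the normalization constant compensates uniformly; their far term integrates to
  the tail. K is fixed before the function, the cutoff and the radii.\<close>

lemma nonlocal_form_lower:
  fixes \<mu> :: "real measure"
  assumes p: "1 < p" "p \<le> real m"
    and mu: "sets \<mu> = sets (restrict_space borel {0..1})" "finite_measure \<mu>"
  obtains K where "0 < K"
    "\<And>(u :: 'a::euclidean_space \<Rightarrow> real) u' \<phi> x0 b c \<rho> k L.
    u' \<in> borel_measurable borel \<Longrightarrow> (AE x in lborel. u x = u' x) \<Longrightarrow> 0 \<le> b \<Longrightarrow> b < c \<Longrightarrow> c \<le> 1 \<Longrightarrow> \<rho> \<le> c \<Longrightarrow> 0 \<le> k \<Longrightarrow>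
    \<phi> \<in> borel_measurable borel \<Longrightarrow> (\<And>x. 0 \<le> \<phi> x) \<Longrightarrow> (\<And>x. \<phi> x \<le> 1) \<Longrightarrow> (\<And>x. x \<notin> ball x0 b \<Longrightarrow> \<phi> x = 0) \<Longrightarrow>
    (\<And>x y. \<bar>\<phi> x - \<phi> y\<bar> \<le> L * norm (x - y)) \<Longrightarrow> 0 \<le> L \<Longrightarrow>
    ennreal (- nonlocal_form \<mu> p u (\<lambda>x. \<phi> x ^ m * max (u x - k) 0)) \<le>
      ennreal (K * L powr p) * (\<integral>\<^sup>+x. ennreal (max (u' x - k) 0 powr p) * indicator (ball x0 c) x \<partial>lborel)
      + ennreal (2 * (c / (c - b)) powr (real DIM('a) + p)) * ((\<integral>\<^sup>+x. ennreal (\<phi> x ^ m * max (u' x - k) 0) \<partial>lborel)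
        * tail_integral \<mu> p u x0 \<rho>)"
proof -
  interpret finite_measure \<mu> by fact
  obtain M where M: "0 < M" "\<And>s. s \<in> {0<..<1} \<Longrightarrow> 0 \<le> frac_const DIM('a) p s"
    "\<And>s. s \<in> {0<..<1} \<Longrightarrow> frac_const DIM('a) p s / (1 - 2 powr (- (p * (1 - s)))) \<le> M"
    using frac_const_bound(1)[OF p(1), of "DIM('a)"] DIM_positive[where 'a = 'a] by (auto simp: Suc_le_eq)
  define V where "V = measure lborel (ball (0::'a) 1) * 2 ^ DIM('a) * 2 powr p"
  have V: "0 \<le> V" by (simp add: V_def)
  define \<mu>1 where "\<mu>1 = measure \<mu> {0<..<1}"
  \<comment> \<open>The summand 1 makes K positive also if \<mu> has no mass in the open
    interval.\<close>
  define K where "K = 2 * real m powr p * V * M * \<mu>1 + 1"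
  have K: "0 < K" unfolding K_def using V M by (intro add_nonneg_pos mult_nonneg_nonneg) (auto simp: \<mu>1_def)
  note mm = measurable_unit_interval_borel[OF mu(1)]
  note [measurable] = mm(1,2)
  have fc[measurable]: "frac_const DIM('a) p \<in> borel_measurable \<mu>"
    using frac_const_bound(2)[OF p(1), of "DIM('a)"] DIM_positive[where 'a = 'a] by (intro mm(4)) (simp add: Suc_le_eq)
  show ?thesis
  proof (rule that[OF K])
    fix u u' \<phi> :: "'a \<Rightarrow> real" and x0 :: 'a and b c \<rho> k L :: real
    assume u'[measurable]: "u' \<in> borel_measurable borel" and ae: "AE x in lborel. u x = u' x"
      and bc: "0 \<le> b" "b < c" "c \<le> 1" and \<rho>: "\<rho> \<le> c" and k: "0 \<le> k" and \<phi>m[measurable]: "\<phi> \<in> borel_measurable borel"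
      and \<phi>: "\<And>x. 0 \<le> \<phi> x" "\<And>x. \<phi> x \<le> 1" "\<And>x. x \<notin> ball x0 b \<Longrightarrow> \<phi> x = 0"
      and Lip: "\<And>x y. \<bar>\<phi> x - \<phi> y\<bar> \<le> L * norm (x - y)" and L: "0 \<le> L"
    have [measurable]: "ball x0 \<rho> \<in> sets borel" by simp
    define W where "W = (\<integral>\<^sup>+x. ennreal (max (u' x - k) 0 powr p) * indicator (ball x0 c) x \<partial>lborel)"
    define I where "I = (\<integral>\<^sup>+x. ennreal (\<phi> x ^ m * max (u' x - k) 0) \<partial>lborel)"
    define \<Theta> where "\<Theta> = 2 * (c / (c - b)) powr (real DIM('a) + p)"
    define T where "T s = (\<integral>\<^sup>+y. ennreal (max (u' y) 0 powr (p - 1) / norm (y - x0) powr (real DIM('a) + s * p)) * indicator (- ball x0 \<rho>) y \<partial>lborel)" for s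
    define f where "f s = (\<integral>(x, y). p_flux p (u x - u y) * (\<phi> x ^ m * max (u x - k) 0 - \<phi> y ^ m * max (u y - k) 0) /
             norm (x - y) powr (real DIM('a) + s * p) \<partial>(lebesgue :: ('a \<times> 'a) measure))" for s
    have T_eq: "tail_kernel p u x0 \<rho> s = T s" for s
      unfolding tail_kernel_def nn_integral_completion T_def by (rule nn_integral_cong_AE) (use ae in eventually_elim, simp)
    then have "tail_kernel p u x0 \<rho> = T" by (rule ext)
    then have [measurable]: "T \<in> borel_measurable \<mu>"
      using tail_kernel_measurable[OF mu(1) u' ae, of p x0 \<rho>] by simp
    have slice: "ennreal (- f s) \<le> ennreal (2 * real m powr p * L powr p * (V / (1 - 2 powr (- (p * (1 - s)))))) * W + ennreal \<Theta> * (I * T s)"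
      if s: "s \<in> {0<..<1}" for s
    proof -
      have "ennreal (- f s) \<le> (\<integral>\<^sup>+z. ennreal (- (case z of (x, y) \<Rightarrow> p_flux p (u x - u y) * (\<phi> x ^ m * max (u x - k) 0 - \<phi> y ^ m * max (u y - k) 0) /
             norm (x - y) powr (real DIM('a) + s * p))) \<partial>(lebesgue :: ('a \<times> 'a) measure))"
        unfolding f_def by (rule ennreal_uminus_integral_le)
      also have "\<dots> = (\<integral>\<^sup>+z. ennreal (- (case z of (x, y) \<Rightarrow> p_flux p (u' x - u' y) * (\<phi> x ^ m * max (u' x - k) 0 - \<phi> y ^ m * max (u' y - k) 0) /
             norm (x - y) powr (real DIM('a) + s * p))) \<partial>(lborel :: ('a \<times> 'a) measure))"
        unfolding nn_integral_completion
        by (rule nn_integral_cong_AE) (use AE_lborel_pair[OF ae] in \<open>eventually_elim, auto\<close>)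
      also have "\<dots> = (\<integral>\<^sup>+(x, y). ennreal (- (p_flux p (u' x - u' y) * (\<phi> x ^ m * max (u' x - k) 0 - \<phi> y ^ m * max (u' y - k) 0) /
             norm (x - y) powr (real DIM('a) + s * p))) \<partial>(lborel :: ('a \<times> 'a) measure))"
        by (intro nn_integral_cong) auto
      also have "\<dots> \<le> ennreal (2 * real m powr p * L powr p * (V / (1 - 2 powr (- (p * (1 - s)))))) * W + ennreal \<Theta> * (I * T s)"
        unfolding V_def W_def \<Theta>_def I_def T_def
        by (rule nonlocal_slice[OF p _ _ bc \<rho> k]) (use s \<phi> Lip L in auto)
      finally show ?thesis .
    qed
    have "ennreal (- nonlocal_form \<mu> p u (\<lambda>x. \<phi> x ^ m * max (u x - k) 0)) \<le>
      (\<integral>\<^sup>+s. ennreal (- (indicator {0<..<1} s *\<^sub>R (frac_const DIM('a) p s * f s))) \<partial>\<mu>)"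
      unfolding nonlocal_form_def set_lebesgue_integral_def f_def by (rule ennreal_uminus_integral_le)
    also have "\<dots> \<le> (\<integral>\<^sup>+s. (ennreal (2 * real m powr p * L powr p * V * M) * W) * indicator {0<..<1} s
         + (ennreal \<Theta> * I) * (ennreal (frac_const DIM('a) p s) * T s * indicator {0<..<1} s) \<partial>\<mu>)"
    proof (rule nn_integral_mono)
      fix s
      show "ennreal (- (indicator {0<..<1} s *\<^sub>R (frac_const DIM('a) p s * f s))) \<le>
         (ennreal (2 * real m powr p * L powr p * V * M) * W) * indicator {0<..<1} s
         + (ennreal \<Theta> * I) * (ennreal (frac_const DIM('a) p s) * T s * indicator {0<..<1} s)"
      proof (cases "s \<in> {0<..<1}")
        case True
        define C where "C = frac_const DIM('a) p s"
        define d where "d = 1 - 2 powr (- (p * (1 - s)))"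
        have C: "0 \<le> C" "C / d \<le> M" using M(2,3)[OF True] by (auto simp: C_def d_def)
        have d: "0 < d" using powr_less_mono[of "- (p * (1 - s))" 0 "2::real"] p True by (simp add: d_def)
        have le: "ennreal (C * (2 * real m powr p * L powr p * (V / d))) \<le> ennreal (2 * real m powr p * L powr p * V * M)"
        proof (rule ennreal_leI)
          have "C * (2 * real m powr p * L powr p * (V / d)) = (2 * real m powr p * L powr p * V) * (C / d)" by simp
          also have "\<dots> \<le> (2 * real m powr p * L powr p * V) * M" using C V by (intro mult_left_mono) auto
          finally show "C * (2 * real m powr p * L powr p * (V / d)) \<le> 2 * real m powr p * L powr p * V * M" .
        qed
        have nn: "0 \<le> 2 * real m powr p * L powr p * (V / d)" using V d by simp
        have "ennreal (- (C * f s)) = ennreal C * ennreal (- f s)" using C by (simp add: ennreal_mult'[symmetric])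
        also have "\<dots> \<le> ennreal C * (ennreal (2 * real m powr p * L powr p * (V / d)) * W + ennreal \<Theta> * (I * T s))"
          unfolding d_def by (intro mult_left_mono slice True) simp
        also have "\<dots> = ennreal (C * (2 * real m powr p * L powr p * (V / d))) * W + (ennreal \<Theta> * I) * (ennreal C * T s)"
          unfolding ennreal_mult[OF C(1) nn] by (simp only: distrib_left mult_ac)
        also have "\<dots> \<le> ennreal (2 * real m powr p * L powr p * V * M) * W + (ennreal \<Theta> * I) * (ennreal C * T s)"
          by (intro add_right_mono mult_right_mono le) simp
        finally show ?thesis using True by (simp add: C_def)
      qed simp
    qed
    also have "\<dots> = (ennreal (2 * real m powr p * L powr p * V * M) * W) * emeasure \<mu> {0<..<1}
         + (ennreal \<Theta> * I) * (\<integral>\<^sup>+s. ennreal (frac_const DIM('a) p s) * T s * indicator {0<..<1} s \<partial>\<mu>)"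
      by (subst nn_integral_add, simp, simp, subst nn_integral_cmult_indicator, simp, subst nn_integral_cmult) auto
    also have "\<dots> \<le> ennreal (K * L powr p) * W
         + (ennreal \<Theta> * I) * (\<integral>\<^sup>+s. ennreal (frac_const DIM('a) p s) * T s * indicator {0<..<1} s \<partial>\<mu>)"
    proof (rule add_right_mono)
      have "(ennreal (2 * real m powr p * L powr p * V * M) * W) * emeasure \<mu> {0<..<1} = ennreal (2 * real m powr p * L powr p * V * M * \<mu>1) * W"
        using V M(1) by (simp add: emeasure_eq_measure \<mu>1_def ennreal_mult mult_ac)
      also have "\<dots> \<le> ennreal (K * L powr p) * W"
        by (intro mult_right_mono ennreal_leI) (auto simp: K_def algebra_simps)
      finally show "(ennreal (2 * real m powr p * L powr p * V * M) * W) * emeasure \<mu> {0<..<1} \<le> ennreal (K * L powr p) * W" .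
    qed
    finally show "ennreal (- nonlocal_form \<mu> p u (\<lambda>x. \<phi> x ^ m * max (u x - k) 0)) \<le>
      ennreal (K * L powr p) * (\<integral>\<^sup>+x. ennreal (max (u' x - k) 0 powr p) * indicator (ball x0 c) x \<partial>lborel)
      + ennreal (2 * (c / (c - b)) powr (real DIM('a) + p)) * ((\<integral>\<^sup>+x. ennreal (\<phi> x ^ m * max (u' x - k) 0) \<partial>lborel)
        * tail_integral \<mu> p u x0 \<rho>)"
      unfolding tail_integral_def T_eq W_def I_def \<Theta>_def by (simp only: mult.assoc)
  qed
qed

section \<open>Weak gradients\<close>

text \<open>Assembled from the coordinates, each of which is a real function measurable for the
  completion.\<close>

lemma integrable_lebesgue_borel_version:
  fixes f :: "'a::euclidean_space \<Rightarrow> 'b::euclidean_space"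
  assumes "integrable lebesgue f"
  obtains f' where "integrable lborel f'" "AE x in lborel. f x = f' x"
proof -
  have "\<exists>h. h \<in> borel_measurable lborel \<and> (AE x in lborel. f x \<bullet> b = h x)" for b
    using completion_ex_borel_measurable_real[of "\<lambda>x. f x \<bullet> b" lborel] borel_measurable_integrable[OF assms] by auto
  then obtain h where h: "\<And>b. h b \<in> borel_measurable lborel" "\<And>b. AE x in lborel. f x \<bullet> b = h b x" by metis
  define f' where "f' x = (\<Sum>b\<in>Basis. h b x *\<^sub>R b)" for x
  have "AE x in lborel. \<forall>b\<in>Basis. f x \<bullet> b = h b x" using h(2) by (intro AE_finite_allI) auto
  then have ae: "AE x in lborel. f x = f' x"
  proof eventually_elim
    case (elim x)
    then have "f' x = (\<Sum>b\<in>Basis. (f x \<bullet> b) *\<^sub>R b)" unfolding f'_def by (intro sum.cong) auto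
    then show ?case by (simp add: euclidean_representation)
  qed
  have [measurable]: "f' \<in> borel_measurable lborel" unfolding f'_def[abs_def] using h(1) by measurable
  have "integrable lebesgue f'"
  proof (rule integrable_cong_AE_imp[OF assms])
    show "f' \<in> borel_measurable lebesgue" by (rule measurable_completion) measurable
    show "AE x in lebesgue. f x = f' x" using AE_completion[OF ae] .
  qed
  then have "integrable lborel f'" by (subst (asm) integrable_completion) auto
  then show ?thesis using ae that by blast
qed

lemma weak_deriv_unique:
  assumes "weak_deriv h u g" "weak_deriv h u' g'" "AE x in lborel. u x = u' x"
  shows "AE x in lborel. g x = g' x"
proof -
  note i = weak_derivD(1,2)[OF assms(1)] weak_derivD(1,2)[OF assms(2)]
  have [measurable]: "u \<in> borel_measurable borel" "u' \<in> borel_measurable borel"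
    using borel_measurable_integrable[OF i(1)] borel_measurable_integrable[OF i(3)] by simp_all
  have "AE x in lborel. g x - g' x = 0"
  proof (rule fundamental_lemma)
    fix \<phi> :: "'a \<Rightarrow> real" assume \<phi>: "test_function UNIV \<phi>"
    obtain D where D: "\<And>x. GDERIV \<phi> x :> D x" using test_function_obtain[OF \<phi>] by blast
    obtain B where B: "\<And>x. \<bar>\<phi> x\<bar> \<le> B" "\<And>x. norm (D x) \<le> B" "0 < B" using test_function_bounded[OF \<phi> D] by blast
    note [measurable] = test_function_measurable[OF \<phi> D]
    have j: "integrable lborel (\<lambda>x. \<phi> x * g x)" "integrable lborel (\<lambda>x. \<phi> x * g' x)"
      using i B by (auto intro!: integrable_mult_bounded)
    have "(\<integral>x. u x * (D x \<bullet> h) \<partial>lborel) = (\<integral>x. u' x * (D x \<bullet> h) \<partial>lborel)"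
      using assms(3) by (intro integral_cong_AE) (auto elim: eventually_mono)
    then have "(\<integral>x. \<phi> x * g x \<partial>lborel) = (\<integral>x. \<phi> x * g' x \<partial>lborel)"
      using weak_derivD(3)[OF assms(1) \<phi> D] weak_derivD(3)[OF assms(2) \<phi> D] by simp
    then show "(\<integral>x. \<phi> x * (g x - g' x) \<partial>lborel) = 0" using j by (simp add: right_diff_distrib)
  qed (use i in auto)
  then show ?thesis by eventually_elim simp
qed

lemma Lp_loc_1_borel_version:
  fixes f :: "'a::euclidean_space \<Rightarrow> 'b::euclidean_space"
  assumes "Lp_loc 1 S f" "compact K" "K \<subseteq> S"
  obtains f' where "integrable lborel f'" "AE x in lborel. x \<in> K \<longrightarrow> f x = f' x"
proof -
  have "Lp 1 K f" using assms by (auto simp: Lp_loc_def)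
  then have m: "f \<in> borel_measurable (lebesgue_on K)" and "integrable (lebesgue_on K) (\<lambda>x. norm (f x) powr 1)" by (auto simp: Lp_def)
  moreover have "(\<lambda>x. norm (f x) powr 1) = (\<lambda>x. norm (f x))" by (auto simp: powr_one_gt_zero_iff)
  ultimately have "integrable (lebesgue_on K) f" by (simp add: integrable_norm_iff)
  then have "integrable lebesgue (\<lambda>x. indicator K x *\<^sub>R f x)"
    using assms(2) by (subst (asm) integrable_restrict_space) (auto simp: lmeasurable_compact fmeasurableD)
  then obtain f' where "integrable lborel f'" "AE x in lborel. indicator K x *\<^sub>R f x = f' x"
    by (rule integrable_lebesgue_borel_version)
  then show ?thesis by (intro that[of f']) (auto elim: eventually_mono)
qed

lemma has_weak_gradientD:
  assumes "has_weak_gradient S u g" "test_function S \<phi>" "\<And>x. GDERIV \<phi> x :> D x"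
  shows "(\<integral>x. u x *\<^sub>R D x \<partial>lebesgue_on S) = - (\<integral>x. \<phi> x *\<^sub>R g x \<partial>lebesgue_on S)"
  using assms unfolding has_weak_gradient_def by (elim conjE allE[of _ \<phi>] allE[of _ D]) simp

text \<open>The bridge from a weak gradient on an open set to derivatives on the whole space: the
  test function \<eta>\<phi> is admissible in S, and the product rule moves the gradient of \<eta>
  to the other side. Off K both \<eta> and its gradient vanish, so the representatives u' and g'
  have to agree with u and g on K only.\<close>

lemma has_weak_gradient_localize:
  fixes S :: "'a::euclidean_space set"
  assumes hw: "has_weak_gradient S u g" and S: "open S" and K: "compact K" "K \<subseteq> S"
    and \<eta>: "test_function S \<eta>" "\<And>x. GDERIV \<eta> x :> E x" "\<And>x. x \<notin> K \<Longrightarrow> \<eta> x = 0" "\<And>x. x \<notin> K \<Longrightarrow> E x = 0"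
    and u': "integrable lborel u'" "AE x in lborel. x \<in> K \<longrightarrow> u x = u' x"
    and g': "integrable lborel g'" "AE x in lborel. x \<in> K \<longrightarrow> g x = g' x"
  shows "weak_deriv h (\<lambda>x. \<eta> x * u' x) (\<lambda>x. (\<eta> x *\<^sub>R g' x + u' x *\<^sub>R E x) \<bullet> h)"
proof -
  have [measurable]: "u' \<in> borel_measurable borel" "g' \<in> borel_measurable borel" using u' g' by auto
  note [measurable] = test_function_measurable[OF \<eta>(1,2)]
  obtain B where B: "\<And>x. \<bar>\<eta> x\<bar> \<le> B" "\<And>x. norm (E x) \<le> B" "0 < B" using test_function_bounded[OF \<eta>(1,2)] by blast
  have bE: "\<bar>E x \<bullet> h\<bar> \<le> B * norm h" for x
    using Cauchy_Schwarz_ineq2[of "E x" h] mult_right_mono[OF B(2)[of x], of "norm h"] by simp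
  have ig: "integrable lborel (\<lambda>x. g' x \<bullet> h)" using g' by simp
  have i: "integrable lborel (\<lambda>x. \<eta> x * u' x)" "integrable lborel (\<lambda>x. \<eta> x * (g' x \<bullet> h))" "integrable lborel (\<lambda>x. (E x \<bullet> h) * u' x)"
    using u' ig B bE by (auto intro!: integrable_mult_bounded)
  \<comment> \<open>Both integrands vanish off K and agree almost everywhere on K, so restricting to
    S and completing the measure change nothing. The nonmeasurable case is contradictory: a function
    equal almost everywhere to a Borel function is Lebesgue measurable.\<close>
  have conv: "(\<integral>x. F x \<partial>lebesgue_on S) = (\<integral>x. F' x \<partial>lborel)"
    if "F' \<in> borel_measurable borel" "AE x in lborel. x \<in> K \<longrightarrow> F x = F' x" "\<And>x. x \<notin> K \<Longrightarrow> F x = 0" "\<And>x. x \<notin> K \<Longrightarrow> F' x = 0"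
    for F F' :: "'a \<Rightarrow> 'a"
  proof -
    have "(\<integral>x. F x \<partial>lebesgue_on S) = (\<integral>x. indicator S x *\<^sub>R F x \<partial>lebesgue)"
      using S by (intro integral_restrict_space) auto
    also have "\<dots> = (\<integral>x. F' x \<partial>lebesgue)"
    proof (cases "(\<lambda>x. indicator S x *\<^sub>R F x) \<in> borel_measurable lebesgue")
      case True
      show ?thesis
      proof (rule integral_cong_AE[OF True])
        show "F' \<in> borel_measurable lebesgue" using that(1) by (intro measurable_completion) simp
        show "AE x in lebesgue. indicator S x *\<^sub>R F x = F' x"
          using AE_completion[OF that(2)] by eventually_elim (use that K in \<open>auto split: split_indicator\<close>)
      qed
    next
      case False
      have Fm: "F' \<in> borel_measurable lebesgue" using that(1) by (intro measurable_completion) simp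
      have "AE x in lborel. F' x = indicator S x *\<^sub>R F x"
        using that(2) by eventually_elim (use that K in \<open>auto split: split_indicator\<close>)
      then have "(\<lambda>x. indicator S x *\<^sub>R F x) \<in> borel_measurable lebesgue"
        by (rule borel_measurable_AE[OF Fm AE_completion])
      then show ?thesis using False by simp
    qed
    also have "\<dots> = (\<integral>x. F' x \<partial>lborel)" using that(1) by (intro integral_completion) simp
    finally show ?thesis .
  qed
  show ?thesis unfolding weak_deriv_def
  proof (intro conjI allI impI)
    show "integrable lborel (\<lambda>x. \<eta> x * u' x)" by (rule i)
    show "integrable lborel (\<lambda>x. (\<eta> x *\<^sub>R g' x + u' x *\<^sub>R E x) \<bullet> h)"
      using i(2,3) by (simp add: inner_add_left mult.commute)
    fix \<phi> :: "'a \<Rightarrow> real" and D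
    assume a: "test_function UNIV \<phi> \<and> (\<forall>x. GDERIV \<phi> x :> D x)"
    then have \<phi>: "test_function UNIV \<phi>" and D: "\<And>x. GDERIV \<phi> x :> D x" by auto
    obtain B' where B': "\<And>x. \<bar>\<phi> x\<bar> \<le> B'" "\<And>x. norm (D x) \<le> B'" "0 < B'" using test_function_bounded[OF \<phi> D] by blast
    note [measurable] = test_function_measurable[OF \<phi> D]
    have bD: "\<bar>D x \<bullet> h\<bar> \<le> B' * norm h" for x
      using Cauchy_Schwarz_ineq2[of "D x" h] mult_right_mono[OF B'(2)[of x], of "norm h"] by simp
    have t: "test_function S (\<lambda>x. \<eta> x * \<phi> x)"
      using \<phi> by (intro test_function_mult[OF \<eta>(1)]) (simp add: test_function_def)
    have d: "GDERIV (\<lambda>x. \<eta> x * \<phi> x) x :> \<eta> x *\<^sub>R D x + \<phi> x *\<^sub>R E x" for x by (rule GDERIV_mult[OF \<eta>(2) D])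
    have "(\<integral>x. u x *\<^sub>R (\<eta> x *\<^sub>R D x + \<phi> x *\<^sub>R E x) \<partial>lebesgue_on S) = - (\<integral>x. (\<eta> x * \<phi> x) *\<^sub>R g x \<partial>lebesgue_on S)"
      by (rule has_weak_gradientD[OF hw t d])
    moreover have "(\<integral>x. u x *\<^sub>R (\<eta> x *\<^sub>R D x + \<phi> x *\<^sub>R E x) \<partial>lebesgue_on S) = (\<integral>x. u' x *\<^sub>R (\<eta> x *\<^sub>R D x + \<phi> x *\<^sub>R E x) \<partial>lborel)"
      by (rule conv) (use u'(2) \<eta>(3,4) in \<open>auto elim: eventually_mono\<close>)
    moreover have "(\<integral>x. (\<eta> x * \<phi> x) *\<^sub>R g x \<partial>lebesgue_on S) = (\<integral>x. (\<eta> x * \<phi> x) *\<^sub>R g' x \<partial>lborel)"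
      by (rule conv) (use g'(2) \<eta>(3,4) in \<open>auto elim: eventually_mono\<close>)
    ultimately have eq: "(\<integral>x. u' x *\<^sub>R (\<eta> x *\<^sub>R D x + \<phi> x *\<^sub>R E x) \<partial>lborel) \<bullet> h = - ((\<integral>x. (\<eta> x * \<phi> x) *\<^sub>R g' x \<partial>lborel) \<bullet> h)" by simp
    have n1: "norm (\<eta> x *\<^sub>R D x + \<phi> x *\<^sub>R E x) \<le> B * B' + B' * B" for x
    proof -
      have "norm (\<eta> x *\<^sub>R D x + \<phi> x *\<^sub>R E x) \<le> \<bar>\<eta> x\<bar> * norm (D x) + \<bar>\<phi> x\<bar> * norm (E x)"
        using norm_triangle_ineq[of "\<eta> x *\<^sub>R D x" "\<phi> x *\<^sub>R E x"] by simp
      also have "\<dots> \<le> B * B' + B' * B" using B B' by (intro add_mono mult_mono) auto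
      finally show ?thesis .
    qed
    have v1: "integrable lborel (\<lambda>x. u' x *\<^sub>R (\<eta> x *\<^sub>R D x + \<phi> x *\<^sub>R E x))"
    proof (rule Bochner_Integration.integrable_bound)
      show "integrable lborel (\<lambda>x. (B * B' + B' * B) * u' x)" using u' by simp
      show "AE x in lborel. norm (u' x *\<^sub>R (\<eta> x *\<^sub>R D x + \<phi> x *\<^sub>R E x)) \<le> norm ((B * B' + B' * B) * u' x)"
        using n1 B B' by (intro AE_I2) (auto simp: abs_mult mult.commute intro!: mult_left_mono order_trans[OF n1])
    qed measurable
    have v2: "integrable lborel (\<lambda>x. (\<eta> x * \<phi> x) *\<^sub>R g' x)"
    proof (rule Bochner_Integration.integrable_bound)
      show "integrable lborel (\<lambda>x. (B * B') *\<^sub>R g' x)" using g' by simp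
      show "AE x in lborel. norm ((\<eta> x * \<phi> x) *\<^sub>R g' x) \<le> norm ((B * B') *\<^sub>R g' x)"
        using B B' by (intro AE_I2) (auto simp: abs_mult intro!: mult_right_mono mult_mono)
    qed measurable
    have j: "integrable lborel (\<lambda>x. (D x \<bullet> h) * (\<eta> x * u' x))" "integrable lborel (\<lambda>x. \<phi> x * ((E x \<bullet> h) * u' x))"
        "integrable lborel (\<lambda>x. \<phi> x * (\<eta> x * (g' x \<bullet> h)))"
      using i B' bD by (auto intro!: integrable_mult_bounded)
    have "(\<integral>x. u' x *\<^sub>R (\<eta> x *\<^sub>R D x + \<phi> x *\<^sub>R E x) \<partial>lborel) \<bullet> h = (\<integral>x. (u' x *\<^sub>R (\<eta> x *\<^sub>R D x + \<phi> x *\<^sub>R E x)) \<bullet> h \<partial>lborel)"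
      by (rule integral_inner_left[symmetric]) (rule v1)
    also have "\<dots> = (\<integral>x. (D x \<bullet> h) * (\<eta> x * u' x) + \<phi> x * ((E x \<bullet> h) * u' x) \<partial>lborel)"
      by (intro Bochner_Integration.integral_cong) (auto simp: inner_add_left algebra_simps)
    also have "\<dots> = (\<integral>x. (D x \<bullet> h) * (\<eta> x * u' x) \<partial>lborel) + (\<integral>x. \<phi> x * ((E x \<bullet> h) * u' x) \<partial>lborel)"
      using j by simp
    finally have e1: "(\<integral>x. u' x *\<^sub>R (\<eta> x *\<^sub>R D x + \<phi> x *\<^sub>R E x) \<partial>lborel) \<bullet> h = \<dots>" .
    have "(\<integral>x. (\<eta> x * \<phi> x) *\<^sub>R g' x \<partial>lborel) \<bullet> h = (\<integral>x. ((\<eta> x * \<phi> x) *\<^sub>R g' x) \<bullet> h \<partial>lborel)"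
      by (rule integral_inner_left[symmetric]) (rule v2)
    also have "\<dots> = (\<integral>x. \<phi> x * (\<eta> x * (g' x \<bullet> h)) \<partial>lborel)"
      by (intro Bochner_Integration.integral_cong) (auto simp: mult_ac)
    finally have "(\<integral>x. (D x \<bullet> h) * (\<eta> x * u' x) \<partial>lborel) = - ((\<integral>x. \<phi> x * (\<eta> x * (g' x \<bullet> h)) \<partial>lborel) + (\<integral>x. \<phi> x * ((E x \<bullet> h) * u' x) \<partial>lborel))"
      using eq e1 by simp
    also have "\<dots> = - (\<integral>x. \<phi> x * (\<eta> x * (g' x \<bullet> h)) + \<phi> x * ((E x \<bullet> h) * u' x) \<partial>lborel)" using j by simp
    finally show "(\<integral>x. \<eta> x * u' x * (D x \<bullet> h) \<partial>lborel) = - (\<integral>x. \<phi> x * ((\<eta> x *\<^sub>R g' x + u' x *\<^sub>R E x) \<bullet> h) \<partial>lborel)"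
      by (simp add: inner_add_left algebra_simps)
  qed
qed

lemma AE_vector_eqI:
  fixes f g :: "'a \<Rightarrow> 'b::euclidean_space"
  assumes "\<And>h. AE x in M. f x \<bullet> h = g x \<bullet> h"
  shows "AE x in M. f x = g x"
proof -
  have "AE x in M. \<forall>b\<in>Basis. f x \<bullet> b = g x \<bullet> b" using assms by (intro AE_finite_allI) auto
  then show ?thesis by eventually_elim (auto intro: euclidean_eqI)
qed

text \<open>A cutoff equal to 1 on the smaller ball reduces uniqueness on S to that of derivatives
  of integrable functions on the whole space. This is what makes statements about the chosen
  \<open>weak_gradient\<close> possible.\<close>

lemma weak_gradient_unique_ball:
  fixes S :: "'a::euclidean_space set"
  assumes hw: "has_weak_gradient S u g1" "has_weak_gradient S u g2" and S: "open S" and c: "0 \<le> c" "c < d" "cball x0 d \<subseteq> S"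
  shows "AE x in lborel. x \<in> cball x0 c \<longrightarrow> g1 x = g2 x"
proof -
  let ?K = "cball x0 d"
  obtain \<eta> E where \<eta>: "test_function S \<eta>" "\<And>x. GDERIV \<eta> x :> E x" "\<And>x. 0 \<le> \<eta> x" "\<And>x. \<eta> x \<le> 1"
    "\<And>x. x \<in> cball x0 c \<Longrightarrow> \<eta> x = 1" "\<And>x. x \<notin> ball x0 d \<Longrightarrow> \<eta> x = 0"
    "\<And>x. norm (E x) \<le> 32 * exp 2 / (d - c)" using cutoff_exists[OF c] by blast
  have \<eta>K: "\<eta> x = 0" "E x = 0" if "x \<notin> ?K" for x
  proof -
    show "\<eta> x = 0" using \<eta>(6)[of x] that by auto
    have "closure {x. \<eta> x \<noteq> 0} \<subseteq> ?K" using \<eta>(6) by (intro closure_minimal) (auto, meson less_imp_le mem_ball)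
    then show "E x = 0" using that by (intro test_functionD(6)[OF \<eta>(1,2)]) auto
  qed
  have L: "Lp_loc 1 S u" "Lp_loc 1 S g1" "Lp_loc 1 S g2" using hw by (auto simp: has_weak_gradient_def)
  obtain u' where u': "integrable lborel u'" "AE x in lborel. x \<in> ?K \<longrightarrow> u x = u' x"
    using Lp_loc_1_borel_version[OF L(1) compact_cball c(3)] by blast
  obtain g1' where g1': "integrable lborel g1'" "AE x in lborel. x \<in> ?K \<longrightarrow> g1 x = g1' x"
    using Lp_loc_1_borel_version[OF L(2) compact_cball c(3)] by blast
  obtain g2' where g2': "integrable lborel g2'" "AE x in lborel. x \<in> ?K \<longrightarrow> g2 x = g2' x"
    using Lp_loc_1_borel_version[OF L(3) compact_cball c(3)] by blast
  have "AE x in lborel. (\<eta> x *\<^sub>R g1' x + u' x *\<^sub>R E x) \<bullet> h = (\<eta> x *\<^sub>R g2' x + u' x *\<^sub>R E x) \<bullet> h" for h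
    using has_weak_gradient_localize[OF hw(1) S compact_cball c(3) \<eta>(1,2) \<eta>K u' g1']
      has_weak_gradient_localize[OF hw(2) S compact_cball c(3) \<eta>(1,2) \<eta>K u' g2']
    by (rule weak_deriv_unique) simp_all
  then have "AE x in lborel. \<eta> x *\<^sub>R g1' x + u' x *\<^sub>R E x = \<eta> x *\<^sub>R g2' x + u' x *\<^sub>R E x" by (rule AE_vector_eqI)
  then show ?thesis using g1'(2) g2'(2)
    by eventually_elim (use \<eta>(5) c in auto)
qed

text \<open>The way back from directional derivatives to the definition, applied to the function
  with which the subsolution is tested. The vector identity is checked by components.\<close>

lemma has_weak_gradient_UNIV_I:
  fixes v :: "'a::euclidean_space \<Rightarrow> real"
  assumes w: "\<And>h. weak_deriv h v' (\<lambda>x. G x \<bullet> h)" and G: "integrable lborel G" and v: "AE x in lborel. v x = v' x"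
  shows "has_weak_gradient UNIV v G"
proof -
  have v': "integrable lborel v'" using weak_derivD(1)[OF w] .
  have [measurable]: "v' \<in> borel_measurable borel" "G \<in> borel_measurable borel" using v' G by auto
  have vm: "v \<in> borel_measurable lebesgue"
  proof (rule borel_measurable_AE)
    show "v' \<in> borel_measurable lebesgue" by (rule measurable_completion) simp
    show "AE x in lebesgue. v' x = v x" using AE_completion[OF v] by eventually_elim simp
  qed
  have iv: "integrable lebesgue v"
  proof (rule integrable_cong_AE_imp[OF _ vm])
    show "integrable lebesgue v'" using v' by (subst integrable_completion) auto
    show "AE x in lebesgue. v' x = v x" using AE_completion[OF v] by eventually_elim simp
  qed
  have iG: "integrable lebesgue G" using G by (subst integrable_completion) auto
  have L: "Lp_loc 1 UNIV f" if "integrable lebesgue f" for f :: "'a \<Rightarrow> 'b::euclidean_space"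
    unfolding Lp_loc_def Lp_def
  proof (intro allI impI conjI)
    fix K :: "'a set" assume "compact K \<and> K \<subseteq> UNIV"
    then have K: "K \<in> sets lebesgue" by (auto simp: lmeasurable_compact fmeasurableD)
    show "f \<in> borel_measurable (lebesgue_on K)" using that by (auto intro: measurable_restrict_space1)
    have "(\<lambda>x. norm (f x) powr 1) = (\<lambda>x. norm (f x))" by (auto simp: powr_one_gt_zero_iff)
    moreover have "integrable (lebesgue_on K) f"
      using K integrable_mult_indicator[OF K that] by (subst integrable_restrict_space) auto
    ultimately show "integrable (lebesgue_on K) (\<lambda>x. norm (f x) powr 1)" by simp
  qed
  show ?thesis unfolding has_weak_gradient_def lebesgue_on_UNIV_eq
  proof (intro conjI L iv iG allI impI)
    fix \<phi> :: "'a \<Rightarrow> real" and D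
    assume a: "test_function UNIV \<phi> \<and> (\<forall>x. GDERIV \<phi> x :> D x)"
    then have \<phi>: "test_function UNIV \<phi>" and D: "\<And>x. GDERIV \<phi> x :> D x" by auto
    obtain B where B: "\<And>x. \<bar>\<phi> x\<bar> \<le> B" "\<And>x. norm (D x) \<le> B" "0 < B" using test_function_bounded[OF \<phi> D] by blast
    note [measurable] = test_function_measurable[OF \<phi> D]
    have "(\<integral>x. v x *\<^sub>R D x \<partial>lebesgue) = (\<integral>x. v' x *\<^sub>R D x \<partial>lebesgue)"
    proof (rule integral_cong_AE)
      have Dm: "D \<in> borel_measurable lebesgue" by (rule measurable_completion) simp
      show "(\<lambda>x. v x *\<^sub>R D x) \<in> borel_measurable lebesgue" using vm Dm by (rule borel_measurable_scaleR)
      show "(\<lambda>x. v' x *\<^sub>R D x) \<in> borel_measurable lebesgue" by (rule measurable_completion) measurable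
      show "AE x in lebesgue. v x *\<^sub>R D x = v' x *\<^sub>R D x" using AE_completion[OF v] by eventually_elim simp
    qed
    also have "\<dots> = (\<integral>x. v' x *\<^sub>R D x \<partial>lborel)" by (intro integral_completion) measurable
    finally have e1: "(\<integral>x. v x *\<^sub>R D x \<partial>lebesgue) = (\<integral>x. v' x *\<^sub>R D x \<partial>lborel)" .
    have e2: "(\<integral>x. \<phi> x *\<^sub>R G x \<partial>lebesgue) = (\<integral>x. \<phi> x *\<^sub>R G x \<partial>lborel)" by (intro integral_completion) measurable
    have v1: "integrable lborel (\<lambda>x. v' x *\<^sub>R D x)"
    proof (rule Bochner_Integration.integrable_bound)
      show "integrable lborel (\<lambda>x. B * v' x)" using v' by simp
      show "AE x in lborel. norm (v' x *\<^sub>R D x) \<le> norm (B * v' x)"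
      proof (rule AE_I2)
        fix x
        show "norm (v' x *\<^sub>R D x) \<le> norm (B * v' x)"
          using mult_right_mono[OF B(2)[of x], of "\<bar>v' x\<bar>"] B(3) by (simp add: abs_mult mult.commute)
      qed
    qed measurable
    have v2: "integrable lborel (\<lambda>x. \<phi> x *\<^sub>R G x)"
    proof (rule Bochner_Integration.integrable_bound)
      show "integrable lborel (\<lambda>x. B *\<^sub>R G x)" using G by simp
      show "AE x in lborel. norm (\<phi> x *\<^sub>R G x) \<le> norm (B *\<^sub>R G x)"
      proof (rule AE_I2)
        fix x
        show "norm (\<phi> x *\<^sub>R G x) \<le> norm (B *\<^sub>R G x)"
          using mult_right_mono[OF B(1)[of x], of "norm (G x)"] B(3) by simp
      qed
    qed measurable
    show "(\<integral>x. v x *\<^sub>R D x \<partial>lebesgue) = - (\<integral>x. \<phi> x *\<^sub>R G x \<partial>lebesgue)"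
      unfolding e1 e2
    proof (rule euclidean_eqI)
      fix b :: 'a
      show "(\<integral>x. v' x *\<^sub>R D x \<partial>lborel) \<bullet> b = - (\<integral>x. \<phi> x *\<^sub>R G x \<partial>lborel) \<bullet> b"
        using weak_derivD(3)[OF w \<phi> D, of b] integral_inner_left[OF v1, of b] integral_inner_left[OF v2, of b] by simp
    qed
  qed
qed

text \<open>Countably many balls exhaust the space, so the exceptional null sets can be
  collected.\<close>

lemma weak_gradient_UNIV_AE:
  fixes v :: "'a::euclidean_space \<Rightarrow> real"
  assumes "has_weak_gradient UNIV v G"
  shows "AE x in lborel. weak_gradient UNIV v x = G x"
proof -
  have "has_weak_gradient UNIV v (weak_gradient UNIV v)" unfolding weak_gradient_def by (rule someI[of "has_weak_gradient UNIV v" G, OF assms])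
  then have "AE x in lborel. x \<in> cball 0 (real n) \<longrightarrow> weak_gradient UNIV v x = G x" for n
    using assms by (intro weak_gradient_unique_ball[where d = "real n + 1" and S = UNIV]) auto
  then have "AE x in lborel. \<forall>n. x \<in> cball 0 (real n) \<longrightarrow> weak_gradient UNIV v x = G x"
    by (intro AE_all_countable[THEN iffD2] allI)
  then show ?thesis
  proof eventually_elim
    case (elim x)
    obtain n :: nat where "norm x \<le> real n" using real_arch_simple by blast
    then show ?case using elim by auto
  qed
qed

section \<open>The energy estimate\<close>

lemma Lp_loc_ball_integrable:
  fixes f f' :: "'a::euclidean_space \<Rightarrow> 'b::euclidean_space"
  assumes L: "Lp_loc q S f" and c: "cball x0 c \<subseteq> S" and [measurable]: "f' \<in> borel_measurable borel"
    and ae: "AE x in lborel. x \<in> ball x0 c \<longrightarrow> f x = f' x"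
  shows "integrable lborel (\<lambda>x. indicator (ball x0 c) x * norm (f' x) powr q)"
proof -
  have [measurable]: "ball x0 c \<in> sets borel" by simp
  have "Lp q (cball x0 c) f" using L c by (auto simp: Lp_loc_def)
  then have "integrable (lebesgue_on (cball x0 c)) (\<lambda>x. norm (f x) powr q)" by (simp add: Lp_def)
  then have "integrable lebesgue (\<lambda>x. indicator (cball x0 c) x *\<^sub>R norm (f x) powr q)"
    by (subst (asm) integrable_restrict_space) auto
  from integrable_mult_indicator[OF _ this, of "ball x0 c"]
  have "integrable lebesgue (\<lambda>x. indicator (ball x0 c) x *\<^sub>R indicator (cball x0 c) x *\<^sub>R norm (f x) powr q)" by simp
  then have "integrable lebesgue (\<lambda>x. indicator (ball x0 c) x * norm (f' x) powr q)"
  proof (rule integrable_cong_AE_imp)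
    show "(\<lambda>x. indicator (ball x0 c) x * norm (f' x) powr q) \<in> borel_measurable lebesgue"
      by (rule measurable_completion) measurable
    show "AE x in lebesgue. indicator (ball x0 c) x *\<^sub>R indicator (cball x0 c) x *\<^sub>R norm (f x) powr q = indicator (ball x0 c) x * norm (f' x) powr q"
      using AE_completion[OF ae] by eventually_elim (auto split: split_indicator)
  qed
  then show ?thesis by (subst (asm) integrable_completion) auto
qed

text \<open>U = \<eta> u is an integrable function on the whole space that carries all information
  about u on the ball of radius c, where \<eta> = 1 and its gradient vanishes. The larger radius d
  leaves room for the cutoff.\<close>

lemma W1p_loc_localize:
  fixes \<Omega> :: "'a::euclidean_space set"
  assumes \<Omega>: "open \<Omega>" and u: "W1p_loc p \<Omega> u" and c: "0 \<le> c" "c < d" "cball x0 d \<subseteq> \<Omega>"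
  obtains U G where "U \<in> borel_measurable borel" "G \<in> borel_measurable borel"
    "\<And>h. weak_deriv h U (\<lambda>x. G x \<bullet> h)" 
    "AE x in lborel. x \<in> ball x0 c \<longrightarrow> u x = U x"
    "AE x in lborel. x \<in> ball x0 c \<longrightarrow> weak_gradient \<Omega> u x = G x"
    "integrable lborel (\<lambda>x. indicator (ball x0 c) x * \<bar>U x\<bar> powr p)"
    "integrable lborel (\<lambda>x. indicator (ball x0 c) x * norm (G x) powr p)"
proof -
  let ?K = "cball x0 d"
  define g where "g = weak_gradient \<Omega> u"
  obtain g2 where g2: "has_weak_gradient \<Omega> u g2" "Lp_loc p \<Omega> g2" and Lu: "Lp_loc p \<Omega> u"
    using u unfolding W1p_loc_def by blast
  have hw: "has_weak_gradient \<Omega> u g"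
    unfolding g_def weak_gradient_def by (rule someI[of "has_weak_gradient \<Omega> u" g2, OF g2(1)])
  obtain \<eta> E where \<eta>: "test_function \<Omega> \<eta>" "\<And>x. GDERIV \<eta> x :> E x" "\<And>x. 0 \<le> \<eta> x" "\<And>x. \<eta> x \<le> 1"
    "\<And>x. x \<in> cball x0 c \<Longrightarrow> \<eta> x = 1" "\<And>x. x \<notin> ball x0 d \<Longrightarrow> \<eta> x = 0"
    "\<And>x. norm (E x) \<le> 32 * exp 2 / (d - c)" using cutoff_exists[OF c] by blast
  have \<eta>K: "\<eta> x = 0" "E x = 0" if "x \<notin> ?K" for x
  proof -
    show "\<eta> x = 0" using \<eta>(6)[of x] that by auto
    have "closure {x. \<eta> x \<noteq> 0} \<subseteq> ?K" using \<eta>(6) by (intro closure_minimal) (auto, meson less_imp_le mem_ball)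
    then show "E x = 0" using that by (intro test_functionD(6)[OF \<eta>(1,2)]) auto
  qed
  have E0: "E x = 0" if x: "x \<in> ball x0 c" for x
  proof -
    have "((\<lambda>_. 1) has_derivative (\<lambda>h. h \<bullet> 0)) (at x)" by simp
    then have "(\<eta> has_derivative (\<lambda>h. h \<bullet> 0)) (at x)"
      by (rule has_derivative_transform_within_open[OF _ open_ball x]) (use \<eta>(5) in auto)
    then show ?thesis using GDERIV_unique[OF \<eta>(2)[of x], of 0] unfolding gderiv_def by blast
  qed
  have L: "Lp_loc 1 \<Omega> u" "Lp_loc 1 \<Omega> g" using hw by (auto simp: has_weak_gradient_def)
  obtain u1 where u1: "integrable lborel u1" "AE x in lborel. x \<in> ?K \<longrightarrow> u x = u1 x"
    using Lp_loc_1_borel_version[OF L(1) compact_cball c(3)] by blast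
  obtain g1 where g1: "integrable lborel g1" "AE x in lborel. x \<in> ?K \<longrightarrow> g x = g1 x"
    using Lp_loc_1_borel_version[OF L(2) compact_cball c(3)] by blast
  have [measurable]: "u1 \<in> borel_measurable borel" "g1 \<in> borel_measurable borel" using u1 g1 by auto
  note [measurable] = test_function_measurable[OF \<eta>(1,2)]
  define U where "U x = \<eta> x * u1 x" for x
  define G where "G x = \<eta> x *\<^sub>R g1 x + u1 x *\<^sub>R E x" for x
  have Um: "U \<in> borel_measurable borel" unfolding U_def[abs_def] by measurable
  have Gm: "G \<in> borel_measurable borel" unfolding G_def[abs_def] by measurable
  have wd: "weak_deriv h U (\<lambda>x. G x \<bullet> h)" for h
    unfolding U_def G_def
    by (rule has_weak_gradient_localize[OF hw \<Omega> compact_cball c(3) \<eta>(1,2) \<eta>K u1 g1])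
  have cd: "x \<in> ?K" "x \<in> cball x0 c" if "x \<in> ball x0 c" for x using that c by auto
  have aeU: "AE x in lborel. x \<in> ball x0 c \<longrightarrow> u x = U x"
    using u1(2) by eventually_elim (use cd \<eta>(5) in \<open>auto simp: U_def\<close>)
  have aeG: "AE x in lborel. x \<in> ball x0 c \<longrightarrow> weak_gradient \<Omega> u x = G x"
    using g1(2) by eventually_elim (use cd \<eta>(5) E0 in \<open>auto simp: G_def g_def[symmetric]\<close>)
  \<comment> \<open>Local integrability of the p-th power is assumed of some weak gradient, possibly
    not of the chosen one; uniqueness transfers it.\<close>
  have "AE x in lborel. x \<in> cball x0 c \<longrightarrow> g x = g2 x"
    by (rule weak_gradient_unique_ball[OF hw g2(1) \<Omega> c])
  then have aeG2: "AE x in lborel. x \<in> ball x0 c \<longrightarrow> g2 x = G x"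
    using aeG by eventually_elim (use cd in \<open>auto simp: g_def\<close>)
  have cc: "cball x0 c \<subseteq> \<Omega>" using c by (meson order_trans less_imp_le subset_cball)
  show ?thesis
    using that[OF Um Gm wd aeU aeG] Lp_loc_ball_integrable[OF Lu cc Um aeU] Lp_loc_ball_integrable[OF g2(2) cc Gm aeG2]
    by simp
qed

section \<open>The truncated test function and its gradient\<close>

lemma GDERIV_power:
  assumes "GDERIV \<phi> x :> D"
  shows "GDERIV (\<lambda>x. \<phi> x ^ m) x :> (real m * \<phi> x ^ (m - 1)) *\<^sub>R D"
  by (rule GDERIV_DERIV_compose[OF assms]) (auto intro!: derivative_eq_intros)

lemma test_function_power:
  assumes "test_function S \<phi>" "0 < m"
  shows "test_function S (\<lambda>x. \<phi> x ^ m)"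
proof -
  obtain n where [simp]: "m = Suc n" using assms(2) by (cases m) auto
  have "\<And>k. C_order k \<phi>" using assms(1) by (simp add: test_function_def)
  then have "test_function S (\<lambda>x. \<phi> x * \<phi> x ^ n)" by (intro test_function_mult[OF assms(1)] C_order_power)
  then show ?thesis by simp
qed

lemma weak_deriv_truncated_cutoff:
  assumes w: "weak_deriv h U (\<lambda>x. G x \<bullet> h)" and k: "0 \<le> k" and m: "0 < m"
    and \<phi>: "test_function UNIV \<phi>" "\<And>x. GDERIV \<phi> x :> D x"
  shows "weak_deriv h (\<lambda>x. \<phi> x ^ m * max (U x - k) 0)
     (\<lambda>x. (\<phi> x ^ m *\<^sub>R (indicator {x. k < U x} x *\<^sub>R G x) + (max (U x - k) 0 * (real m * \<phi> x ^ (m - 1))) *\<^sub>R D x) \<bullet> h)"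
proof -
  have "weak_deriv h (\<lambda>x. \<phi> x ^ m * max (U x - k) 0)
     (\<lambda>x. \<phi> x ^ m * (indicator {x. k < U x} x * (G x \<bullet> h)) + max (U x - k) 0 * (((real m * \<phi> x ^ (m - 1)) *\<^sub>R D x) \<bullet> h))"
    by (rule weak_deriv_mult[OF weak_deriv_pos_part[OF w k] test_function_power[OF \<phi>(1) m] GDERIV_power[OF \<phi>(2)]])
  then show ?thesis by (simp add: inner_add_left mult_ac)
qed

lemma integrable_of_weak_deriv:
  assumes w: "\<And>h. weak_deriv h v (\<lambda>x. G x \<bullet> h)"
  shows "integrable lborel G"
proof -
  have "integrable lborel (\<lambda>x. \<Sum>b\<in>Basis. (G x \<bullet> b) *\<^sub>R b)"
    using weak_derivD(2)[OF w] by (intro Bochner_Integration.integrable_sum integrable_scaleR_left) auto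
  then show ?thesis by (simp add: euclidean_representation)
qed

lemma Lp_UNIV_I:
  fixes f :: "'a::euclidean_space \<Rightarrow> 'b::euclidean_space"
  assumes ae: "AE x in lborel. f x = f' x" and [measurable]: "f' \<in> borel_measurable borel"
    and B: "integrable lborel B" "\<And>x. norm (f' x) powr q \<le> B x"
  shows "Lp q UNIV f"
proof -
  have f: "f \<in> borel_measurable lebesgue"
  proof (rule borel_measurable_AE)
    show "f' \<in> borel_measurable lebesgue" by (rule measurable_completion) simp
    show "AE x in lebesgue. f' x = f x" using AE_completion[OF ae] by eventually_elim simp
  qed
  have "integrable lborel (\<lambda>x. norm (f' x) powr q)"
  proof (rule Bochner_Integration.integrable_bound[OF B(1)])
    show "AE x in lborel. norm (norm (f' x) powr q) \<le> norm (B x)"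
      using B(2) by (intro AE_I2) (smt (verit) powr_ge_zero real_norm_def)
  qed measurable
  then have "integrable lebesgue (\<lambda>x. norm (f' x) powr q)" by (subst integrable_completion) auto
  then have "integrable lebesgue (\<lambda>x. norm (f x) powr q)"
  proof (rule integrable_cong_AE_imp)
    show "(\<lambda>x. norm (f x) powr q) \<in> borel_measurable lebesgue"
      using f by measurable
    show "AE x in lebesgue. norm (f' x) powr q = norm (f x) powr q"
      using AE_completion[OF ae] by eventually_elim simp
  qed
  then show ?thesis using f by (simp add: Lp_def lebesgue_on_UNIV_eq)
qed

text \<open>The summand a will be a multiple of minus the nonlocal form, whose sign is unknown; if
  it is negative, dropping it only enlarges the sum.\<close>

lemma ennreal_add_le: "0 \<le> b \<Longrightarrow> ennreal (a + b) \<le> ennreal a + ennreal b"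
  by (cases "0 \<le> a") (auto simp: ennreal_neg ennreal_leI)

text \<open>The gradient of the test function vanishes outside the ball, so it is enough to know a
  representative of the gradient of u inside it.\<close>

lemma local_form_eq:
  fixes \<Omega> :: "'a::euclidean_space set"
  assumes \<Omega>: "open \<Omega>" "ball x0 c \<subseteq> \<Omega>"
    and [measurable]: "G \<in> borel_measurable borel" "H \<in> borel_measurable borel"
    and ae: "AE x in lborel. x \<in> ball x0 c \<longrightarrow> weak_gradient \<Omega> u x = G x" "AE x in lborel. weak_gradient UNIV v x = H x"
    and H: "\<And>x. x \<notin> ball x0 c \<Longrightarrow> H x = 0"
  shows "local_form p \<Omega> u v = (\<integral>x. p_flux p (G x) \<bullet> H x \<partial>lborel)"
proof -
  let ?f = "\<lambda>x. indicator \<Omega> x *\<^sub>R (p_flux p (weak_gradient \<Omega> u x) \<bullet> weak_gradient UNIV v x)"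
  have [measurable]: "(\<lambda>x. p_flux p (G x)) \<in> borel_measurable borel" unfolding p_flux_def by measurable
  have m: "(\<lambda>x. p_flux p (G x) \<bullet> H x) \<in> borel_measurable lebesgue" by (rule measurable_completion) measurable
  have e: "AE x in lborel. p_flux p (G x) \<bullet> H x = ?f x"
    using ae
  proof eventually_elim
    case (elim x)
    then show ?case using H[of x] \<Omega>(2) by (cases "x \<in> ball x0 c") auto
  qed
  have "local_form p \<Omega> u v = (\<integral>x. ?f x \<partial>lebesgue)"
    unfolding local_form_def using \<Omega> by (intro integral_restrict_space) auto
  also have "\<dots> = (\<integral>x. p_flux p (G x) \<bullet> H x \<partial>lebesgue)"
  proof (rule integral_cong_AE)
    show "?f \<in> borel_measurable lebesgue" by (rule borel_measurable_AE[OF m AE_completion[OF e]])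
    show "AE x in lebesgue. ?f x = p_flux p (G x) \<bullet> H x" using AE_completion[OF e] by eventually_elim simp
  qed (rule m)
  also have "\<dots> = (\<integral>x. p_flux p (G x) \<bullet> H x \<partial>lborel)" by (intro integral_completion) measurable
  finally show ?thesis .
qed

text \<open>The Caccioppoli and the Faber-Krahn inequality in one estimate. Testing with v =
  \<phi>^m (u - k)_+ bounds \<alpha> times the local form by minus the nonlocal form. Up to a cutoff
  term the local form controls the integral of \<phi>^m |\<nabla>u|^p over {u > k}, hence the
  gradient of v, and Faber-Krahn turns that into the p-norm of v at the price of R^p.\<close>

lemma subsolution_step:
  fixes \<mu> :: "real measure"
  assumes p: "1 < p" "p \<le> real m"
    and mu: "sets \<mu> = sets (restrict_space borel {0..1})" "finite_measure \<mu>" and alpha: "0 < measure \<mu> {1}"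
  obtains K where "0 < K"
    "\<And>(\<Omega> :: 'a::euclidean_space set) u u' \<phi> D x0 b c d \<rho> k L R.
      open \<Omega> \<Longrightarrow> weak_subsolution \<mu> p \<Omega> u \<Longrightarrow> u' \<in> borel_measurable borel \<Longrightarrow> (AE x in lborel. u x = u' x) \<Longrightarrow>
      0 < b \<Longrightarrow> b < c \<Longrightarrow> c < d \<Longrightarrow> c \<le> 1 \<Longrightarrow> cball x0 d \<subseteq> \<Omega> \<Longrightarrow> \<rho> \<le> c \<Longrightarrow> 0 \<le> k \<Longrightarrow>
      test_function UNIV \<phi> \<Longrightarrow> (\<And>x. GDERIV \<phi> x :> D x) \<Longrightarrow> (\<And>x. 0 \<le> \<phi> x) \<Longrightarrow> (\<And>x. \<phi> x \<le> 1) \<Longrightarrow>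
      (\<And>x. x \<notin> ball x0 b \<Longrightarrow> \<phi> x = 0) \<Longrightarrow> (\<And>x. norm (D x) \<le> L) \<Longrightarrow> 0 < R \<Longrightarrow>
      2 * emeasure lborel {x \<in> ball x0 b. k < u' x} \<le> emeasure lborel (ball (0::'a) R) \<Longrightarrow>
      (\<integral>\<^sup>+x. ennreal ((\<phi> x ^ m * max (u' x - k) 0) powr p) \<partial>lborel) \<le>
        ennreal (K * R powr p) * (ennreal (L powr p) * (\<integral>\<^sup>+x. ennreal (max (u' x - k) 0 powr p) * indicator (ball x0 c) x \<partial>lborel)
          + ennreal (2 * (c / (c - b)) powr (real DIM('a) + p)) * ((\<integral>\<^sup>+x. ennreal (\<phi> x ^ m * max (u' x - k) 0) \<partial>lborel)
        * tail_integral \<mu> p u x0 \<rho>))"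
proof -
  define \<alpha> where "\<alpha> = measure \<mu> {1}"
  have \<alpha>: "0 < \<alpha>" using alpha by (simp add: \<alpha>_def)
  have m: "0 < m" using p by (cases m) auto
  then have zm: "(0::real) ^ m = 0" by simp
  show ?thesis
  proof (rule nonlocal_form_lower[where 'a = 'a, OF p mu])
    fix Kn assume Kn: "0 < Kn"
      and nl: "\<And>(u :: 'a \<Rightarrow> real) u' \<phi> x0 b c \<rho> k L.
      u' \<in> borel_measurable borel \<Longrightarrow> (AE x in lborel. u x = u' x) \<Longrightarrow> 0 \<le> b \<Longrightarrow> b < c \<Longrightarrow> c \<le> 1 \<Longrightarrow> \<rho> \<le> c \<Longrightarrow> 0 \<le> k \<Longrightarrow>
      \<phi> \<in> borel_measurable borel \<Longrightarrow> (\<And>x. 0 \<le> \<phi> x) \<Longrightarrow> (\<And>x. \<phi> x \<le> 1) \<Longrightarrow> (\<And>x. x \<notin> ball x0 b \<Longrightarrow> \<phi> x = 0) \<Longrightarrow>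
      (\<And>x y. \<bar>\<phi> x - \<phi> y\<bar> \<le> L * norm (x - y)) \<Longrightarrow> 0 \<le> L \<Longrightarrow>
      ennreal (- nonlocal_form \<mu> p u (\<lambda>x. \<phi> x ^ m * max (u x - k) 0)) \<le>
        ennreal (Kn * L powr p) * (\<integral>\<^sup>+x. ennreal (max (u' x - k) 0 powr p) * indicator (ball x0 c) x \<partial>lborel)
        + ennreal (2 * (c / (c - b)) powr (real DIM('a) + p)) * ((\<integral>\<^sup>+x. ennreal (\<phi> x ^ m * max (u' x - k) 0) \<partial>lborel)
          * tail_integral \<mu> p u x0 \<rho>)"
    \<comment> \<open>Here 2/\<alpha> comes from dividing by \<alpha> and by the half that is kept
      of the gradient term, \<open>Kn + 1\<close> covers the coefficient \<open>Kn\<close> of the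
      energy and the coefficient 1 of the tail, and 2 (2m)^p collects the gradient of the
      cutoff.\<close>
    define K' where "K' = 2 powr p * (2 / \<alpha> * (Kn + 1) + 2 * (2 * real m) powr p)"
    have a1: "2 / \<alpha> * Kn \<le> 2 / \<alpha> * (Kn + 1)" "2 / \<alpha> * 1 \<le> 2 / \<alpha> * (Kn + 1)"
      using \<alpha> Kn by (intro mult_left_mono; simp)+
    have "2 / \<alpha> * Kn + 2 * (2 * real m) powr p \<le> 2 / \<alpha> * (Kn + 1) + 2 * (2 * real m) powr p"
      "2 / \<alpha> \<le> 2 / \<alpha> * (Kn + 1) + 2 * (2 * real m) powr p"
      using a1 powr_ge_zero[of "2 * real m" p] by linarith+
    then have KK: "2 powr p * (2 / \<alpha> * Kn + 2 * (2 * real m) powr p) \<le> K'" "2 powr p * (2 / \<alpha>) \<le> K'"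
      unfolding K'_def by (intro mult_left_mono; simp)+
    have K': "0 < K'" using \<alpha> Kn by (auto simp: K'_def intro!: mult_pos_pos add_pos_nonneg)
    show ?thesis
    proof (rule that[of "2 * K'"])
      show "0 < 2 * K'" using K' by simp
      fix \<Omega> :: "'a set" and u u' \<phi> :: "'a \<Rightarrow> real" and D :: "'a \<Rightarrow> 'a" and x0 :: 'a and b c d \<rho> k L R :: real
      assume \<Omega>: "open \<Omega>" and sub: "weak_subsolution \<mu> p \<Omega> u" and u'[measurable]: "u' \<in> borel_measurable borel"
        and ae: "AE x in lborel. u x = u' x"
        and bc: "0 < b" "b < c" and cd: "c < d" and c1: "c \<le> 1" and dO: "cball x0 d \<subseteq> \<Omega>" and \<rho>: "\<rho> \<le> c" and k: "0 \<le> k"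
        and \<phi>: "test_function UNIV \<phi>" and D: "\<And>x. GDERIV \<phi> x :> D x" and \<phi>0: "\<And>x. 0 \<le> \<phi> x" and \<phi>1: "\<And>x. \<phi> x \<le> 1"
        and \<phi>b: "\<And>x. x \<notin> ball x0 b \<Longrightarrow> \<phi> x = 0" and L: "\<And>x. norm (D x) \<le> L" and R: "0 < R"
        and small: "2 * emeasure lborel {x \<in> ball x0 b. k < u' x} \<le> emeasure lborel (ball (0::'a) R)"
      note [measurable] = test_function_measurable[OF \<phi> D]
      have [measurable]: "ball x0 c \<in> sets borel" "ball x0 b \<in> sets borel" by simp_all
      have L0: "0 \<le> L" using L[of x0] norm_ge_zero order_trans by blast
      have D0: "D x = 0" if "x \<notin> ball x0 c" for x
      proof -
        have "closure {x. \<phi> x \<noteq> 0} \<subseteq> cball x0 b" using \<phi>b by (intro closure_minimal) (auto, meson less_imp_le mem_ball)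
        then show ?thesis using that bc by (intro test_functionD(6)[OF \<phi> D]) auto
      qed
      have bb: "x \<in> ball x0 c" if "x \<in> ball x0 b" for x using that bc by auto
      have W1: "W1p_loc p \<Omega> u" using sub by (simp add: weak_subsolution_def)
      have c0: "0 \<le> c" using bc by simp
      obtain U G where UG[measurable]: "U \<in> borel_measurable borel" "G \<in> borel_measurable borel"
        and wd: "\<And>h. weak_deriv h U (\<lambda>x. G x \<bullet> h)"
        and aeU: "AE x in lborel. x \<in> ball x0 c \<longrightarrow> u x = U x"
        and aeG: "AE x in lborel. x \<in> ball x0 c \<longrightarrow> weak_gradient \<Omega> u x = G x"
        and iU: "integrable lborel (\<lambda>x. indicator (ball x0 c) x * \<bar>U x\<bar> powr p)"
        and iG: "integrable lborel (\<lambda>x. indicator (ball x0 c) x * norm (G x) powr p)"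
        using W1p_loc_localize[OF \<Omega> W1 c0 cd dO] by blast
      define w where "w x = max (U x - k) 0" for x
      define G1 where "G1 x = indicator {x. k < U x} x *\<^sub>R G x" for x
      define V where "V x = \<phi> x ^ m * w x" for x
      define H where "H x = \<phi> x ^ m *\<^sub>R G1 x + (w x * (real m * \<phi> x ^ (m - 1))) *\<^sub>R D x" for x
      have [measurable]: "w \<in> borel_measurable borel" unfolding w_def[abs_def] by measurable
      have [measurable]: "G1 \<in> borel_measurable borel" unfolding G1_def[abs_def] by measurable
      have Vm[measurable]: "V \<in> borel_measurable borel" unfolding V_def[abs_def] by measurable
      have Hm[measurable]: "H \<in> borel_measurable borel" unfolding H_def[abs_def] by measurable
      have w0: "0 \<le> w x" for x by (simp add: w_def)
      have wV: "weak_deriv h V (\<lambda>x. H x \<bullet> h)" for h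
        unfolding V_def H_def w_def G1_def by (rule weak_deriv_truncated_cutoff[OF wd k m \<phi> D])
      have Vb: "V x = 0" if "x \<notin> ball x0 b" for x using \<phi>b[OF that] m by (simp add: V_def)
      have Hc: "H x = 0" if "x \<notin> ball x0 c" for x
      proof -
        have "\<phi> x = 0" using \<phi>b bb that by blast
        then show ?thesis using D0[OF that] m by (simp add: H_def)
      qed
      define v where "v x = \<phi> x ^ m * max (u x - k) 0" for x
      have aev: "AE x in lborel. v x = V x"
        using aeU
      proof eventually_elim
        case (elim x)
        then show ?case using \<phi>b[of x] bb[of x] m by (cases "x \<in> ball x0 b") (auto simp: v_def V_def w_def)
      qed
      have hw: "has_weak_gradient UNIV v H"
        by (rule has_weak_gradient_UNIV_I[OF wV integrable_of_weak_deriv[OF wV] aev])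
      have aeH: "AE x in lborel. weak_gradient UNIV v x = H x" by (rule weak_gradient_UNIV_AE[OF hw])
      have w_le: "indicator (ball x0 c) x * w x powr p \<le> indicator (ball x0 c) x * \<bar>U x\<bar> powr p" for x
        using p k by (intro mult_left_mono powr_mono2) (auto simp: w_def)
      have iw: "integrable lborel (\<lambda>x. indicator (ball x0 c) x * w x powr p)"
        by (rule Bochner_Integration.integrable_bound[OF iU]) (use w_le in auto)
      have G1_le: "norm (G1 x) \<le> norm (G x)" for x by (simp add: G1_def indicator_def)
      have \<phi>m: "\<phi> x ^ m \<le> indicator (ball x0 c) x" for x
      proof (cases "x \<in> ball x0 b")
        case True
        then show ?thesis using bb[OF True] \<phi>0[of x] \<phi>1[of x] by (simp add: power_le_one)
      next
        case False
        then show ?thesis using \<phi>b[OF False] by (simp add: zm)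
      qed
      have iP: "integrable lborel (\<lambda>x. \<phi> x ^ m * norm (G1 x) powr p)"
      proof (rule Bochner_Integration.integrable_bound[OF iG])
        show "AE x in lborel. norm (\<phi> x ^ m * norm (G1 x) powr p) \<le> norm (indicator (ball x0 c) x * norm (G x) powr p)"
        proof (rule AE_I2)
          fix x
          note \<phi>m[of x]
          then have "\<phi> x ^ m * norm (G1 x) powr p \<le> indicator (ball x0 c) x * norm (G x) powr p"
            using G1_le[of x] p by (intro mult_mono powr_mono2) auto
          then show "norm (\<phi> x ^ m * norm (G1 x) powr p) \<le> norm (indicator (ball x0 c) x * norm (G x) powr p)"
            using \<phi>0 by simp
        qed
      qed measurable
      have mwD: "(t * w x * norm (D x)) powr p \<le> (t * L) powr p * (indicator (ball x0 c) x * w x powr p)" if "0 \<le> t" for t x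
      proof (cases "x \<in> ball x0 c")
        case True
        have "(t * w x * norm (D x)) powr p \<le> (t * w x * L) powr p"
          using p that w0 L by (intro powr_mono2 mult_left_mono) auto
        then show ?thesis using True that L0 w0 by (simp add: powr_mult mult_ac)
      qed (use D0 in simp)
      have H_le: "norm (H x) powr p \<le> 2 powr p * (\<phi> x ^ m * norm (G1 x) powr p + (real m * L) powr p * (indicator (ball x0 c) x * w x powr p))" for x
      proof -
        have "norm (H x) powr p \<le> 2 powr p * (\<phi> x ^ m * norm (G1 x) powr p + (real m * w x * norm (D x)) powr p)"
          unfolding H_def by (rule norm_cutoff_gradient_powr[OF p(1) \<phi>0 \<phi>1 w0])
        also have "\<dots> \<le> 2 powr p * (\<phi> x ^ m * norm (G1 x) powr p + (real m * L) powr p * (indicator (ball x0 c) x * w x powr p))"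
          by (intro mult_left_mono add_left_mono mwD) auto
        finally show ?thesis .
      qed
      have iHb: "integrable lborel (\<lambda>x. 2 powr p * (\<phi> x ^ m * norm (G1 x) powr p + (real m * L) powr p * (indicator (ball x0 c) x * w x powr p)))"
        by (intro integrable_mult_right Bochner_Integration.integrable_add iP iw)
      have "W1p_zero p (ball x0 b) v"
        unfolding W1p_zero_def W1p_def
      proof (intro conjI exI[of _ H] hw)
        show "Lp p UNIV v"
        proof (rule Lp_UNIV_I[OF aev Vm iw])
          fix x
          note \<phi>m[of x]
          then have "V x \<le> indicator (ball x0 c) x * w x" unfolding V_def by (intro mult_right_mono w0)
          then have "norm (V x) powr p \<le> (indicator (ball x0 c) x * w x) powr p"
            using p \<phi>0 w0 by (intro powr_mono2) (auto simp: V_def abs_mult)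
          then show "norm (V x) powr p \<le> indicator (ball x0 c) x * w x powr p"
            using p by (cases "x \<in> ball x0 c") auto
        qed
        show "Lp p UNIV H" by (rule Lp_UNIV_I[OF _ Hm iHb H_le]) simp
        show "AE x in lebesgue. x \<notin> ball x0 b \<longrightarrow> v x = 0" using \<phi>b m by (intro AE_I2) (auto simp: v_def)
      qed
      moreover have "bounded_domain (ball x0 b)" using bc by (simp add: bounded_domain_def)
      moreover have "closure (ball x0 b) \<subseteq> \<Omega>" using bc cd dO by (auto simp: subset_eq)
      moreover have "AE x in lebesgue. 0 \<le> v x" using \<phi>0 by (intro AE_I2) (simp add: v_def)
      ultimately have main: "nonlocal_form \<mu> p u v + \<alpha> * local_form p \<Omega> u v \<le> 0"
        using sub unfolding weak_subsolution_def \<alpha>_def by blast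
      have cO: "ball x0 c \<subseteq> \<Omega>" using cd dO by (auto simp: subset_eq)
      have loc: "local_form p \<Omega> u v = (\<integral>x. p_flux p (G x) \<bullet> H x \<partial>lborel)"
        by (rule local_form_eq[OF \<Omega> cO UG(2) Hm aeG aeH Hc])
      \<comment> \<open>Where U \<le> k the gradient of the test function is 0, so the gradient of U
        may be replaced by its truncation \<open>G1\<close>, the one that occurs in the
        energy.\<close>
      have GH: "p_flux p (G x) \<bullet> H x = p_flux p (G1 x) \<bullet> H x" for x
      proof (cases "k < U x")
        case False
        then have "H x = 0" by (simp add: H_def G1_def w_def)
        then show ?thesis by simp
      qed (simp add: G1_def)
      define P where "P = (\<integral>x. \<phi> x ^ m * norm (G1 x) powr p \<partial>lborel)"
      define Wr where "Wr = (\<integral>x. indicator (ball x0 c) x * w x powr p \<partial>lborel)"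
      have P0: "0 \<le> P" unfolding P_def using \<phi>0 by (intro Bochner_Integration.integral_nonneg) auto
      have Wr0: "0 \<le> Wr" unfolding Wr_def by (intro Bochner_Integration.integral_nonneg) auto
      have iGH: "integrable lborel (\<lambda>x. p_flux p (G x) \<bullet> H x)"
      proof (rule Bochner_Integration.integrable_bound)
        show "integrable lborel (\<lambda>x. indicator (ball x0 c) x * norm (G x) powr p
          + 2 powr p * (indicator (ball x0 c) x * norm (G x) powr p + (real m * L) powr p * (indicator (ball x0 c) x * w x powr p)))"
          by (intro integrable_mult_right Bochner_Integration.integrable_add iG iw)
        show "(\<lambda>x. p_flux p (G x) \<bullet> H x) \<in> borel_measurable lborel" unfolding p_flux_def by measurable
        show "AE x in lborel. norm (p_flux p (G x) \<bullet> H x) \<le> norm (indicator (ball x0 c) x * norm (G x) powr p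
          + 2 powr p * (indicator (ball x0 c) x * norm (G x) powr p + (real m * L) powr p * (indicator (ball x0 c) x * w x powr p)))"
        proof (rule AE_I2)
          fix x
          show "norm (p_flux p (G x) \<bullet> H x) \<le> norm (indicator (ball x0 c) x * norm (G x) powr p
            + 2 powr p * (indicator (ball x0 c) x * norm (G x) powr p + (real m * L) powr p * (indicator (ball x0 c) x * w x powr p)))"
          proof (cases "x \<in> ball x0 c")
            case True
            have "\<bar>p_flux p (G x) \<bullet> H x\<bar> \<le> norm (G1 x) powr p + 2 powr p * (norm (G1 x) powr p + (real m * w x * norm (D x)) powr p)"
              unfolding GH unfolding H_def by (rule abs_p_flux_inner_le[OF p(1) \<phi>0 \<phi>1 w0])
            also have "\<dots> \<le> norm (G x) powr p + 2 powr p * (norm (G x) powr p + (real m * L) powr p * (indicator (ball x0 c) x * w x powr p))"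
              using p G1_le[of x] by (intro add_mono mult_left_mono mwD powr_mono2) auto
            finally show ?thesis using True by simp
          qed (simp add: Hc)
        qed
      qed
      have "1/2 * P - 1/2 * ((2 * real m * L) powr p * Wr) = (\<integral>x. 1/2 * (\<phi> x ^ m * norm (G1 x) powr p) - 1/2 * ((2 * real m * L) powr p * (indicator (ball x0 c) x * w x powr p)) \<partial>lborel)"
        unfolding P_def Wr_def using iP iw by simp
      also have "\<dots> \<le> (\<integral>x. p_flux p (G x) \<bullet> H x \<partial>lborel)"
      proof (rule integral_mono[OF _ iGH])
        show "integrable lborel (\<lambda>x. 1/2 * (\<phi> x ^ m * norm (G1 x) powr p) - 1/2 * ((2 * real m * L) powr p * (indicator (ball x0 c) x * w x powr p)))"
          by (intro integrable_mult_right Bochner_Integration.integrable_diff iP iw)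
        fix x
        have "1/2 * (\<phi> x ^ m * norm (G1 x) powr p) - 1/2 * (2 * real m * w x * norm (D x)) powr p \<le> p_flux p (G x) \<bullet> H x"
          unfolding GH unfolding H_def by (rule p_flux_local_lower[OF p \<phi>0 \<phi>1 w0])
        then show "1/2 * (\<phi> x ^ m * norm (G1 x) powr p) - 1/2 * ((2 * real m * L) powr p * (indicator (ball x0 c) x * w x powr p)) \<le> p_flux p (G x) \<bullet> H x"
          using mwD[of "2 * real m" x] by simp
      qed
      finally have loc_ge: "1/2 * P - 1/2 * ((2 * real m * L) powr p * Wr) \<le> local_form p \<Omega> u v" unfolding loc .
      \<comment> \<open>Multiply the lower bound of the local form by \<alpha> and insert the
        subsolution inequality; P and Wr are real, so P can be isolated.\<close>
      have P_le: "P \<le> 2 / \<alpha> * (- nonlocal_form \<mu> p u v) + (2 * real m * L) powr p * Wr"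
      proof -
        have "\<alpha> * (1/2 * P - 1/2 * ((2 * real m * L) powr p * Wr)) \<le> \<alpha> * local_form p \<Omega> u v"
          using loc_ge \<alpha> by (intro mult_left_mono) auto
        also have "\<dots> \<le> - nonlocal_form \<mu> p u v" using main by simp
        finally show ?thesis using \<alpha> by (simp add: field_simps)
      qed
      define W where "W = (\<integral>\<^sup>+x. ennreal (max (u' x - k) 0 powr p) * indicator (ball x0 c) x \<partial>lborel)"
      define Z where "Z = ennreal (2 * (c / (c - b)) powr (real DIM('a) + p)) * ((\<integral>\<^sup>+x. ennreal (\<phi> x ^ m * max (u' x - k) 0) \<partial>lborel)
          * tail_integral \<mu> p u x0 \<rho>)"
      have aeUu: "AE x in lborel. x \<in> ball x0 c \<longrightarrow> U x = u' x" using aeU ae by eventually_elim auto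
      have W_eq: "W = ennreal Wr"
      proof -
        have "W = (\<integral>\<^sup>+x. ennreal (indicator (ball x0 c) x * w x powr p) \<partial>lborel)"
          unfolding W_def by (rule nn_integral_cong_AE) (use aeUu in \<open>eventually_elim, auto simp: w_def split: split_indicator\<close>)
        also have "\<dots> = ennreal Wr" unfolding Wr_def using iw by (intro nn_integral_eq_integral) auto
        finally show ?thesis .
      qed
      have nlX: "ennreal (- nonlocal_form \<mu> p u v) \<le> ennreal (Kn * L powr p) * W + Z"
        unfolding W_def Z_def v_def
        by (rule nl[OF u' ae _ bc(2) c1 \<rho> k _ \<phi>0 \<phi>1 \<phi>b test_function_Lipschitz[OF D L] L0]) (use bc in auto)
      have "(\<integral>\<^sup>+x. ennreal (norm (H x) powr p) \<partial>lborel) \<le>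
        (\<integral>\<^sup>+x. ennreal (2 powr p * (\<phi> x ^ m * norm (G1 x) powr p + (real m * L) powr p * (indicator (ball x0 c) x * w x powr p))) \<partial>lborel)"
        by (intro nn_integral_mono ennreal_leI H_le)
      also have "\<dots> = ennreal (2 powr p * (P + (real m * L) powr p * Wr))"
        using iHb iP iw \<phi>0 by (subst nn_integral_eq_integral) (auto simp: P_def Wr_def)
      \<comment> \<open>Real arithmetic comes before the splitting in \<open>ennreal\<close>,
        because minus the nonlocal form may be negative.\<close>
      also have "\<dots> \<le> ennreal (2 powr p * (2 / \<alpha>) * (- nonlocal_form \<mu> p u v) + 2 powr p * ((2 * real m * L) powr p * Wr + (real m * L) powr p * Wr))"
      proof (rule ennreal_leI)
        have "2 powr p * (P + (real m * L) powr p * Wr) \<le> 2 powr p * ((2 / \<alpha> * (- nonlocal_form \<mu> p u v) + (2 * real m * L) powr p * Wr) + (real m * L) powr p * Wr)"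
          using P_le by (intro mult_left_mono) auto
        then show "2 powr p * (P + (real m * L) powr p * Wr) \<le> 2 powr p * (2 / \<alpha>) * (- nonlocal_form \<mu> p u v) + 2 powr p * ((2 * real m * L) powr p * Wr + (real m * L) powr p * Wr)"
          by (simp add: algebra_simps)
      qed
      also have "\<dots> \<le> ennreal (2 powr p * (2 / \<alpha>) * (- nonlocal_form \<mu> p u v)) + ennreal (2 powr p * ((2 * real m * L) powr p * Wr + (real m * L) powr p * Wr))"
        using Wr0 by (intro ennreal_add_le) auto
      also have "\<dots> \<le> ennreal (2 powr p * (2 / \<alpha>)) * (ennreal (Kn * L powr p) * W + Z) + ennreal (2 powr p * (2 * (2 * real m) powr p) * L powr p) * W"
      proof (rule add_mono)
        have "ennreal (2 powr p * (2 / \<alpha>) * (- nonlocal_form \<mu> p u v)) = ennreal (2 powr p * (2 / \<alpha>)) * ennreal (- nonlocal_form \<mu> p u v)"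
          using \<alpha> by (intro ennreal_mult') auto
        also have "\<dots> \<le> ennreal (2 powr p * (2 / \<alpha>)) * (ennreal (Kn * L powr p) * W + Z)" by (intro mult_left_mono nlX) simp
        finally show "ennreal (2 powr p * (2 / \<alpha>) * (- nonlocal_form \<mu> p u v)) \<le> ennreal (2 powr p * (2 / \<alpha>)) * (ennreal (Kn * L powr p) * W + Z)" .
        have "(real m * L) powr p \<le> (2 * real m * L) powr p" using L0 p by (intro powr_mono2) auto
        then have "(2 * real m * L) powr p * Wr + (real m * L) powr p * Wr \<le> (2 * real m * L) powr p * Wr + (2 * real m * L) powr p * Wr"
          using Wr0 by (intro add_left_mono mult_right_mono) auto
        also have "\<dots> = 2 * (2 * real m) powr p * L powr p * Wr" using L0 by (simp add: powr_mult)
        finally have "ennreal (2 powr p * ((2 * real m * L) powr p * Wr + (real m * L) powr p * Wr)) \<le> ennreal (2 powr p * (2 * (2 * real m) powr p * L powr p * Wr))"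
          by (intro ennreal_leI mult_left_mono) auto
        also have "\<dots> = ennreal (2 powr p * (2 * (2 * real m) powr p) * L powr p) * W"
          unfolding W_eq using Wr0 by (simp add: ennreal_mult[symmetric] mult_ac)
        finally show "ennreal (2 powr p * ((2 * real m * L) powr p * Wr + (real m * L) powr p * Wr)) \<le> ennreal (2 powr p * (2 * (2 * real m) powr p) * L powr p) * W" .
      qed
      also have "\<dots> = ennreal (2 powr p * (2 / \<alpha> * Kn + 2 * (2 * real m) powr p)) * (ennreal (L powr p) * W) + ennreal (2 powr p * (2 / \<alpha>)) * Z"
        using \<alpha> Kn by (simp add: distrib_left ennreal_mult[symmetric] ennreal_plus[symmetric] mult.assoc[symmetric] distrib_right[symmetric] del: ennreal_plus)
          (simp add: algebra_simps)
      also have "\<dots> \<le> ennreal K' * (ennreal (L powr p) * W) + ennreal K' * Z"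
        by (intro add_mono mult_right_mono ennreal_leI KK) auto
      also have "\<dots> = ennreal K' * (ennreal (L powr p) * W + Z)" by (simp add: distrib_left)
      finally have HX: "(\<integral>\<^sup>+x. ennreal (norm (H x) powr p) \<partial>lborel) \<le> ennreal K' * (ennreal (L powr p) * W + Z)" .
      \<comment> \<open>The test function lives in the part of the ball of radius b where u' exceeds
        k, whose measure is at most half that of the ball of radius R.\<close>
      have "emeasure lborel {x. V x \<noteq> 0} \<le> emeasure lborel {x \<in> ball x0 b. k < u' x}"
      proof (rule emeasure_mono_AE)
        show "AE x in lborel. x \<in> {x. V x \<noteq> 0} \<longrightarrow> x \<in> {x \<in> ball x0 b. k < u' x}"
          using aeUu
        proof eventually_elim
          case (elim x)
          show ?case
          proof
            assume "x \<in> {x. V x \<noteq> 0}"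
            then have x: "V x \<noteq> 0" by simp
            then have xb: "x \<in> ball x0 b" using Vb by blast
            moreover have "k < U x" using x by (auto simp: V_def w_def max_def split: if_splits)
            ultimately show "x \<in> {x \<in> ball x0 b. k < u' x}" using elim bb[OF xb] by auto
          qed
        qed
        show "{x \<in> ball x0 b. k < u' x} \<in> sets lborel" by simp
      qed
      then have "2 * emeasure lborel {x. V x \<noteq> 0} \<le> 2 * emeasure lborel {x \<in> ball x0 b. k < u' x}" by (intro mult_left_mono) auto
      then have "(\<integral>\<^sup>+x. ennreal (\<bar>V x\<bar> powr p) \<partial>lborel) \<le> ennreal (2 * R powr p) * (\<integral>\<^sup>+x. ennreal (norm (H x) powr p) \<partial>lborel)"
        using small by (intro Faber_Krahn[OF p(1) wV Hm R]) (rule order_trans)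
      also have "\<dots> \<le> ennreal (2 * R powr p) * (ennreal K' * (ennreal (L powr p) * W + Z))"
        by (intro mult_left_mono HX) simp
      also have "\<dots> = ennreal (2 * K' * R powr p) * (ennreal (L powr p) * W + Z)"
        using K' by (simp add: mult.assoc[symmetric] ennreal_mult[symmetric]) (simp add: mult_ac)
      finally have "(\<integral>\<^sup>+x. ennreal (\<bar>V x\<bar> powr p) \<partial>lborel) \<le> ennreal (2 * K' * R powr p) * (ennreal (L powr p) * W + Z)" .
      moreover have "(\<integral>\<^sup>+x. ennreal (\<bar>V x\<bar> powr p) \<partial>lborel) = (\<integral>\<^sup>+x. ennreal ((\<phi> x ^ m * max (u' x - k) 0) powr p) \<partial>lborel)"
      proof (rule nn_integral_cong_AE)
        show "AE x in lborel. ennreal (\<bar>V x\<bar> powr p) = ennreal ((\<phi> x ^ m * max (u' x - k) 0) powr p)"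
          using aeUu
        proof eventually_elim
          case (elim x)
          then show ?case using \<phi>b[of x] bb[of x] \<phi>0[of x] by (cases "x \<in> ball x0 b") (auto simp: V_def w_def abs_mult zm)
        qed
      qed
      ultimately show "(\<integral>\<^sup>+x. ennreal ((\<phi> x ^ m * max (u' x - k) 0) powr p) \<partial>lborel) \<le>
          ennreal (2 * K' * R powr p) * (ennreal (L powr p) * (\<integral>\<^sup>+x. ennreal (max (u' x - k) 0 powr p) * indicator (ball x0 c) x \<partial>lborel)
            + ennreal (2 * (c / (c - b)) powr (real DIM('a) + p)) * ((\<integral>\<^sup>+x. ennreal (\<phi> x ^ m * max (u' x - k) 0) \<partial>lborel)
          * tail_integral \<mu> p u x0 \<rho>))"
        by (simp only: W_def Z_def)
    qed
  qed
qed

section \<open>The iteration\<close>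

text \<open>One step in scale-free form, with X = 2^j and the energy measured by a = A / (K0^p r^N).
  All powers of r cancel, since (r^N)^\<kappa> = r^p compensates the r^(-p) of the cutoff and of the
  tail. The bound \<delta> t \<le> K0 gives t^(p-1) \<le> K0^(p-1) \<delta>^(1-p), the source of the
  power of \<delta>. \<open>Y\<close> is a common majorant of the cutoff and tail contributions; its
  exponent N + 2p of X collects N + p from \<theta> and at most p from the level gap h.\<close>

lemma De_Giorgi_step_algebra:
  fixes A K K0 r \<delta> t V N p X h L \<theta> tt \<kappa> Q1 :: real
  assumes p: "1 < p" and N: "0 < N" and pos: "0 \<le> A" "0 < K" "0 < K0" "0 < r" "0 < V" and \<delta>: "0 < \<delta>" "\<delta> \<le> 1"
    and t: "0 \<le> t" "\<delta> * t \<le> K0" and X: "1 \<le> X" and h: "h = K0 / (2 * X)" and L: "L = 512 * exp 2 * X / r"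
    and \<theta>: "0 < \<theta>" "\<theta> \<le> 12 * X" and tt: "tt = t powr (p - 1) / (r / 2) powr p" and \<kappa>: "\<kappa> = p / N"
    and Q1: "Q1 = (512 * exp 2) powr p + 2 * 12 powr (N + p) * 2 powr (p - 1) * 2 powr p"
  shows "K * (2 * A / (h powr p * V)) powr \<kappa> * (L powr p * A + 2 * \<theta> powr (N + p) * (A / h powr (p - 1) * tt))
    \<le> (K0 powr p * r powr N) * (K * (2 * 2 powr p / V) powr \<kappa> * Q1 * \<delta> powr (1 - p) * X powr (p * \<kappa> + N + 2 * p) * (A / (K0 powr p * r powr N)) powr (1 + \<kappa>))"
proof (cases "A = 0")
  case False
  then have A: "0 < A" using pos by simp
  define Y where "Y = X powr (N + 2 * p) * \<delta> powr (1 - p) / r powr p"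
  have Y0: "0 \<le> Y" by (simp add: Y_def)
  have d1: "1 \<le> \<delta> powr (1 - p)"
    using powr_mono'[of "1 - p" 0 \<delta>] \<delta> p by simp
  have X1: "X powr a \<le> X powr b" if "a \<le> b" for a b using X that by (intro powr_mono) auto
  have s1: "L powr p \<le> (512 * exp 2) powr p * Y"
  proof -
    have "L powr p = (512 * exp 2) powr p * (X powr p / r powr p)"
      unfolding L using X pos by (simp add: powr_mult powr_divide)
    also have "X powr p / r powr p \<le> (X powr (N + 2 * p) * \<delta> powr (1 - p)) / r powr p"
      using X1[of p "N + 2 * p"] N p d1 mult_mono[of "X powr p" "X powr (N + 2 * p)" 1 "\<delta> powr (1 - p)"]
      by (intro divide_right_mono) auto
    finally show ?thesis by (simp add: Y_def)
  qed
  have s2: "\<theta> powr (N + p) \<le> 12 powr (N + p) * X powr (N + p)"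
    using powr_mono2[of "N + p" \<theta> "12 * X"] \<theta> p N X by (simp add: powr_mult)
  have s3: "tt / h powr (p - 1) \<le> 2 powr (p - 1) * 2 powr p * (X powr p * \<delta> powr (1 - p) / r powr p)"
  proof -
    have "t powr (p - 1) \<le> (K0 / \<delta>) powr (p - 1)"
      using t \<delta> p by (intro powr_mono2) (auto simp: field_simps)
    also have "\<dots> = K0 powr (p - 1) * \<delta> powr (1 - p)"
      using pos \<delta> powr_minus_divide[of \<delta> "p - 1"] by (simp add: powr_divide)
    finally have "tt \<le> K0 powr (p - 1) * \<delta> powr (1 - p) / (r / 2) powr p"
      unfolding tt by (intro divide_right_mono) auto
    also have "(r / 2) powr p = r powr p / 2 powr p" using pos by (simp add: powr_divide)
    finally have 1: "tt \<le> K0 powr (p - 1) * \<delta> powr (1 - p) * 2 powr p / r powr p" by simp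
    have h1: "h powr (p - 1) = K0 powr (p - 1) / (2 powr (p - 1) * X powr (p - 1))"
      unfolding h using pos X by (simp add: powr_divide powr_mult)
    have "tt / h powr (p - 1) \<le> (K0 powr (p - 1) * \<delta> powr (1 - p) * 2 powr p / r powr p) / h powr (p - 1)"
      by (intro divide_right_mono 1) auto
    also have "\<dots> = 2 powr (p - 1) * 2 powr p * (X powr (p - 1) * \<delta> powr (1 - p) / r powr p)"
      unfolding h1 using pos by simp
    also have "\<dots> \<le> 2 powr (p - 1) * 2 powr p * (X powr p * \<delta> powr (1 - p) / r powr p)"
      using X1[of "p - 1" p] by (intro mult_left_mono divide_right_mono mult_right_mono) auto
    finally show ?thesis .
  qed
  have hp: "0 < h" using pos X by (simp add: h)
  have s4: "2 * \<theta> powr (N + p) * (tt / h powr (p - 1)) \<le> 2 * 12 powr (N + p) * 2 powr (p - 1) * 2 powr p * Y"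
  proof -
    have "\<theta> powr (N + p) * (tt / h powr (p - 1)) \<le> (12 powr (N + p) * X powr (N + p)) * (2 powr (p - 1) * 2 powr p * (X powr p * \<delta> powr (1 - p) / r powr p))"
      using t pos by (intro mult_mono s2 s3) (auto simp: tt)
    also have "\<dots> = 12 powr (N + p) * 2 powr (p - 1) * 2 powr p * ((X powr (N + p) * X powr p) * \<delta> powr (1 - p) / r powr p)"
      by (simp add: mult_ac)
    also have "X powr (N + p) * X powr p = X powr (N + 2 * p)" by (simp add: powr_add[symmetric] algebra_simps)
    finally show ?thesis by (simp add: Y_def)
  qed
  define a where "a = A / (K0 powr p * r powr N)"
  have a: "0 < a" "A = a * (K0 powr p * r powr N)" using A pos by (auto simp: a_def)
  have s5: "(2 * A / (h powr p * V)) powr \<kappa> = (2 * 2 powr p / V) powr \<kappa> * X powr (p * \<kappa>) * (a powr \<kappa> * r powr p)"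
  proof -
    have "h powr p = K0 powr p / (2 powr p * X powr p)" unfolding h using pos X by (simp add: powr_divide powr_mult)
    then have "2 * A / (h powr p * V) = (2 * 2 powr p / V) * (X powr p * (a * r powr N))"
      unfolding a(2) using pos by (simp add: field_simps)
    also have "\<dots> powr \<kappa> = (2 * 2 powr p / V) powr \<kappa> * ((X powr p) powr \<kappa> * (a powr \<kappa> * (r powr N) powr \<kappa>))"
    proof -
      have "(q * (x * (y * z))) powr \<kappa> = q powr \<kappa> * (x powr \<kappa> * (y powr \<kappa> * z powr \<kappa>))"
        if "0 \<le> q" "0 \<le> x" "0 \<le> y" "0 \<le> z" for q x y z :: real
        using that by (simp add: powr_mult)
      note gen = this
      show ?thesis by (rule gen) (use pos a X in auto)
    qed
    finally show ?thesis using N by (simp add: powr_powr \<kappa>)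
  qed
  have rp: "r powr p \<noteq> 0" using pos by simp
  have "L powr p * A + 2 * \<theta> powr (N + p) * (A / h powr (p - 1) * tt) = A * (L powr p + 2 * \<theta> powr (N + p) * (tt / h powr (p - 1)))"
    by (simp add: algebra_simps)
  also have "\<dots> \<le> A * ((512 * exp 2) powr p * Y + 2 * 12 powr (N + p) * 2 powr (p - 1) * 2 powr p * Y)"
    using A by (intro mult_left_mono add_mono s1 s4) auto
  also have "\<dots> = A * (Q1 * Y)" by (simp add: Q1 algebra_simps)
  finally have "K * (2 * A / (h powr p * V)) powr \<kappa> * (L powr p * A + 2 * \<theta> powr (N + p) * (A / h powr (p - 1) * tt))
     \<le> K * (2 * A / (h powr p * V)) powr \<kappa> * (A * (Q1 * Y))"
    using pos by (intro mult_left_mono) auto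
  also have "\<dots> = (K0 powr p * r powr N) * (K * (2 * 2 powr p / V) powr \<kappa> * Q1 * \<delta> powr (1 - p) * (X powr (p * \<kappa>) * X powr (N + 2 * p)) * (a * a powr \<kappa>))"
    unfolding s5 Y_def using rp by (subst a(2)) (simp add: field_simps)
  also have "X powr (p * \<kappa>) * X powr (N + 2 * p) = X powr (p * \<kappa> + N + 2 * p)" by (simp add: powr_add[symmetric] add.assoc)
  also have "a * a powr \<kappa> = a powr (1 + \<kappa>)" using a by (simp add: powr_add)
  finally show ?thesis by (simp add: a_def)
qed simp

text \<open>For p < N one has \<eta>/(\<eta> - 1) = N/p and equality holds; for p \<ge> N the value
  \<eta> = 2 leaves the factor 2p/N \<ge> 1.\<close>

lemma De_Giorgi_exponent:
  assumes p: "1 < p" and N: "1 \<le> N"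
  shows "p - 1 \<le> ((p - 1) * sobolev_eta N p) / ((sobolev_eta N p - 1) * p) * p * (p / real N)"
proof (cases "p < real N")
  case True
  have "sobolev_eta N p / (sobolev_eta N p - 1) = real N / p"
    using True p by (simp add: sobolev_eta_def field_simps)
  moreover have "((p - 1) * sobolev_eta N p) / ((sobolev_eta N p - 1) * p) * p * (p / real N) = (p - 1) * (sobolev_eta N p / (sobolev_eta N p - 1)) * (p / real N)"
    using p by simp
  ultimately show ?thesis using p N by simp
next
  case False
  have "1 \<le> 2 * (p / real N)" using False p N by (simp add: field_simps)
  then have "p - 1 \<le> (p - 1) * (2 * (p / real N))" using p mult_left_mono[of 1 "2 * (p / real N)" "p - 1"] by simp
  also have "\<dots> = ((p - 1) * 2) / ((2 - 1) * p) * p * (p / real N)" using p by simp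
  finally show ?thesis using False by (simp add: sobolev_eta_def)
qed

text \<open>C solves C^(p\<kappa>) = Q V^\<kappa> b^(1/\<kappa>): raising the lower bound of K0 to
  the power p\<kappa> then yields the smallness condition of the recursion. The powers of \<delta>
  compare because e p \<kappa> \<ge> p - 1 and \<delta> \<le> 1.\<close>

lemma De_Giorgi_initial:
  fixes a K0 r \<delta> V N p C \<kappa> Q b e :: real
  assumes p: "1 < p" and N: "0 < N" and pos: "0 \<le> a" "0 < K0" "0 < r" "0 < V" "0 < Q" "1 < b" and \<delta>: "0 < \<delta>" "\<delta> \<le> 1"
    and \<kappa>: "\<kappa> = p / N" and C: "C = (Q * V powr \<kappa> * b powr (1 / \<kappa>)) powr (1 / (p * \<kappa>))"
    and K0: "C * \<delta> powr (- e) * (a / (V * r powr N)) powr (1 / p) \<le> K0" and e: "p - 1 \<le> e * p * \<kappa>"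
  shows "Q * \<delta> powr (1 - p) * (a / (K0 powr p * r powr N)) powr \<kappa> \<le> b powr (- (1 / \<kappa>))"
proof -
  have kp: "0 < \<kappa>" using p N by (simp add: \<kappa>)
  define Z where "Z = Q * V powr \<kappa> * b powr (1 / \<kappa>)"
  have Z: "0 < Z" using pos by (simp add: Z_def)
  have C0: "0 < C" using Z by (simp add: C Z_def[symmetric])
  have Cp: "C powr (p * \<kappa>) = Z" unfolding C Z_def[symmetric] using Z p kp by (simp add: powr_powr)
  define x where "x = a / (V * r powr N)"
  have x: "0 \<le> x" using pos by (simp add: x_def)
  have "(C * \<delta> powr (- e) * x powr (1 / p)) powr (p * \<kappa>) \<le> K0 powr (p * \<kappa>)"
    using K0 C0 p kp by (intro powr_mono2) (auto simp: x_def)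
  also have "(C * \<delta> powr (- e) * x powr (1 / p)) powr (p * \<kappa>) = Z * \<delta> powr (- (e * p * \<kappa>)) * x powr \<kappa>"
    using C0 x \<delta> p by (simp add: powr_mult powr_powr Cp mult.assoc)
  finally have 1: "Z * \<delta> powr (- (e * p * \<kappa>)) * x powr \<kappa> \<le> K0 powr (p * \<kappa>)" .
  have "\<delta> powr (1 - p) \<le> \<delta> powr (- (e * p * \<kappa>))" using \<delta> e by (intro powr_mono') auto
  then have "Z * \<delta> powr (1 - p) * x powr \<kappa> \<le> Z * \<delta> powr (- (e * p * \<kappa>)) * x powr \<kappa>"
    using Z by (intro mult_right_mono mult_left_mono) auto
  with 1 have 2: "Z * \<delta> powr (1 - p) * x powr \<kappa> \<le> K0 powr (p * \<kappa>)" by linarith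
  have ax: "a / (K0 powr p * r powr N) = V * x / K0 powr p" using pos by (simp add: x_def)
  have "(a / (K0 powr p * r powr N)) powr \<kappa> = V powr \<kappa> * x powr \<kappa> / K0 powr (p * \<kappa>)"
    unfolding ax using pos x by (simp add: powr_mult powr_divide powr_powr)
  then have "Q * \<delta> powr (1 - p) * (a / (K0 powr p * r powr N)) powr \<kappa> = b powr (- (1 / \<kappa>)) * (Z * \<delta> powr (1 - p) * x powr \<kappa> / K0 powr (p * \<kappa>))"
    unfolding Z_def using pos by (simp add: powr_minus field_simps)
  also have "\<dots> \<le> b powr (- (1 / \<kappa>)) * 1"
    using 2 pos by (intro mult_left_mono) auto
  finally show ?thesis by simp
qed

lemma emeasure_ball_powr:
  assumes "0 < R"
  shows "emeasure lborel (ball (x::'a::euclidean_space) R) = ennreal (R powr real DIM('a) * measure lborel (ball (0::'a) 1))"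
proof -
  have "emeasure lborel (ball x R) = ennreal (measure lborel (ball x R))"
    using emeasure_bounded_finite[of "ball x R"] by (intro emeasure_eq_ennreal_measure) auto
  also have "measure lborel (ball x R) = R powr real DIM('a) * measure lborel (ball (0::'a) 1)"
    using assms content_ball_conv_unit_ball[of R x] by (simp add: powr_realpow)
  finally show ?thesis .
qed

text \<open>The tail and the energy enter through real numbers t and a, so both are finite here; K0
  is any positive level above \<delta> t and above the energy term. Asking for K0 \<ge> \<delta> t
  instead of K0 \<ge> t is what allows the factor \<delta> in front of the tail.\<close>

lemma De_Giorgi_iteration:
  fixes \<mu> :: "real measure"
  assumes p: "1 < p"
    and mu: "sets \<mu> = sets (restrict_space borel {0..1})" "finite_measure \<mu>" and alpha: "0 < measure \<mu> {1}"
  obtains C where "0 < C"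
    "\<And>(\<Omega> :: 'a::euclidean_space set) u u' x0 r \<delta> K0 t a.
      open \<Omega> \<Longrightarrow> weak_subsolution \<mu> p \<Omega> u \<Longrightarrow> u' \<in> borel_measurable borel \<Longrightarrow> (AE x in lborel. u x = u' x) \<Longrightarrow>
      ball x0 r \<subseteq> \<Omega> \<Longrightarrow> 0 < r \<Longrightarrow> r \<le> 1 \<Longrightarrow> 0 < \<delta> \<Longrightarrow> \<delta> \<le> 1 \<Longrightarrow> 0 < K0 \<Longrightarrow> 0 \<le> t \<Longrightarrow> \<delta> * t \<le> K0 \<Longrightarrow>
      tail_integral \<mu> p u x0 (r / 2)
        \<le> ennreal (t powr (p - 1) / (r / 2) powr p) \<Longrightarrow>
      0 \<le> a \<Longrightarrow> (\<integral>\<^sup>+x. ennreal (max (u' x) 0 powr p) * indicator (ball x0 r) x \<partial>lborel) = ennreal a \<Longrightarrow>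
      C * \<delta> powr (- (((p - 1) * sobolev_eta DIM('a) p) / ((sobolev_eta DIM('a) p - 1) * p)))
        * (a / (measure lborel (ball (0::'a) 1) * r powr real DIM('a))) powr (1 / p) \<le> K0 \<Longrightarrow>
      AE x in lborel. x \<in> ball x0 (r / 2) \<longrightarrow> u' x \<le> K0"
proof -
  \<comment> \<open>An integer power keeps \<phi>^m smooth; the ceiling gives m \<ge> p.\<close>
  define m where "m = nat \<lceil>p\<rceil>"
  have m: "p \<le> real m" unfolding m_def by linarith
  define N where "N = real DIM('a)"
  have N: "0 < N" "1 \<le> DIM('a)" by (auto simp: N_def Suc_le_eq)
  define V where "V = measure lborel (ball (0::'a) 1)"
  have V: "0 < V" unfolding V_def by (rule content_ball_pos) simp
  define \<kappa> where "\<kappa> = p / N"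
  have \<kappa>: "0 < \<kappa>" using p N by (simp add: \<kappa>_def)
  define e where "e = ((p - 1) * sobolev_eta DIM('a) p) / ((sobolev_eta DIM('a) p - 1) * p)"
  have e: "p - 1 \<le> e * p * \<kappa>" unfolding e_def \<kappa>_def N_def by (rule De_Giorgi_exponent[OF p N(2)])
  show ?thesis
  proof (rule subsolution_step[where 'a = 'a, OF p m mu alpha])
    fix K assume K: "0 < K"
      and step: "\<And>(\<Omega> :: 'a::euclidean_space set) u u' \<phi> D x0 b c d \<rho> k L R.
      open \<Omega> \<Longrightarrow> weak_subsolution \<mu> p \<Omega> u \<Longrightarrow> u' \<in> borel_measurable borel \<Longrightarrow> (AE x in lborel. u x = u' x) \<Longrightarrow>
      0 < b \<Longrightarrow> b < c \<Longrightarrow> c < d \<Longrightarrow> c \<le> 1 \<Longrightarrow> cball x0 d \<subseteq> \<Omega> \<Longrightarrow> \<rho> \<le> c \<Longrightarrow> 0 \<le> k \<Longrightarrow>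
      test_function UNIV \<phi> \<Longrightarrow> (\<And>x. GDERIV \<phi> x :> D x) \<Longrightarrow> (\<And>x. 0 \<le> \<phi> x) \<Longrightarrow> (\<And>x. \<phi> x \<le> 1) \<Longrightarrow>
      (\<And>x. x \<notin> ball x0 b \<Longrightarrow> \<phi> x = 0) \<Longrightarrow> (\<And>x. norm (D x) \<le> L) \<Longrightarrow> 0 < R \<Longrightarrow>
      2 * emeasure lborel {x \<in> ball x0 b. k < u' x} \<le> emeasure lborel (ball (0::'a) R) \<Longrightarrow>
      (\<integral>\<^sup>+x. ennreal ((\<phi> x ^ m * max (u' x - k) 0) powr p) \<partial>lborel) \<le>
        ennreal (K * R powr p) * (ennreal (L powr p) * (\<integral>\<^sup>+x. ennreal (max (u' x - k) 0 powr p) * indicator (ball x0 c) x \<partial>lborel)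
          + ennreal (2 * (c / (c - b)) powr (real DIM('a) + p)) * ((\<integral>\<^sup>+x. ennreal (\<phi> x ^ m * max (u' x - k) 0) \<partial>lborel)
        * tail_integral \<mu> p u x0 \<rho>))"
    define Q1 :: real where "Q1 = (512 * exp 2) powr p + 2 * 12 powr (N + p) * 2 powr (p - 1) * 2 powr p"
    have Q1: "0 < Q1" unfolding Q1_def by (intro add_pos_pos) auto
    \<comment> \<open>The data of the recursion: its constant is Q \<delta>^(1-p), and its growth is
      X^E = \<beta>^j for X = 2^j.\<close>
    define Q where "Q = K * (2 * 2 powr p / V) powr \<kappa> * Q1"
    have Q: "0 < Q" using K V Q1 by (simp add: Q_def)
    define E where "E = p * \<kappa> + N + 2 * p"
    have E: "0 < E" using p N \<kappa> by (auto simp: E_def intro!: add_pos_pos)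
    define \<beta> :: real where "\<beta> = 2 powr E"
    have \<beta>: "1 < \<beta>" using powr_less_mono[of 0 E 2] E by (simp add: \<beta>_def)
    define C where "C = (Q * V powr \<kappa> * \<beta> powr (1 / \<kappa>)) powr (1 / (p * \<kappa>))"
    have C: "0 < C" using Q V \<beta> by (simp add: C_def)
    show ?thesis
    proof (rule that[OF C])
      fix \<Omega> :: "'a set" and u u' :: "'a \<Rightarrow> real" and x0 :: 'a and r \<delta> K0 t a :: real
      assume \<Omega>: "open \<Omega>" and sub: "weak_subsolution \<mu> p \<Omega> u" and u'[measurable]: "u' \<in> borel_measurable borel"
        and ae: "AE x in lborel. u x = u' x" and rO: "ball x0 r \<subseteq> \<Omega>" and r: "0 < r" "r \<le> 1" and \<delta>: "0 < \<delta>" "\<delta> \<le> 1"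
        and K0: "0 < K0" and t: "0 \<le> t" "\<delta> * t \<le> K0"
        and tail: "tail_integral \<mu> p u x0 (r / 2)
        \<le> ennreal (t powr (p - 1) / (r / 2) powr p)" (is "?TT \<le> _")
        and a: "0 \<le> a" "(\<integral>\<^sup>+x. ennreal (max (u' x) 0 powr p) * indicator (ball x0 r) x \<partial>lborel) = ennreal a"
        and CK: "C * \<delta> powr (- (((p - 1) * sobolev_eta DIM('a) p) / ((sobolev_eta DIM('a) p - 1) * p)))
          * (a / (measure lborel (ball (0::'a) 1) * r powr real DIM('a))) powr (1 / p) \<le> K0"
      \<comment> \<open>The radii decrease from 3r/4 to r/2. Starting below r keeps the closed ball
        of radius 7r/8 inside \<Omega>, although the ball of radius r may touch the
        boundary.\<close>
      define Rj where "Rj j = r / 2 + r / (4 * 2 ^ j)" for j :: nat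
      define kj where "kj j = K0 - K0 / 2 ^ j" for j :: nat
      define A where "A j = (\<integral>\<^sup>+x. ennreal (max (u' x - kj j) 0 powr p) * indicator (ball x0 (Rj j)) x \<partial>lborel)" for j
      have [measurable]: "ball x0 s \<in> sets borel" for s by simp
      have Rb: "r / 2 < Rj j" "Rj (Suc j) < Rj j" "Rj j \<le> 3 * r / 4" for j
        using r by (auto simp: Rj_def field_simps)
      have kb: "0 \<le> kj j" "kj j < K0" "kj (Suc j) - kj j = K0 / (2 * 2 ^ j)" for j
        using K0 by (auto simp: kj_def field_simps)
      have kmono: "kj j \<le> kj (Suc j)" for j using kb(3)[of j] K0 by (smt (verit) divide_nonneg_nonneg zero_le_power)
      have A_le: "A j \<le> ennreal a" for j
        unfolding A_def a(2)[symmetric]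
      proof (rule nn_integral_mono)
        fix x
        have "x \<in> ball x0 r" if "x \<in> ball x0 (Rj j)" using that Rb(3)[of j] r by auto
        moreover have "max (u' x - kj j) 0 powr p \<le> max (u' x) 0 powr p"
          using kb(1)[of j] p by (intro powr_mono2) auto
        ultimately show "ennreal (max (u' x - kj j) 0 powr p) * indicator (ball x0 (Rj j)) x \<le> ennreal (max (u' x) 0 powr p) * indicator (ball x0 r) x"
          by (intro mult_mono ennreal_leI) (auto simp: indicator_def)
      qed
      define Ar where "Ar j = enn2real (A j)" for j
      have A_eq: "A j = ennreal (Ar j)" for j
        unfolding Ar_def using A_le[of j] by (intro ennreal_enn2real[symmetric]) (auto simp: less_top[symmetric] top_unique)
      have Ar0: "0 \<le> Ar j" for j by (simp add: Ar_def)
      have A_mono: "A (Suc j) \<le> A j" for j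
        unfolding A_def
      proof (rule nn_integral_mono)
        fix x
        have "max (u' x - kj (Suc j)) 0 powr p \<le> max (u' x - kj j) 0 powr p"
          using kmono[of j] p by (intro powr_mono2) auto
        then show "ennreal (max (u' x - kj (Suc j)) 0 powr p) * indicator (ball x0 (Rj (Suc j))) x \<le> ennreal (max (u' x - kj j) 0 powr p) * indicator (ball x0 (Rj j)) x"
          using Rb(2)[of j] by (intro mult_mono ennreal_leI) (auto simp: indicator_def)
      qed
      define aj where "aj j = Ar j / (K0 powr p * r powr N)" for j
      have S0: "0 < K0 powr p * r powr N" using K0 r by simp
      have rec: "aj (Suc j) \<le> (Q * \<delta> powr (1 - p)) * \<beta> ^ j * aj j powr (1 + \<kappa>)" for j
      \<comment> \<open>If the energy vanishes, the radius R below would be 0; monotonicity of the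
        energies settles that case.\<close>
      proof (cases "Ar j = 0")
        case True
        then have "Ar (Suc j) \<le> 0" using A_mono[of j] by (simp add: A_eq ennreal_eq_0_iff)
        then have "aj (Suc j) = 0" using Ar0[of "Suc j"] by (simp add: aj_def)
        then show ?thesis using Q \<beta> by simp
      next
        case False
        then have Ap: "0 < Ar j" using Ar0[of j] by simp
        define X :: real where "X = 2 ^ j"
        have X: "1 \<le> X" by (simp add: X_def)
        define h where "h = K0 / (2 * X)"
        have h: "0 < h" "kj (Suc j) = kj j + h" using K0 X kb(3)[of j] by (auto simp: h_def X_def)
        \<comment> \<open>The cutoff falls from 1 to 0 between \<open>Rj (Suc j)\<close> and the
          midpoint b; the other half of the gap, from b to c, separates its support from the far
          region. Each half has width r/(16 X), whence 512 = 32 * 16 in \<open>L\<close>.\<close>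
        define c where "c = Rj j"
        define b where "b = (Rj j + Rj (Suc j)) / 2"
        have bc: "c - b = r / (16 * X)" "b - Rj (Suc j) = r / (16 * X)"
          by (auto simp: c_def b_def Rj_def X_def field_simps)
        define L where "L = 512 * exp 2 * X / r"
        \<comment> \<open>Chosen so that the ball of radius R has measure 2 \<open>Ar j\<close> /
          h^p, twice the Chebyshev bound for the superlevel set.\<close>
        define R where "R = (2 * Ar j / (h powr p * V)) powr (1 / N)"
        have R: "0 < R" using Ap h V by (simp add: R_def)
        have b0: "0 < b" "b < c" "Rj (Suc j) < b" using Rb[of j] Rb[of "Suc j"] r by (auto simp: b_def c_def)
        have Rp: "0 \<le> Rj (Suc j)" using Rb(1)[of "Suc j"] r by simp
        obtain \<phi> D where \<phi>: "test_function UNIV \<phi>" "\<And>x. GDERIV \<phi> x :> D x" "\<And>x. 0 \<le> \<phi> x" "\<And>x. \<phi> x \<le> 1"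
          "\<And>x. x \<in> cball x0 (Rj (Suc j)) \<Longrightarrow> \<phi> x = 1" "\<And>x. x \<notin> ball x0 b \<Longrightarrow> \<phi> x = 0"
          "\<And>x. norm (D x) \<le> 32 * exp 2 / (b - Rj (Suc j))"
          using cutoff_exists[OF Rp b0(3) subset_UNIV] by blast
        have DL: "norm (D x) \<le> L" for x using \<phi>(7)[of x] unfolding bc L_def by simp
        have ind: "(x \<in> ball x0 b \<Longrightarrow> x \<in> ball x0 (Rj j))" for x using b0 by (auto simp: c_def)
        \<comment> \<open>Chebyshev: where u' exceeds the next level, u' - \<open>kj j\<close>
          exceeds h.\<close>
        have M: "emeasure lborel {x \<in> ball x0 b. kj (Suc j) < u' x} \<le> ennreal (Ar j / h powr p)"
        proof -
          let ?S = "{x \<in> ball x0 b. kj (Suc j) < u' x}"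
          have [measurable]: "?S \<in> sets borel" by simp
          have "ennreal (h powr p) * emeasure lborel ?S = (\<integral>\<^sup>+x. ennreal (h powr p) * indicator ?S x \<partial>lborel)"
            by (subst nn_integral_cmult_indicator) auto
          also have "\<dots> \<le> A j"
            unfolding A_def
          proof (rule nn_integral_mono)
            fix x
            show "ennreal (h powr p) * indicator ?S x \<le> ennreal (max (u' x - kj j) 0 powr p) * indicator (ball x0 (Rj j)) x"
            proof (cases "x \<in> ?S")
              case True
              then have "h powr p \<le> max (u' x - kj j) 0 powr p" using h p by (intro powr_mono2) auto
              then show ?thesis using True ind[of x] by (simp add: ennreal_leI)
            qed simp
          qed
          finally have le: "ennreal (h powr p) * emeasure lborel ?S \<le> ennreal (Ar j)" by (simp add: A_eq)
          have "emeasure lborel ?S = ennreal (1 / h powr p) * (ennreal (h powr p) * emeasure lborel ?S)"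
            using h by (simp add: mult.assoc[symmetric] ennreal_mult[symmetric])
          also have "\<dots> \<le> ennreal (1 / h powr p) * ennreal (Ar j)" by (intro mult_left_mono le) simp
          also have "\<dots> = ennreal (Ar j / h powr p)" by (simp add: ennreal_mult[symmetric] Ar0)
          finally show ?thesis .
        qed
        have "emeasure lborel (ball (0::'a) R) = ennreal (2 * Ar j / h powr p)"
        proof -
          have "R powr N = 2 * Ar j / (h powr p * V)" unfolding R_def using N Ap h V by (simp add: powr_powr)
          then show ?thesis using V emeasure_ball_powr[OF R, of "0::'a"] unfolding V_def[symmetric] N_def[symmetric] by simp
        qed
        moreover have "2 * ennreal (Ar j / h powr p) = ennreal (2 * Ar j / h powr p)"
          using ennreal_mult[of 2 "Ar j / h powr p"] Ar0[of j] by simp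
        ultimately have small: "2 * emeasure lborel {x \<in> ball x0 b. kj (Suc j) < u' x} \<le> emeasure lborel (ball (0::'a) R)"
          using mult_left_mono[OF M, of 2] by simp
        have cd: "c < 7 * r / 8" "c \<le> 1" "cball x0 (7 * r / 8) \<subseteq> \<Omega>" "r / 2 \<le> c"
          using Rb[of j] r rO by (auto simp: c_def subset_eq)
        define \<theta> where "\<theta> = c / (c - b)"
        \<comment> \<open>The factor 12 is (3/4) * 16, from c \<le> 3r/4 and c - b = r/(16
          X).\<close>
        have \<theta>: "0 < \<theta>" "\<theta> \<le> 12 * X"
        proof -
          show "0 < \<theta>" using b0 by (simp add: \<theta>_def)
          have "c / (r / (16 * X)) \<le> (3 * r / 4) / (r / (16 * X))" using Rb(3)[of j] r X by (intro divide_right_mono) (auto simp: c_def)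
          then show "\<theta> \<le> 12 * X" using r unfolding \<theta>_def bc by simp
        qed
        define tt where "tt = t powr (p - 1) / (r / 2) powr p"
        have tt0: "0 \<le> tt" by (simp add: tt_def)
        have W: "(\<integral>\<^sup>+x. ennreal (max (u' x - kj (Suc j)) 0 powr p) * indicator (ball x0 c) x \<partial>lborel) \<le> ennreal (Ar j)"
          unfolding A_eq[symmetric] A_def c_def
          using kmono[of j] p by (intro nn_integral_mono mult_right_mono ennreal_leI powr_mono2) auto
        \<comment> \<open>Where u' exceeds \<open>kj (Suc j)\<close>, the quantity y = u' -
          \<open>kj j\<close> exceeds h, so y \<le> y^p / h^(p-1): the level gap pays for the first
          power in front of the tail.\<close>
        have I: "(\<integral>\<^sup>+x. ennreal (\<phi> x ^ m * max (u' x - kj (Suc j)) 0) \<partial>lborel) \<le> ennreal (Ar j / h powr (p - 1))"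
        proof -
          have "(\<integral>\<^sup>+x. ennreal (\<phi> x ^ m * max (u' x - kj (Suc j)) 0) \<partial>lborel) \<le>
            (\<integral>\<^sup>+x. ennreal (1 / h powr (p - 1)) * (ennreal (max (u' x - kj j) 0 powr p) * indicator (ball x0 (Rj j)) x) \<partial>lborel)"
          proof (rule nn_integral_mono)
            fix x
            show "ennreal (\<phi> x ^ m * max (u' x - kj (Suc j)) 0) \<le> ennreal (1 / h powr (p - 1)) * (ennreal (max (u' x - kj j) 0 powr p) * indicator (ball x0 (Rj j)) x)"
            proof (cases "x \<in> ball x0 b \<and> kj (Suc j) < u' x")
              case True
              define y where "y = u' x - kj j"
              have y: "h < y" using True h by (simp add: y_def)
              have "\<phi> x ^ m * max (u' x - kj (Suc j)) 0 \<le> 1 * y"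
                using \<phi>(3,4)[of x] True h by (intro mult_mono power_le_one) (auto simp: y_def)
              also have "\<dots> = y powr p / y powr (p - 1)" using y h by (simp add: powr_diff)
              also have "\<dots> \<le> y powr p / h powr (p - 1)"
                using y h p by (intro divide_left_mono powr_mono2) auto
              finally have "ennreal (\<phi> x ^ m * max (u' x - kj (Suc j)) 0) \<le> ennreal (1 / h powr (p - 1) * y powr p)"
                by (intro ennreal_leI) simp
              also have "\<dots> = ennreal (1 / h powr (p - 1)) * ennreal (y powr p)" by (rule ennreal_mult) auto
              finally show ?thesis using True ind[of x] y h by (simp add: y_def max_def)
            next
              case False
              have z: "\<phi> x ^ m * max (u' x - kj (Suc j)) 0 = 0"
              proof (cases "x \<in> ball x0 b")
                case True
                then show ?thesis using False by simp
              next
                case False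
                then show ?thesis using \<phi>(6)[of x] m p by (cases m) auto
              qed
              show ?thesis unfolding z by simp
            qed
          qed
          also have "\<dots> = ennreal (1 / h powr (p - 1)) * ennreal (Ar j)"
            unfolding A_eq[symmetric] A_def by (rule nn_integral_cmult) measurable
          also have "\<dots> = ennreal (Ar j / h powr (p - 1))" using Ar0 by (simp add: ennreal_mult[symmetric])
          finally show ?thesis .
        qed
        have "ennreal (Ar (Suc j)) \<le> (\<integral>\<^sup>+x. ennreal ((\<phi> x ^ m * max (u' x - kj (Suc j)) 0) powr p) \<partial>lborel)"
          unfolding A_eq[symmetric] A_def
        proof (rule nn_integral_mono)
          fix x
          show "ennreal (max (u' x - kj (Suc j)) 0 powr p) * indicator (ball x0 (Rj (Suc j))) x \<le> ennreal ((\<phi> x ^ m * max (u' x - kj (Suc j)) 0) powr p)"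
            using \<phi>(5)[of x] by (cases "x \<in> ball x0 (Rj (Suc j))") auto
        qed
        also have "\<dots> \<le> ennreal (K * R powr p) * (ennreal (L powr p) * (\<integral>\<^sup>+x. ennreal (max (u' x - kj (Suc j)) 0 powr p) * indicator (ball x0 c) x \<partial>lborel)
          + ennreal (2 * (c / (c - b)) powr (real DIM('a) + p)) * ((\<integral>\<^sup>+x. ennreal (\<phi> x ^ m * max (u' x - kj (Suc j)) 0) \<partial>lborel) * ?TT))"
          by (rule step[OF \<Omega> sub u' ae b0(1,2) cd kb(1) \<phi>(1,2,3,4,6) DL R small])
        also have "\<dots> \<le> ennreal (K * R powr p) * (ennreal (L powr p) * ennreal (Ar j)
          + ennreal (2 * \<theta> powr (N + p)) * (ennreal (Ar j / h powr (p - 1)) * ennreal tt))"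
          unfolding \<theta>_def[symmetric] N_def using W I tail unfolding tt_def[symmetric]
          by (intro mult_left_mono add_mono mult_mono) auto
        also have "\<dots> = ennreal (K * R powr p * (L powr p * Ar j + 2 * \<theta> powr (N + p) * (Ar j / h powr (p - 1) * tt)))"
        proof -
          have nn: "0 \<le> Ar j / h powr (p - 1)" "0 \<le> Ar j / h powr (p - 1) * tt" "0 \<le> K * R powr p"
            "0 \<le> L powr p * Ar j" "0 \<le> 2 * \<theta> powr (N + p) * (Ar j / h powr (p - 1) * tt)" "0 \<le> 2 * \<theta> powr (N + p)"
            using Ar0[of j] tt0 K by auto
          then show ?thesis
            using Ar0[of j] by (simp only: ennreal_mult[symmetric] ennreal_plus[symmetric] tt0 powr_ge_zero add_nonneg_nonneg)
        qed
        finally have "Ar (Suc j) \<le> K * R powr p * (L powr p * Ar j + 2 * \<theta> powr (N + p) * (Ar j / h powr (p - 1) * tt))"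
          using Ar0[of j] tt0 K by (subst (asm) ennreal_le_iff) auto
        also have "R powr p = (2 * Ar j / (h powr p * V)) powr \<kappa>" unfolding R_def by (simp add: powr_powr \<kappa>_def)
        also have "K * (2 * Ar j / (h powr p * V)) powr \<kappa> * (L powr p * Ar j + 2 * \<theta> powr (N + p) * (Ar j / h powr (p - 1) * tt))
          \<le> (K0 powr p * r powr N) * (K * (2 * 2 powr p / V) powr \<kappa> * Q1 * \<delta> powr (1 - p) * X powr (p * \<kappa> + N + 2 * p) * (Ar j / (K0 powr p * r powr N)) powr (1 + \<kappa>))"
          by (rule De_Giorgi_step_algebra[OF p N(1) Ar0 K K0 r(1) V \<delta> t X h_def L_def \<theta> tt_def \<kappa>_def Q1_def])
        finally have "aj (Suc j) \<le> Q * \<delta> powr (1 - p) * X powr E * aj j powr (1 + \<kappa>)"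
          using S0 by (simp add: aj_def Q_def E_def field_simps)
        also have "X powr E = \<beta> ^ j"
          unfolding X_def \<beta>_def by (simp add: powr_powr powr_power mult.commute flip: powr_realpow)
        finally show ?thesis by simp
      qed
      have init: "(Q * \<delta> powr (1 - p)) * aj 0 powr \<kappa> \<le> \<beta> powr (- (1 / \<kappa>))"
      proof -
        have "Ar 0 \<le> a" using A_le[of 0] a(1) unfolding A_eq by (simp add: ennreal_le_iff)
        then have "aj 0 \<le> a / (K0 powr p * r powr N)" unfolding aj_def using S0 by (intro divide_right_mono) auto
        then have "aj 0 powr \<kappa> \<le> (a / (K0 powr p * r powr N)) powr \<kappa>"
          using \<kappa> S0 Ar0[of 0] by (intro powr_mono2) (auto simp: aj_def)
        then have "(Q * \<delta> powr (1 - p)) * aj 0 powr \<kappa> \<le> (Q * \<delta> powr (1 - p)) * (a / (K0 powr p * r powr N)) powr \<kappa>"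
          using Q by (intro mult_left_mono) auto
        also have "\<dots> \<le> \<beta> powr (- (1 / \<kappa>))"
          using CK unfolding e_def[symmetric] V_def[symmetric] N_def[symmetric]
          by (intro De_Giorgi_initial[OF p N(1) a(1) K0 r(1) V Q \<beta> \<delta> \<kappa>_def C_def _ e]) 
        finally show ?thesis .
      qed
      have lim: "aj \<longlonglongrightarrow> 0"
        by (rule superlinear_recursion_tendsto_0[OF _ _ \<beta> \<kappa> rec init]) (use Ar0 S0 Q \<delta> in \<open>auto simp: aj_def\<close>)
      have Ar_lim: "Ar \<longlonglongrightarrow> 0"
      proof -
        have "(\<lambda>j. (K0 powr p * r powr N) * aj j) \<longlonglongrightarrow> (K0 powr p * r powr N) * 0" by (intro tendsto_mult tendsto_const lim)
        moreover have "(K0 powr p * r powr N) * aj j = Ar j" for j using K0 r by (simp add: aj_def)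
        ultimately show ?thesis by simp
      qed
      \<comment> \<open>Every \<open>A j\<close> dominates the energy at the limiting level and
        radius, so the latter is 0.\<close>
      define Z where "Z = (\<integral>\<^sup>+x. ennreal (max (u' x - K0) 0 powr p) * indicator (ball x0 (r / 2)) x \<partial>lborel)"
      have Z_le: "Z \<le> ennreal (Ar j)" for j
        unfolding A_eq[symmetric] A_def Z_def
      proof (rule nn_integral_mono)
        fix x
        have "max (u' x - K0) 0 powr p \<le> max (u' x - kj j) 0 powr p" using kb(2)[of j] p by (intro powr_mono2) auto
        then show "ennreal (max (u' x - K0) 0 powr p) * indicator (ball x0 (r / 2)) x \<le> ennreal (max (u' x - kj j) 0 powr p) * indicator (ball x0 (Rj j)) x"
          using Rb(1)[of j] by (intro mult_mono ennreal_leI) (auto simp: indicator_def)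
      qed
      have "(\<lambda>j. ennreal (Ar j)) \<longlonglongrightarrow> ennreal 0" by (intro tendsto_ennrealI Ar_lim)
      then have "Z \<le> 0" using Z_le by (intro LIMSEQ_le_const[where X = "\<lambda>j. ennreal (Ar j)"]) auto
      then have "Z = 0" by simp
      then have "AE x in lborel. ennreal (max (u' x - K0) 0 powr p) * indicator (ball x0 (r / 2)) x = 0"
        unfolding Z_def by (subst (asm) nn_integral_0_iff_AE) auto
      then show "AE x in lborel. x \<in> ball x0 (r / 2) \<longrightarrow> u' x \<le> K0"
        by eventually_elim (auto simp: ennreal_eq_0_iff max_def split: if_splits)
    qed
  qed
qed

section \<open>Passage to the extended-valued statement\<close>

lemma Lp_loc_UNIV_measurable:
  fixes u :: "'a::euclidean_space \<Rightarrow> real"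
  assumes "Lp_loc q UNIV u"
  shows "u \<in> borel_measurable lebesgue"
proof (rule borel_measurable_LIMSEQ_metric)
  \<comment> \<open>\<open>Lp_loc\<close> asserts measurability on compact sets only; u is the
    pointwise limit of its truncations to balls.\<close>
  show "(\<lambda>x. indicator (cball 0 (real n)) x *\<^sub>R u x) \<in> borel_measurable lebesgue" for n
  proof -
    have "u \<in> borel_measurable (lebesgue_on (cball 0 (real n)))"
      using assms by (auto simp: Lp_loc_def Lp_def)
    then show ?thesis by (subst (asm) borel_measurable_restrict_space_iff) auto
  qed
  fix x :: 'a
  obtain n0 :: nat where "norm x \<le> real n0" using real_arch_simple by blast
  then have "eventually (\<lambda>n. indicator (cball 0 (real n)) x *\<^sub>R u x = u x) sequentially"
    by (intro eventually_sequentiallyI[of n0]) (auto simp: indicator_def)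
  then show "(\<lambda>n. indicator (cball 0 (real n)) x *\<^sub>R u x) \<longlonglongrightarrow> u x" by (rule tendsto_eventually)
qed

theorem theorem1p6:
  fixes p :: real and \<mu> :: "real measure"
  assumes p: "1 < p"
    and mu_borel: "sets \<mu> = sets (restrict_space borel {0..1})"
    and mu_finite: "finite_measure \<mu>"
    and mu_nontrivial: "0 < emeasure \<mu> {0<..<1}"
    and mu_zero: "emeasure \<mu> {0} = 0"
    and alpha_pos: "0 < measure \<mu> {1}"
  shows "\<exists>C>0. \<forall>(\<Omega> :: 'a::euclidean_space set) u.
    bounded_domain \<Omega> \<and> weak_subsolution \<mu> p \<Omega> u \<longrightarrow>
    (\<forall>x0 r \<delta>. ball x0 r \<subseteq> \<Omega> \<and> 0 < r \<and> r \<le> 1 \<and> 0 < \<delta> \<and> \<delta> \<le> 1 \<longrightarrow>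
      esssup (lebesgue_on (ball x0 (r / 2))) (\<lambda>x. ereal (u x)) \<le>
      enn2ereal
        (ennreal \<delta> * Tail \<mu> p (\<lambda>x. max (u x) 0) x0 (r / 2) +
         ennreal (C * \<delta> powr (- ((p - 1) * sobolev_eta DIM('a) p) /
                                ((sobolev_eta DIM('a) p - 1) * p))) *
         Lp_average p (ball x0 r) (\<lambda>x. max (u x) 0)))"
proof (rule De_Giorgi_iteration[where 'a = 'a, OF p mu_borel mu_finite alpha_pos])
  fix C assume C: "0 < C"
    and iter: "\<And>(\<Omega> :: 'a::euclidean_space set) u u' x0 r \<delta> K0 t a.
      open \<Omega> \<Longrightarrow> weak_subsolution \<mu> p \<Omega> u \<Longrightarrow> u' \<in> borel_measurable borel \<Longrightarrow> (AE x in lborel. u x = u' x) \<Longrightarrow>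
      ball x0 r \<subseteq> \<Omega> \<Longrightarrow> 0 < r \<Longrightarrow> r \<le> 1 \<Longrightarrow> 0 < \<delta> \<Longrightarrow> \<delta> \<le> 1 \<Longrightarrow> 0 < K0 \<Longrightarrow> 0 \<le> t \<Longrightarrow> \<delta> * t \<le> K0 \<Longrightarrow>
      tail_integral \<mu> p u x0 (r / 2)
        \<le> ennreal (t powr (p - 1) / (r / 2) powr p) \<Longrightarrow>
      0 \<le> a \<Longrightarrow> (\<integral>\<^sup>+x. ennreal (max (u' x) 0 powr p) * indicator (ball x0 r) x \<partial>lborel) = ennreal a \<Longrightarrow>
      C * \<delta> powr (- (((p - 1) * sobolev_eta DIM('a) p) / ((sobolev_eta DIM('a) p - 1) * p)))
        * (a / (measure lborel (ball (0::'a) 1) * r powr real DIM('a))) powr (1 / p) \<le> K0 \<Longrightarrow>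
      AE x in lborel. x \<in> ball x0 (r / 2) \<longrightarrow> u' x \<le> K0"
  define V where "V = measure lborel (ball (0::'a) 1)"
  have V: "0 < V" unfolding V_def by (rule content_ball_pos) simp
  show ?thesis
  proof (intro exI[of _ C] conjI C allI impI)
    fix \<Omega> :: "'a set" and u :: "'a \<Rightarrow> real" and x0 :: 'a and r \<delta> :: real
    assume \<Omega>u: "bounded_domain \<Omega> \<and> weak_subsolution \<mu> p \<Omega> u"
      and "ball x0 r \<subseteq> \<Omega> \<and> 0 < r \<and> r \<le> 1 \<and> 0 < \<delta> \<and> \<delta> \<le> 1"
    then have rO: "ball x0 r \<subseteq> \<Omega>" and r: "0 < r" "r \<le> 1" and \<delta>: "0 < \<delta>" "\<delta> \<le> 1" by auto
    have \<Omega>: "open \<Omega>" and sub: "weak_subsolution \<mu> p \<Omega> u" using \<Omega>u by (auto simp: bounded_domain_def)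
    have um: "u \<in> borel_measurable lebesgue"
      using sub by (intro Lp_loc_UNIV_measurable[of "p - 1"]) (simp add: weak_subsolution_def tail_space_def)
    obtain u' where u': "u' \<in> borel_measurable borel" "AE x in lborel. u x = u' x"
      using completion_ex_borel_measurable_real[OF um] by auto
    note [measurable] = u'(1)
    define B where "B = ball x0 (r / 2)"
    define E where "E = C * \<delta> powr (- ((p - 1) * sobolev_eta DIM('a) p) / ((sobolev_eta DIM('a) p - 1) * p))"
    have E: "0 < E" using C \<delta> by (simp add: E_def)
    define T where "T = Tail \<mu> p (\<lambda>x. max (u x) 0) x0 (r / 2)"
    define M where "M = Lp_average p (ball x0 r) (\<lambda>x. max (u x) 0)"
    have "esssup (lebesgue_on B) (\<lambda>x. ereal (u x)) \<le> enn2ereal (ennreal \<delta> * T + ennreal E * M)"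
    \<comment> \<open>Both coefficients are positive, so an infinite tail or average makes the right
      side infinite. Otherwise the iteration can be fed with real numbers.\<close>
    proof (cases "T = \<infinity> \<or> M = \<infinity>")
      case True
      then have top: "ennreal \<delta> * T + ennreal E * M = \<infinity>" using \<delta> E by (auto simp: ennreal_mult_top ennreal_top_mult)
      show ?thesis unfolding top by simp
    next
      case False
      define I where "I = tail_kernel p u x0 (r / 2)"
      define TT where "TT = tail_integral \<mu> p u x0 (r / 2)"
      have [measurable]: "I \<in> borel_measurable \<mu>" unfolding I_def by (rule tail_kernel_measurable[OF mu_borel u'])
      have [measurable]: "frac_const DIM('a) p \<in> borel_measurable \<mu>"
        using frac_const_bound(2)[OF p, of "DIM('a)"] by (intro measurable_unit_interval_borel(4)[OF mu_borel]) (simp add: Suc_le_eq)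
      note [measurable] = measurable_unit_interval_borel(2)[OF mu_borel]
      define X where "X = (\<integral>\<^sup>+s\<in>{0<..<1}. ennreal (frac_const DIM('a) p s * (r / 2) powr p) * I s \<partial>\<mu>)"
      have T_eq: "T = ennreal_powr X (1 / (p - 1))" unfolding T_def Tail_def X_def I_def tail_kernel_def by simp
      have "X = (\<integral>\<^sup>+s. ennreal ((r / 2) powr p) * (ennreal (frac_const DIM('a) p s) * I s * indicator {0<..<1} s) \<partial>\<mu>)"
        unfolding X_def by (intro nn_integral_cong) (simp add: ennreal_mult'' mult_ac)
      also have "\<dots> = ennreal ((r / 2) powr p) * TT" unfolding TT_def tail_integral_def I_def[symmetric] by (rule nn_integral_cmult) measurable
      finally have X_TT: "X = ennreal ((r / 2) powr p) * TT" .
      have Xfin: "X \<noteq> \<infinity>" using False T_eq by (auto simp: ennreal_powr_def)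
      define x where "x = enn2real X"
      have X_eq: "X = ennreal x" using Xfin by (simp add: x_def less_top)
      \<comment> \<open>The real value of the tail: its power p - 1 recovers X, which is the form
        that the iteration asks for.\<close>
      define t where "t = x powr (1 / (p - 1))"
      have T_t: "T = ennreal t" using Xfin by (simp add: T_eq ennreal_powr_def t_def x_def)
      have "t powr (p - 1) = x" using p by (simp add: t_def powr_powr x_def)
      have "TT = ennreal (1 / (r / 2) powr p) * X"
        unfolding X_TT using r by (simp add: mult.assoc[symmetric] ennreal_mult[symmetric])
      also have "\<dots> = ennreal (x / (r / 2) powr p)" unfolding X_eq by (simp add: ennreal_mult[symmetric] x_def)
      finally have TT: "TT \<le> ennreal (t powr (p - 1) / (r / 2) powr p)" using \<open>t powr (p - 1) = x\<close> by simp
      define A where "A = (\<integral>\<^sup>+x. ennreal (max (u' x) 0 powr p) * indicator (ball x0 r) x \<partial>lborel)"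
      have M_eq: "M = ennreal_powr (A / ennreal (r powr real DIM('a) * V)) (1 / p)"
      proof -
        have "(\<integral>\<^sup>+x\<in>ball x0 r. ennreal (\<bar>max (u x) 0\<bar> powr p) \<partial>lebesgue) = A"
          unfolding nn_integral_completion A_def by (rule nn_integral_cong_AE) (use u'(2) in eventually_elim, simp)
        moreover have "emeasure lebesgue (ball x0 r) = ennreal (r powr real DIM('a) * V)"
          using emeasure_ball_powr[OF r(1), of x0] by (simp add: V_def)
        ultimately show ?thesis unfolding M_def Lp_average_def by simp
      qed
      have Afin: "A \<noteq> \<infinity>"
      proof
        assume "A = \<infinity>"
        then have "A / ennreal (r powr real DIM('a) * V) = \<infinity>" by (simp add: ennreal_top_divide)
        then show False using False M_eq by (simp add: ennreal_powr_def)
      qed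
      define a where "a = enn2real A"
      have a: "0 \<le> a" "A = ennreal a" using Afin by (simp_all add: a_def less_top)
      define \<alpha> where "\<alpha> = (a / (V * r powr real DIM('a))) powr (1 / p)"
      have M_\<alpha>: "M = ennreal \<alpha>"
        using V r a by (simp add: M_eq divide_ennreal ennreal_powr_def \<alpha>_def mult.commute)
      define z where "z = \<delta> * t + E * \<alpha>"
      have z0: "0 \<le> z" using \<delta> E by (simp add: z_def t_def \<alpha>_def)
      have RHS: "enn2ereal (ennreal \<delta> * T + ennreal E * M) = ereal z"
      proof -
        have "ennreal \<delta> * T + ennreal E * M = ennreal z"
          unfolding T_t M_\<alpha> z_def using \<delta> E by (simp add: ennreal_mult ennreal_plus t_def \<alpha>_def)
        then show ?thesis using z0 by (simp add: enn2ereal_ennreal)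
      qed
      \<comment> \<open>Levels strictly above z are used because the iteration requires K0 > 0,
        while z may be 0; density of the order then gives the bound by z itself.\<close>
      have bound: "esssup (lebesgue_on B) (\<lambda>x. ereal (u x)) \<le> ereal K0" if K0: "z < K0" for K0
      proof -
        have tn: "0 \<le> t" by (simp add: t_def)
        have "0 \<le> E * \<alpha>" "0 \<le> \<delta> * t" using E \<delta> by (simp_all add: \<alpha>_def t_def)
        then have K: "\<delta> * t \<le> K0" "E * \<alpha> \<le> K0" "0 < K0" using K0 z0 by (auto simp: z_def)
        have "AE x in lborel. x \<in> ball x0 (r / 2) \<longrightarrow> u' x \<le> K0"
          by (rule iter[OF \<Omega> sub u' rO r \<delta> K(3) tn K(1) TT[unfolded TT_def] a(1) a(2)[unfolded A_def]])
            (use K(2) in \<open>simp add: E_def \<alpha>_def V_def\<close>)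
        then have "AE x in lborel. x \<in> B \<longrightarrow> ereal (u x) \<le> ereal K0"
          using u'(2) by eventually_elim (simp add: B_def)
        then have "AE x in lebesgue_on B. ereal (u x) \<le> ereal K0"
          by (subst AE_restrict_space_iff) (auto simp: B_def intro: AE_completion)
        \<comment> \<open>Measurability of u matters here: it is what lets \<open>esssup\<close> be
          read as the infimum of the almost everywhere upper bounds.\<close>
        moreover have "(\<lambda>x. ereal (u x)) \<in> borel_measurable (lebesgue_on B)"
          using um by (intro borel_measurable_ereal measurable_restrict_space1)
        ultimately show ?thesis by (subst esssup_eq_AE) (auto intro: Inf_lower)
      qed
      show ?thesis unfolding RHS
      proof (rule dense_ge)
        fix y assume "ereal z < y"
        then show "esssup (lebesgue_on B) (\<lambda>x. ereal (u x)) \<le> y"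
          using bound by (cases y) auto
      qed
    qed
    then show "esssup (lebesgue_on (ball x0 (r / 2))) (\<lambda>x. ereal (u x)) \<le>
      enn2ereal
        (ennreal \<delta> * Tail \<mu> p (\<lambda>x. max (u x) 0) x0 (r / 2) +
         ennreal (C * \<delta> powr (- ((p - 1) * sobolev_eta DIM('a) p) /
                                ((sobolev_eta DIM('a) p - 1) * p))) *
         Lp_average p (ball x0 r) (\<lambda>x. max (u x) 0))"
      unfolding B_def E_def T_def M_def .
  qed
qed

end
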